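(* Let $n\ge 2$ and $1\le r\le n-1$. The group $T_{n,r}$ has the $R_\infty$ property: for every automorphism $\varphi$ of $T_{n,r}$, the equivalence relation on $T_{n,r}$ in which $x$ is equivalent to $y$ if there is $h\in T_{n,r}$ with $h^{-1}x\,(h)\varphi=y$ has infinitely many equivalence classes.
   Context: Maps act on the right. $X_n=\{0,\ldots,n-1\}$, $X_n^*$ is the set of finite words over $X_n$, $\dot{\mathbf r}=\{\dot 0,\ldots,\dot{(r-1)}\}$ is a further ordered alphabet, $X_{n,r}^+=\{\dot a w:\dot a\in\dot{\mathbf r},\,w\in X_n^*\}$, $\mathfrak C_n=X_n^\omega$, and $\mathfrak C_{n,r}=\{\dot a x:\dot a\in\dot{\mathbf r},\,x\in\mathfrak C_n\}$ is a Cantor space; $U_\nu$ is the set of infinite words with prefix $\nu$. A complete antichain is a finite set of pairwise prefix-incomparable words $u\in X_{n,r}^+$ whose sets $U_u$ cover $\mathfrak C_{n,r}$; it is listed in lexicographic order. $T_{n,r}$ is the group of homeomorphisms $g$ of $\mathfrak C_{n,r}$ for which there are complete antichains $\{u_0,\ldots,u_{l-1}\}$, $\{v_0,\ldots,v_{l-1}\}$ of the same size and a fixed $j$ with $(u_i x)g=v_{(i+j)\bmod l}\,x$ for all $i$ and all $x\in\mathfrak C_n$. *)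

theory Defs
  imports
    "HOL-Analysis.Analysis"
    "HOL-Algebra.Group"
    "HOL-Library.Omega_Words_Fun"
    "HOL-Library.Sublist"
begin

text \<open>
  A word that starts with a dotted letter is a pair: the index of the dotted letter, and the
  remaining word over \<open>{0,\<dots>,n-1}\<close>, which is a list for a finite word and a function on
  \<open>nat\<close> for an infinite one.
\<close>

type_synonym fin_word = "nat \<times> nat list"
type_synonym inf_word = "nat \<times> (nat \<Rightarrow> nat)"

definition cantor :: "nat \<Rightarrow> (nat \<Rightarrow> nat) set" where
  "cantor n = {x. \<forall>k. x k < n}"

definition dotted_cantor :: "nat \<Rightarrow> nat \<Rightarrow> inf_word set" where
  "dotted_cantor n r = {..<r} \<times> cantor n"

definition dotted_words :: "nat \<Rightarrow> nat \<Rightarrow> fin_word set" where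
  "dotted_words n r = {..<r} \<times> lists {..<n}"

definition cantor_topology :: "nat \<Rightarrow> nat \<Rightarrow> inf_word topology" where
  "cantor_topology n r =
     prod_topology (discrete_topology {..<r})
       (product_topology (\<lambda>_. discrete_topology {..<n}) UNIV)"

lemma topspace_cantor_topology: "topspace (cantor_topology n r) = dotted_cantor n r"
  by (auto simp: cantor_topology_def dotted_cantor_def cantor_def PiE_def Pi_def)

definition append_inf :: "fin_word \<Rightarrow> (nat \<Rightarrow> nat) \<Rightarrow> inf_word" where
  "append_inf u x = (fst u, snd u \<frown> x)"

definition cone :: "nat \<Rightarrow> fin_word \<Rightarrow> inf_word set" where
  "cone n u = append_inf u ` cantor n"

definition dotted_prefix :: "fin_word \<Rightarrow> fin_word \<Rightarrow> bool" where
  "dotted_prefix u v \<longleftrightarrow> fst u = fst v \<and> prefix (snd u) (snd v)"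

definition lex_less :: "fin_word \<Rightarrow> fin_word \<Rightarrow> bool" where
  "lex_less u v \<longleftrightarrow> (u, v) \<in> less_than <*lex*> lexord less_than"

definition complete_antichain :: "nat \<Rightarrow> nat \<Rightarrow> fin_word set \<Rightarrow> bool" where
  "complete_antichain n r A \<longleftrightarrow>
     finite A \<and> A \<subseteq> dotted_words n r \<and>
     (\<forall>u\<in>A. \<forall>v\<in>A. u \<noteq> v \<longrightarrow> \<not> dotted_prefix u v) \<and>
     (\<Union>u\<in>A. cone n u) = dotted_cantor n r"

definition lists_antichain :: "nat \<Rightarrow> nat \<Rightarrow> fin_word list \<Rightarrow> bool" where
  "lists_antichain n r us \<longleftrightarrow> complete_antichain n r (set us) \<and> sorted_wrt lex_less us"

definition T_carrier :: "nat \<Rightarrow> nat \<Rightarrow> (inf_word \<Rightarrow> inf_word) set" where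
  "T_carrier n r =
     {g \<in> extensional (dotted_cantor n r).
        homeomorphic_map (cantor_topology n r) (cantor_topology n r) g \<and>
        (\<exists>us vs j. lists_antichain n r us \<and> lists_antichain n r vs \<and> length us = length vs \<and>
           (\<forall>i<length us. \<forall>x\<in>cantor n.
              g (append_inf (us ! i) x) = append_inf (vs ! ((i + j) mod length us)) x))}"

text \<open>Maps act on the right, so the product of \<open>g\<close> and \<open>h\<close> applies \<open>g\<close> first.\<close>

definition T_group :: "nat \<Rightarrow> nat \<Rightarrow> (inf_word \<Rightarrow> inf_word) monoid" where
  "T_group n r =
     \<lparr>carrier = T_carrier n r,
      mult = (\<lambda>g h. compose (dotted_cantor n r) h g),
      one = (\<lambda>x\<in>dotted_cantor n r. x)\<rparr>"

definition twisted_conj :: "('a, 'b) monoid_scheme \<Rightarrow> ('a \<Rightarrow> 'a) \<Rightarrow> ('a \<times> 'a) set" where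
  "twisted_conj G \<phi> =
     {(x, y). x \<in> carrier G \<and> y \<in> carrier G \<and>
        (\<exists>h\<in>carrier G. inv\<^bsub>G\<^esub> h \<otimes>\<^bsub>G\<^esub> x \<otimes>\<^bsub>G\<^esub> \<phi> h = y)}"

definition R_infinity :: "('a, 'b) monoid_scheme \<Rightarrow> bool" where
  "R_infinity G \<longleftrightarrow> (\<forall>\<phi>\<in>iso G G. infinite (carrier G // twisted_conj G \<phi>))"

end

theory Submission
  imports Defs
begin

text \<open>
  Rubin's method recovers the action from the group: whether the closed support of \<open>k\<close> lies in that
  of \<open>f\<close> can be expressed by commutation alone (following the proof of Belk, Elliott and Matucci), and
  the closed supports are clopen, so that every automorphism \<open>\<phi>\<close> is conjugation by a homeomorphism
  \<open>\<sigma>\<close> of the Cantor space. Two distinct points have the same stabilizer iff no point lies between them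
  on the circle; so \<open>\<sigma>\<close> permutes these gaps. After composing with an element of the group, \<open>\<sigma>\<close>
  fixes the gap formed by the largest and the smallest point, and is then increasing or decreasing.

  Twisted conjugacy of \<open>x\<close> and \<open>y\<close> is conjugacy of \<open>\<sigma>\<inverse>x\<close> and \<open>\<sigma>\<inverse>y\<close> by an element \<open>h\<close> of the
  group. If \<open>\<sigma>\<close> is increasing and \<open>x\<close> is a large power of an element that moves all points up, then
  \<open>\<sigma>\<inverse>x\<close> fixes only the smallest and the largest point, and so does its conjugate; hence \<open>h\<close> fixes
  the smallest point, and the logarithm of the slope of \<open>x\<close> there is an invariant. If \<open>\<sigma>\<close> is
  decreasing, then \<open>\<sigma>\<inverse>x\<close> exchanges the two points of at most one further gap, and if \<open>h\<close> fixes the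
  base gap, the sum of the two logarithmic slopes at this gap is an invariant.
\<close>

text \<open>The obstacle is that \<sigma> is only known to be a homeomorphism that normalizes the
  group. It need not replace prefixes anywhere, so it has no slope of its own and may distort the
  space badly near its fixed points. Two devices stand in for the missing slope. The germs at the
  smallest point of the elements fixing it form an infinite cyclic group, on which the logarithm of
  the slope is an isomorphism to the integers; an increasing \<sigma> induces an automorphism of it
  by conjugation, and preservation of the order excludes the change of sign. Hence an element that
  moves points up has the same germ as its conjugate, \<sigma> commutes with it near an end of the
  circle, and a bound for \<sigma> on one fundamental domain is a bound on a whole neighbourhood of
  that end; a high power sweeps across the rest. A decreasing \<sigma> interchanges the slopes at
  the two ends of the base gap, which is why only their sum can be compared; the test elements for
  this case are trivial near the largest point.\<close>

section \<open>Leaves and the cyclic order\<close>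

text \<open>
  The words with \<open>N\<close> undotted letters are numbered in lexicographic order; \<open>pval n N x\<close> is the number
  of the prefix of \<open>x\<close>. So \<open>x\<close> precedes \<open>y\<close> iff \<open>pval n N x < pval n N y\<close> for some \<open>N\<close>.
\<close>

primrec pval :: "nat \<Rightarrow> nat \<Rightarrow> inf_word \<Rightarrow> nat" where
  "pval n 0 x = fst x"
| "pval n (Suc N) x = n * pval n N x + snd x N"

definition tail :: "nat \<Rightarrow> inf_word \<Rightarrow> nat \<Rightarrow> nat" where
  "tail N x = (\<lambda>i. snd x (N + i))"

lemma mem_dotted_cantor: "x \<in> dotted_cantor n r \<longleftrightarrow> fst x < r \<and> (\<forall>i. snd x i < n)"
  by (cases x) (auto simp: dotted_cantor_def cantor_def)

locale thompson =
  fixes n r :: nat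
  assumes n2: "2 \<le> n" and r1: "1 \<le> r"
begin

abbreviation C :: "inf_word set" where "C \<equiv> dotted_cantor n r"

abbreviation val :: "nat \<Rightarrow> inf_word \<Rightarrow> nat" where "val \<equiv> pval n"

text \<open>The inverse of the map from \<open>x\<close> to \<open>(val N x, tail N x)\<close>: the
  leading quotient and the base-\<open>n\<close> digits of the leaf number \<open>k\<close> are read
  back as the dotted letter and the first \<open>N\<close> letters.\<close>

definition pt :: "nat \<Rightarrow> nat \<Rightarrow> (nat \<Rightarrow> nat) \<Rightarrow> inf_word" where
  "pt N k w = (k div n ^ N, \<lambda>i. if i < N then (k div n ^ (N - 1 - i)) mod n else w (i - N))"

definition mn :: inf_word where "mn = (0, \<lambda>_. 0)"
definition mx :: inf_word where "mx = (r - 1, \<lambda>_. n - 1)"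

definition lo :: "nat \<Rightarrow> nat \<Rightarrow> inf_word" where "lo N k = pt N k (\<lambda>_. 0)"
definition hi :: "nat \<Rightarrow> nat \<Rightarrow> inf_word" where "hi N k = pt N k (\<lambda>_. n - 1)"

lemma n_pos: "0 < n" using n2 by simp

lemma leaf_pos: "0 < r * n ^ N"
  using n_pos r1 by simp

lemma fst_less: "x \<in> C \<Longrightarrow> fst x < r"
  and snd_less: "x \<in> C \<Longrightarrow> snd x i < n"
  by (auto simp: mem_dotted_cantor)

lemma tail_cantor: "x \<in> C \<Longrightarrow> tail N x \<in> cantor n"
  by (auto simp: tail_def cantor_def snd_less)

lemma val_Suc_div: "x \<in> C \<Longrightarrow> val (Suc N) x div n = val N x"
  using snd_less[of x N] by simp

lemma val_Suc_mod: "x \<in> C \<Longrightarrow> val (Suc N) x mod n = snd x N"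
  using snd_less[of x N] by simp

lemma val_div: "x \<in> C \<Longrightarrow> val (N + k) x div n ^ k = val N x"
proof (induction k)
  case (Suc k)
  have "val (N + Suc k) x div n ^ Suc k = val (Suc (N + k)) x div n div n ^ k"
    by (simp only: power_Suc add_Suc_right div_mult2_eq)
  then show ?case using Suc val_Suc_div[of x "N + k"] by simp
qed simp

lemma val_div': "x \<in> C \<Longrightarrow> N \<le> M \<Longrightarrow> val N x = val M x div n ^ (M - N)"
  using val_div[of x N "M - N"] by simp

lemma val_eq_mono: "x \<in> C \<Longrightarrow> y \<in> C \<Longrightarrow> val M x = val M y \<Longrightarrow> N \<le> M \<Longrightarrow> val N x = val N y"
  by (simp add: val_div')

lemma val_le_mono: "x \<in> C \<Longrightarrow> y \<in> C \<Longrightarrow> val M x \<le> val M y \<Longrightarrow> N \<le> M \<Longrightarrow> val N x \<le> val N y"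
  by (simp add: val_div' div_le_mono)

lemma val_less_mono: "x \<in> C \<Longrightarrow> y \<in> C \<Longrightarrow> val N x < val N y \<Longrightarrow> N \<le> M \<Longrightarrow> val M x < val M y"
  using val_le_mono[of y x M N] by (meson not_le)

lemma val_bound: "x \<in> C \<Longrightarrow> val N x < r * n ^ N"
proof (induction N)
  case 0 then show ?case by (simp add: fst_less)
next
  case (Suc N)
  then have "val (Suc N) x div n < r * n ^ N" by (simp only: val_Suc_div)
  then have "val (Suc N) x < r * n ^ N * n" using n_pos by (simp only: div_less_iff_less_mult)
  then show ?case by (simp only: power_Suc mult_ac)
qed

lemma val_eq_iff:
  assumes "x \<in> C" "y \<in> C"
  shows "val N x = val N y \<longleftrightarrow> fst x = fst y \<and> (\<forall>i<N. snd x i = snd y i)"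
proof (induction N)
  case (Suc N)
  have "val (Suc N) x = val (Suc N) y \<longleftrightarrow> val N x = val N y \<and> snd x N = snd y N"
    using val_Suc_div[OF assms(1), of N] val_Suc_div[OF assms(2), of N]
      val_Suc_mod[OF assms(1), of N] val_Suc_mod[OF assms(2), of N] by force
  then show ?case using Suc by (auto simp: less_Suc_eq)
qed simp

lemma point_eqI: "x \<in> C \<Longrightarrow> y \<in> C \<Longrightarrow> val N x = val N y \<Longrightarrow> tail N x = tail N y \<Longrightarrow> x = y"
proof (rule prod_eqI)
  assume a: "x \<in> C" "y \<in> C" "val N x = val N y" "tail N x = tail N y"
  show "fst x = fst y" using a val_eq_iff by blast
  show "snd x = snd y"
  proof
    fix i
    show "snd x i = snd y i"
    proof (cases "i < N")
      case True then show ?thesis using a val_eq_iff by blast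
    next
      case False
      then have "snd x i = tail N x (i - N)" "snd y i = tail N y (i - N)" by (auto simp: tail_def)
      then show ?thesis using a by simp
    qed
  qed
qed

lemma val_ext: "x \<in> C \<Longrightarrow> y \<in> C \<Longrightarrow> (\<And>N. val N x = val N y) \<Longrightarrow> x = y"
  by (meson lessI prod_eqI ext val_eq_iff)

lemma pt_in: "k < r * n ^ N \<Longrightarrow> w \<in> cantor n \<Longrightarrow> pt N k w \<in> C"
  using n_pos by (auto simp: mem_dotted_cantor pt_def cantor_def less_mult_imp_div_less)

lemma val_pt_le: "M \<le> N \<Longrightarrow> val M (pt N k w) = k div n ^ (N - M)"
proof (induction M)
  case 0 then show ?case by (simp add: pt_def)
next
  case (Suc M)
  have e: "N - M = Suc (N - Suc M)" using Suc by simp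
  have s: "snd (pt N k w) M = (k div n ^ (N - Suc M)) mod n" using Suc by (simp add: pt_def)
  have "k div n ^ (N - M) = k div n ^ (N - Suc M) div n"
    unfolding e power_Suc by (simp only: mult.commute[of n] div_mult2_eq)
  with Suc s show ?case by simp
qed

lemma val_pt [simp]: "val N (pt N k w) = k"
  using val_pt_le[of N N] by simp

lemma tail_pt [simp]: "tail N (pt N k w) = w"
  by (auto simp: tail_def pt_def)

lemma pt_val: "x \<in> C \<Longrightarrow> pt N (val N x) (tail N x) = x"
  by (intro point_eqI[of _ _ N] pt_in val_bound tail_cantor) auto

lemma zero_cantor: "(\<lambda>_. 0) \<in> cantor n" and last_cantor: "(\<lambda>_. n - 1) \<in> cantor n"
  using n_pos by (auto simp: cantor_def)

lemma lo_in: "k < r * n ^ N \<Longrightarrow> lo N k \<in> C" and hi_in: "k < r * n ^ N \<Longrightarrow> hi N k \<in> C"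
  unfolding lo_def hi_def by (intro pt_in zero_cantor last_cantor; assumption)+

lemma val_lo [simp]: "val N (lo N k) = k" and val_hi [simp]: "val N (hi N k) = k"
  by (simp_all add: lo_def hi_def)

lemma mn_in: "mn \<in> C" and mx_in: "mx \<in> C"
  using n_pos r1 by (auto simp: mem_dotted_cantor mn_def mx_def)

lemma val_mn [simp]: "val N mn = 0"
  by (induction N) (auto simp: mn_def)

lemma val_mx: "Suc (val N mx) = r * n ^ N"
proof (induction N)
  case 0 then show ?case using r1 by (simp add: mx_def)
next
  case (Suc N)
  have "n * Suc (val N mx) = n * (r * n ^ N)" using Suc by simp
  moreover have "snd mx N = n - 1" by (simp add: mx_def)
  ultimately show ?case using n_pos by (simp add: mult_ac)
qed

lemma val_lo_add: "val (N + j) (lo N k) = k * n ^ j"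
proof (induction j)
  case (Suc j)
  have "snd (lo N k) (N + j) = 0" by (simp add: lo_def pt_def)
  with Suc show ?case by simp
qed simp

lemma val_hi_add: "Suc (val (N + j) (hi N k)) = Suc k * n ^ j"
proof (induction j)
  case (Suc j)
  have "snd (hi N k) (N + j) = n - 1" by (simp add: hi_def pt_def)
  then have "Suc (val (N + Suc j) (hi N k)) = n * Suc (val (N + j) (hi N k))" using n_pos by simp
  with Suc show ?case by (simp add: algebra_simps del: pval.simps)
qed simp

section \<open>The linear and the cyclic order of the points\<close>

definition lt :: "inf_word \<Rightarrow> inf_word \<Rightarrow> bool" (infix "\<sqsubset>" 50) where
  "x \<sqsubset> y \<longleftrightarrow> (\<exists>N. val N x < val N y)"

definition cyc :: "inf_word \<Rightarrow> inf_word \<Rightarrow> inf_word \<Rightarrow> bool" where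
  "cyc x y z \<longleftrightarrow> x \<sqsubset> y \<and> y \<sqsubset> z \<or> y \<sqsubset> z \<and> z \<sqsubset> x \<or> z \<sqsubset> x \<and> x \<sqsubset> y"

lemma lt_irrefl [simp]: "\<not> x \<sqsubset> x" by (simp add: lt_def)

lemma lt_trans: "x \<in> C \<Longrightarrow> y \<in> C \<Longrightarrow> z \<in> C \<Longrightarrow> x \<sqsubset> y \<Longrightarrow> y \<sqsubset> z \<Longrightarrow> x \<sqsubset> z"
  unfolding lt_def by (meson val_less_mono less_trans nat_le_linear order_refl)

lemma lt_asym: "x \<in> C \<Longrightarrow> y \<in> C \<Longrightarrow> x \<sqsubset> y \<Longrightarrow> \<not> y \<sqsubset> x"
  using lt_trans lt_irrefl by blast

lemma lt_total: "x \<in> C \<Longrightarrow> y \<in> C \<Longrightarrow> x \<noteq> y \<Longrightarrow> x \<sqsubset> y \<or> y \<sqsubset> x"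
  unfolding lt_def using val_ext by (meson linorder_neqE_nat)

lemma lt_le: "x \<in> C \<Longrightarrow> y \<in> C \<Longrightarrow> x \<sqsubset> y \<Longrightarrow> val N x \<le> val N y"
  using lt_asym lt_def by (meson not_le)

lemma nlt_le: "\<not> y \<sqsubset> x \<Longrightarrow> val N x \<le> val N y"
  by (auto simp: lt_def not_less)

lemma le_lt_trans: "x \<in> C \<Longrightarrow> y \<in> C \<Longrightarrow> z \<in> C \<Longrightarrow> \<not> y \<sqsubset> x \<Longrightarrow> y \<sqsubset> z \<Longrightarrow> x \<sqsubset> z"
  by (metis lt_total lt_trans)

lemma lt_le_trans: "x \<in> C \<Longrightarrow> y \<in> C \<Longrightarrow> z \<in> C \<Longrightarrow> x \<sqsubset> y \<Longrightarrow> \<not> z \<sqsubset> y \<Longrightarrow> x \<sqsubset> z"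
  by (metis lt_total lt_trans)

lemma lt_shift: "x \<in> C \<Longrightarrow> y \<in> C \<Longrightarrow> x \<sqsubset> y \<Longrightarrow> \<exists>N\<ge>M. val N x < val N y"
  unfolding lt_def by (meson val_less_mono nat_le_linear order_refl)

lemma neq_val: "x \<in> C \<Longrightarrow> y \<in> C \<Longrightarrow> x \<noteq> y \<Longrightarrow> \<exists>N. \<forall>M\<ge>N. val M x \<noteq> val M y"
  using val_ext val_eq_mono by metis

lemma mn_least: "x \<in> C \<Longrightarrow> \<not> x \<sqsubset> mn"
  by (simp add: lt_def)

lemma mx_greatest: "x \<in> C \<Longrightarrow> \<not> mx \<sqsubset> x"
  using val_bound val_mx by (metis lt_def not_less_eq)

lemma mn_lt: "x \<in> C \<Longrightarrow> x \<noteq> mn \<Longrightarrow> mn \<sqsubset> x"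
  using lt_total mn_least mn_in by blast

lemma lt_mx: "x \<in> C \<Longrightarrow> x \<noteq> mx \<Longrightarrow> x \<sqsubset> mx"
  using lt_total mx_greatest mx_in by blast

lemma lo_least:
  assumes "x \<in> C" "k \<le> val N x" shows "\<not> x \<sqsubset> lo N k"
proof
  assume "x \<sqsubset> lo N k"
  have kN: "k < r * n ^ N" using assms val_bound le_less_trans by blast
  obtain M where M: "M \<ge> N" "val M x < val M (lo N k)"
    using lt_shift[OF assms(1) lo_in[OF kN] \<open>x \<sqsubset> lo N k\<close>] by blast
  have "val M (lo N k) = k * n ^ (M - N)" using val_lo_add[of N "M - N" k] M by simp
  also have "\<dots> \<le> val N x * n ^ (M - N)" using assms by simp
  also have "\<dots> \<le> val M x" using val_div'[OF assms(1) M(1)] by (metis div_times_less_eq_dividend)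
  finally show False using M by simp
qed

lemma hi_greatest:
  assumes "x \<in> C" "val N x \<le> k" "k < r * n ^ N" shows "\<not> hi N k \<sqsubset> x"
proof
  assume "hi N k \<sqsubset> x"
  obtain M where M: "M \<ge> N" "val M (hi N k) < val M x"
    using lt_shift[OF hi_in[OF assms(3)] assms(1) \<open>hi N k \<sqsubset> x\<close>] by blast
  have "Suc (val M (hi N k)) = Suc k * n ^ (M - N)" using val_hi_add[of N "M - N" k] M by simp
  moreover have "val M x < Suc k * n ^ (M - N)"
    using val_div'[OF assms(1) M(1)] assms(2) n_pos by (simp add: div_less_iff_less_mult flip: less_Suc_eq_le)
  ultimately show False using M by simp
qed

lemma lo_eq_mn: "lo N 0 = mn"
  using mn_least[of "lo N 0"] lo_least[of mn 0 N] mn_in lt_total[of mn "lo N 0"] leaf_pos[of N] lo_in[of 0 N]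
  by (metis le0)

lemma hi_eq_mx: "hi N (r * n ^ N - 1) = mx"
proof -
  have l: "r * n ^ N - 1 < r * n ^ N" using leaf_pos by simp
  have "val N mx \<le> r * n ^ N - 1" using val_mx[of N] by simp
  from hi_greatest[OF mx_in this l] lt_mx[OF hi_in[OF l]] show ?thesis by blast
qed

text \<open>Compactness in the manner of Koenig's lemma: \<open>v N\<close> is the least leaf of
  depth \<open>N\<close> visited infinitely often. Taking the least one makes the choices at
  different depths compatible, so that they are the prefixes of one point.\<close>

lemma accumulation:
  fixes y :: "nat \<Rightarrow> inf_word"
  assumes y: "\<And>M. y M \<in> C"
  obtains z where "z \<in> C" "\<And>N. \<exists>M\<ge>N. val N (y M) = val N z"
proof -
  define A where "A N k = {M. val N (y M) = k}" for N k
  define v where "v N = (LEAST k. infinite (A N k))" for N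
  have ex: "\<exists>k. infinite (A N k)" for N
  proof (rule ccontr)
    assume "\<nexists>k. infinite (A N k)"
    then have "finite (\<Union>k<r * n ^ N. A N k)" by auto
    moreover have "(\<Union>k<r * n ^ N. A N k) = UNIV" using val_bound[OF y] by (auto simp: A_def)
    ultimately show False by simp
  qed
  have vinf: "infinite (A N (v N))" for N unfolding v_def using ex[of N] by (rule LeastI_ex)
  have vle: "v N \<le> k" if "infinite (A N k)" for N k unfolding v_def using that by (rule Least_le)
  have vdiv: "v (Suc N) div n = v N" for N
  proof -
    have "A (Suc N) k \<subseteq> A N (k div n)" for k
      using val_Suc_div[OF y] by (auto simp: A_def simp del: pval.simps)
    then have "infinite (A N (v (Suc N) div n))" using vinf finite_subset by blast
    then have a: "v N \<le> v (Suc N) div n" by (rule vle)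
    have "A N (v N) \<subseteq> (\<Union>i<n. A (Suc N) (n * v N + i))"
      using snd_less[OF y] by (auto simp: A_def)
    then have "infinite (\<Union>i<n. A (Suc N) (n * v N + i))" using vinf finite_subset by blast
    then obtain i where "i < n" "infinite (A (Suc N) (n * v N + i))" by auto
    then have "v (Suc N) \<le> n * v N + i" by (intro vle)
    then have "v (Suc N) div n \<le> (n * v N + i) div n" by (rule div_le_mono)
    then show ?thesis using a \<open>i < n\<close> by simp
  qed
  define z where "z = (v 0, \<lambda>N. v (Suc N) mod n)"
  have vz: "val N z = v N" for N
  proof (induction N)
    case (Suc N)
    then have "val (Suc N) z = n * (v (Suc N) div n) + v (Suc N) mod n" by (simp add: z_def vdiv)
    then show ?case by simp
  qed (simp add: z_def)
  have "A 0 (v 0) \<noteq> {}" using vinf[of 0] by (metis finite.emptyI)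
  then obtain M where "fst (y M) = v 0" by (auto simp: A_def)
  then have "v 0 < r" using fst_less[OF y[of M]] by simp
  then have z: "z \<in> C" using n_pos by (auto simp: mem_dotted_cantor z_def)
  have "\<exists>M\<ge>N. val N (y M) = val N z" for N
    using vinf[of N] unfolding infinite_nat_iff_unbounded_le A_def vz by auto
  with z show ?thesis using that by blast
qed

text \<open>The Cantor space counterpart of a Lebesgue number: if every depth had a bad point, an
  accumulation point of the bad points would have a good neighbourhood containing some of
  them.\<close>

lemma uniform_depth:
  assumes ex: "\<And>x. x \<in> C \<Longrightarrow> \<exists>N. P N x"
    and mono: "\<And>x y N M. x \<in> C \<Longrightarrow> y \<in> C \<Longrightarrow> P N x \<Longrightarrow> N \<le> M \<Longrightarrow> val N y = val N x \<Longrightarrow> P M y"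
  obtains N where "\<And>x. x \<in> C \<Longrightarrow> P N x"
proof (rule ccontr)
  assume "\<not> thesis"
  then have "\<forall>N. \<exists>x. x \<in> C \<and> \<not> P N x" using that by blast
  then obtain y where y: "\<And>N. y N \<in> C" "\<And>N. \<not> P N (y N)" by metis
  obtain z where z: "z \<in> C" "\<And>N. \<exists>M\<ge>N. val N (y M) = val N z" using accumulation[of y] y by blast
  obtain N where "P N z" using ex z by blast
  moreover obtain M where "M \<ge> N" "val N (y M) = val N z" using z by blast
  ultimately show False using mono[of z "y M" N M] z y by blast
qed

section \<open>Gaps: pairs of points that are consecutive in the cyclic order\<close>

definition adj :: "inf_word \<Rightarrow> inf_word \<Rightarrow> bool" where
  "adj x y \<longleftrightarrow> x \<noteq> y \<and> (\<forall>w\<in>C. \<not> cyc x w y)"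

lemma adj_lt: "adj x y \<Longrightarrow> x \<sqsubset> y \<Longrightarrow> w \<in> C \<Longrightarrow> x \<sqsubset> w \<Longrightarrow> \<not> w \<sqsubset> y"
  unfolding adj_def cyc_def by blast

lemma adj_gt:
  assumes "adj x y" "y \<sqsubset> x" "x \<in> C" "y \<in> C"
  shows "x = mx \<and> y = mn"
proof (rule ccontr)
  assume "\<not> ?thesis"
  then have "x \<sqsubset> mx \<or> mn \<sqsubset> y" using assms lt_mx mn_lt by blast
  then have "cyc x mx y \<or> cyc x mn y" using assms(2) by (auto simp: cyc_def)
  then show False using assms mn_in mx_in by (auto simp: adj_def)
qed

lemma adj_leaf:
  assumes "Suc k < r * n ^ N"
  shows "adj (hi N k) (lo N (Suc k))" and "hi N k \<sqsubset> lo N (Suc k)"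
proof -
  let ?a = "hi N k" and ?b = "lo N (Suc k)"
  have C: "?a \<in> C" "?b \<in> C" using assms by (simp_all add: hi_in lo_in)
  show l: "?a \<sqsubset> ?b" by (auto simp: lt_def intro!: exI[of _ N])
  have "\<not> (?a \<sqsubset> w \<and> w \<sqsubset> ?b)" if "w \<in> C" for w
    using hi_greatest[of w N k] lo_least[of w "Suc k" N] that assms by linarith
  moreover have "\<not> ?b \<sqsubset> ?a" using lt_asym C l by blast
  ultimately show "adj ?a ?b" using l lt_irrefl unfolding adj_def cyc_def by metis
qed

text \<open>Depth 1 may have just two leaves (\<open>n = 2\<close>, \<open>r = 1\<close>), so the
  witness is taken at depth 2, where there are at least four.\<close>

lemma interior: "\<exists>w\<in>C. mn \<sqsubset> w \<and> w \<sqsubset> mx"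
proof -
  have "1 * 2 ^ 2 \<le> r * n ^ 2" using r1 n2 by (intro mult_mono power_mono) simp_all
  then have "4 \<le> r * n ^ 2" by simp
  then have b: "1 < r * n ^ 2" "1 < val 2 mx" using val_mx[of 2] by linarith+
  then have "mn \<sqsubset> lo 2 1" "lo 2 1 \<sqsubset> mx"
    by (auto simp: lt_def intro!: exI[of _ 2])
  then show ?thesis using lo_in b by blast
qed

lemma mn_neq_mx: "mn \<noteq> mx" and mn_lt_mx: "mn \<sqsubset> mx"
  using interior lt_trans mn_in mx_in lt_irrefl by metis+

lemma adj_mx_mn: "adj mx mn"
  using mn_neq_mx mn_least mx_greatest mn_lt_mx lt_asym[OF mn_in mx_in mn_lt_mx]
  by (auto simp: adj_def cyc_def)

lemma not_adj_mn_mx: "\<not> adj mn mx"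
  using interior by (auto simp: adj_def cyc_def)

lemma cyc_trichotomy:
  "x \<in> C \<Longrightarrow> y \<in> C \<Longrightarrow> z \<in> C \<Longrightarrow> x \<noteq> y \<Longrightarrow> y \<noteq> z \<Longrightarrow> x \<noteq> z \<Longrightarrow> cyc x y z \<or> cyc x z y"
  unfolding cyc_def by (metis lt_total)

lemma cyc_asym: "x \<in> C \<Longrightarrow> y \<in> C \<Longrightarrow> z \<in> C \<Longrightarrow> cyc x y z \<Longrightarrow> \<not> cyc x z y"
  unfolding cyc_def by (metis lt_asym)

lemma cyc_distinct: "x \<in> C \<Longrightarrow> y \<in> C \<Longrightarrow> z \<in> C \<Longrightarrow> cyc x y z \<Longrightarrow> x \<noteq> y \<and> y \<noteq> z \<and> x \<noteq> z"
  unfolding cyc_def by (metis lt_asym lt_irrefl)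

lemma cyc_rotate: "cyc x y z \<longleftrightarrow> cyc y z x"
  unfolding cyc_def by blast

lemma adj_unique_right: "x \<in> C \<Longrightarrow> y \<in> C \<Longrightarrow> z \<in> C \<Longrightarrow> adj x y \<Longrightarrow> adj x z \<Longrightarrow> y = z"
  using cyc_trichotomy[of x y z] unfolding adj_def by blast

lemma adj_unique_left: "x \<in> C \<Longrightarrow> y \<in> C \<Longrightarrow> z \<in> C \<Longrightarrow> adj x z \<Longrightarrow> adj y z \<Longrightarrow> x = y"
  using cyc_trichotomy[of x y z] cyc_rotate[of x z y] cyc_rotate[of z y x] unfolding adj_def by blast

text \<open>At a depth that separates the two ends, the smallest point of the leaf of
  \<open>y\<close> lies above \<open>x\<close> and not above \<open>y\<close>; as nothing lies
  strictly between, it is \<open>y\<close>. The base gap, where \<open>y = mn\<close>, is treated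
  apart.\<close>

lemma adj_right_lo:
  assumes "adj x y" "x \<in> C" "y \<in> C"
  obtains N where "y = lo N (val N y)"
proof (cases "x \<sqsubset> y")
  case True
  then obtain N where N: "val N x < val N y" by (auto simp: lt_def)
  have l: "lo N (val N y) \<in> C" using val_bound assms lo_in by blast
  have "x \<sqsubset> lo N (val N y)" using N by (auto simp: lt_def intro!: exI[of _ N])
  then have "\<not> lo N (val N y) \<sqsubset> y" using adj_lt assms True l by blast
  moreover have "\<not> y \<sqsubset> lo N (val N y)" using lo_least assms by blast
  ultimately show ?thesis using that lt_total l assms by blast
next
  case False
  then have "y \<sqsubset> x" using lt_total[of x y] assms unfolding adj_def by blast
  then have "y = mn" using adj_gt assms by blast
  then show ?thesis using that[of 0] lo_eq_mn[of 0] val_mn[of 0] by metis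
qed

text \<open>Used in contrapositive form: for two points that do not form a gap there are arbitrarily
  large depths at which the second one is not in the leaf following that of the first.\<close>

lemma adj_of_neighbouring_leaves:
  assumes "x \<in> C" "y \<in> C" and ev: "\<And>N. N \<ge> N0 \<Longrightarrow> val N y = Suc (val N x)"
  shows "adj x y"
proof -
  have xy: "x \<sqsubset> y" using ev[of N0] by (auto simp: lt_def intro!: exI[of _ N0])
  have "\<not> (x \<sqsubset> w \<and> w \<sqsubset> y)" if wC: "w \<in> C" for w
  proof
    assume w: "x \<sqsubset> w \<and> w \<sqsubset> y"
    then obtain M where M: "M \<ge> N0" "val M x < val M w" using lt_shift[OF assms(1) wC] by blast
    from w obtain M' where M': "M' \<ge> M" "val M' w < val M' y" using lt_shift[OF wC assms(2)] by blast
    have "val M' x < val M' w" using val_less_mono M M' assms wC by blast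
    then show False using ev[of M'] M M' by simp
  qed
  moreover have "\<not> y \<sqsubset> x" using lt_asym assms xy by blast
  ultimately show ?thesis using xy lt_irrefl unfolding adj_def cyc_def by metis
qed

end

section \<open>Locally prefix-replacing maps\<close>

definition seq_less :: "(nat \<Rightarrow> nat) \<Rightarrow> (nat \<Rightarrow> nat) \<Rightarrow> bool" where
  "seq_less w z \<longleftrightarrow> (\<exists>m. (\<forall>i<m. w i = z i) \<and> w m < z m)"

definition pre :: "nat \<Rightarrow> inf_word \<Rightarrow> fin_word" where
  "pre N x = (fst x, map (snd x) [0..<N])"

lemma tail_add: "tail (a + k) x = (\<lambda>i. tail a x (k + i))"
  by (simp add: tail_def add.assoc)

context thompson
begin

text \<open>Inside one leaf the order depends on the tails alone, so replacing a common prefix does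
  not affect it.\<close>

lemma lt_tail:
  assumes "x \<in> C" "y \<in> C" "val N x = val N y"
  shows "x \<sqsubset> y \<longleftrightarrow> seq_less (tail N x) (tail N y)"
proof -
  have less: "x \<sqsubset> y" if "x \<in> C" "y \<in> C" "val N x = val N y" "seq_less (tail N x) (tail N y)" for x y
  proof -
    obtain m where m: "\<forall>i<m. tail N x i = tail N y i" "tail N x m < tail N y m"
      using \<open>seq_less _ _\<close> by (auto simp: seq_less_def)
    have "snd x i = snd y i" if i: "i < N + m" for i
    proof (cases "i < N")
      case True
      then show ?thesis using val_eq_iff \<open>x \<in> C\<close> \<open>y \<in> C\<close> \<open>val N x = val N y\<close> by blast
    next
      case False
      then have "i - N < m" "N + (i - N) = i" using i by auto
      then show ?thesis using m(1) unfolding tail_def by metis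
    qed
    moreover have "fst x = fst y" using val_eq_iff that by blast
    ultimately have "val (N + m) x = val (N + m) y" using val_eq_iff that(1,2) by blast
    then have "val (Suc (N + m)) x < val (Suc (N + m)) y" using m(2) by (simp add: tail_def)
    then show ?thesis unfolding lt_def by blast
  qed
  have "seq_less w z \<or> seq_less z w" if "w \<noteq> z" for w z :: "nat \<Rightarrow> nat"
  proof -
    define m where "m = (LEAST m. w m \<noteq> z m)"
    have "\<exists>m. w m \<noteq> z m" using that by auto
    then have "w m \<noteq> z m" unfolding m_def by (rule LeastI_ex)
    moreover have "w i = z i" if "i < m" for i using not_less_Least that unfolding m_def by blast
    moreover have "seq_less w z" if "w m < z m" using calculation that unfolding seq_less_def by blast
    moreover have "seq_less z w" if "z m < w m" using calculation that unfolding seq_less_def by metis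
    ultimately show ?thesis by (metis linorder_neqE_nat)
  qed
  then show ?thesis using less[of x y] less[of y x] assms point_eqI lt_asym[of x y] lt_irrefl by metis
qed

lemma conc_cantor: "u \<in> lists {..<n} \<Longrightarrow> w \<in> cantor n \<Longrightarrow> u \<frown> w \<in> cantor n"
  by (auto simp: cantor_def conc_def) 

lemma append_inf_in: "u \<in> dotted_words n r \<Longrightarrow> w \<in> cantor n \<Longrightarrow> append_inf u w \<in> C"
  using conc_cantor[of "snd u" w] by (cases u) (simp add: dotted_words_def append_inf_def dotted_cantor_def)

lemma tail_append_inf [simp]: "tail (length (snd u)) (append_inf u w) = w"
  by (auto simp: tail_def append_inf_def)

lemma val_append_inf:
  "u \<in> dotted_words n r \<Longrightarrow> w \<in> cantor n \<Longrightarrow> z \<in> cantor n \<Longrightarrow>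
    val (length (snd u)) (append_inf u w) = val (length (snd u)) (append_inf u z)"
  by (subst val_eq_iff) (auto simp: append_inf_in, auto simp: append_inf_def)

lemma pre_in: "x \<in> C \<Longrightarrow> pre N x \<in> dotted_words n r"
  by (auto simp: pre_def dotted_words_def fst_less snd_less)

lemma length_pre [simp]: "length (snd (pre N x)) = N"
  by (simp add: pre_def)

lemma append_inf_pre: "x \<in> C \<Longrightarrow> append_inf (pre N x) (tail N x) = x"
  by (auto simp: append_inf_def pre_def tail_def conc_def intro!: prod_eqI)

lemma pre_cong: "x \<in> C \<Longrightarrow> y \<in> C \<Longrightarrow> val N x = val N y \<Longrightarrow> pre N x = pre N y"
  by (auto simp: pre_def val_eq_iff)

lemma append_inf_pre': "x \<in> C \<Longrightarrow> y \<in> C \<Longrightarrow> val N y = val N x \<Longrightarrow> append_inf (pre N x) (tail N y) = y"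
  using append_inf_pre pre_cong by metis

lemma val_append_pre:
  assumes "x \<in> C" "w \<in> cantor n"
  shows "val N (append_inf (pre N x) w) = val N x"
  using val_append_inf[OF pre_in[OF assms(1), of N] assms(2) tail_cantor[OF assms(1), of N]] assms
  by (simp add: append_inf_pre)

text \<open>\<open>lexord\<close> also puts a word before its proper extensions. Once prefixes are
  excluded, a first differing letter remains, and it decides the order of all continuations.\<close>

lemma lex_less_lt:
  assumes uv: "u \<in> dotted_words n r" "v \<in> dotted_words n r" "lex_less u v" "\<not> dotted_prefix u v"
    and xy: "x \<in> cantor n" "y \<in> cantor n"
  shows "append_inf u x \<sqsubset> append_inf v y"
proof (cases "fst u < fst v")
  case True
  then show ?thesis by (auto simp: lt_def append_inf_def intro!: exI[of _ 0])
next
  case False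
  then have e: "fst u = fst v" and l: "(snd u, snd v) \<in> lexord less_than"
    using uv(3) by (cases u; cases v; auto simp: lex_less_def)+
  have np: "\<not> prefix (snd u) (snd v)" using uv(4) e by (simp add: dotted_prefix_def)
  obtain p a b c d where p: "a < b" "snd u = p @ a # c" "snd v = p @ b # d"
    using l np unfolding lexord_def by (auto simp: prefix_def)
  have "seq_less (tail 0 (append_inf u x)) (tail 0 (append_inf v y))"
    unfolding seq_less_def using p by (intro exI[of _ "length p"]) (auto simp: tail_def append_inf_def conc_def nth_append)
  moreover have "val 0 (append_inf u x) = val 0 (append_inf v y)" using e by (simp add: append_inf_def)
  ultimately show ?thesis using lt_tail append_inf_in uv(1,2) xy by blast
qed

lemma lex_less_total: "u \<noteq> v \<Longrightarrow> lex_less u v \<or> lex_less v u"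
  using lexord_linear[of less_than "snd u" "snd v"] linorder_less_linear
  by (cases u; cases v) (auto simp: lex_less_def)

lemma lt_lex_less:
  assumes "u \<in> dotted_words n r" "v \<in> dotted_words n r" "\<not> dotted_prefix u v" "\<not> dotted_prefix v u"
    and "x \<in> cantor n" "y \<in> cantor n" "append_inf u x \<sqsubset> append_inf v y"
  shows "lex_less u v"
proof (rule ccontr)
  assume "\<not> lex_less u v"
  moreover have "u \<noteq> v" using assms(3) by (auto simp: dotted_prefix_def)
  ultimately have "lex_less v u" using lex_less_total by blast
  then have "append_inf v y \<sqsubset> append_inf u x" using lex_less_lt assms by blast
  then show False using lt_asym append_inf_in assms by blast
qed

text \<open>Near \<open>x\<close>, the map \<open>g\<close> replaces a prefix with \<open>a\<close> undotted letters by one with \<open>b\<close>.\<close>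

definition local_at :: "(inf_word \<Rightarrow> inf_word) \<Rightarrow> inf_word \<Rightarrow> nat \<Rightarrow> nat \<Rightarrow> bool" where
  "local_at g x a b \<longleftrightarrow> (\<forall>y\<in>C. val a y = val a x \<longrightarrow> val b (g y) = val b (g x) \<and> tail b (g y) = tail a y)"

lemma local_atD:
  "local_at g x a b \<Longrightarrow> y \<in> C \<Longrightarrow> val a y = val a x \<Longrightarrow> val b (g y) = val b (g x)"
  "local_at g x a b \<Longrightarrow> y \<in> C \<Longrightarrow> val a y = val a x \<Longrightarrow> tail b (g y) = tail a y"
  by (auto simp: local_at_def)

lemma local_at_cong: "local_at g x a b \<Longrightarrow> y \<in> C \<Longrightarrow> val a y = val a x \<Longrightarrow> local_at g y a b"
  by (auto simp: local_at_def)

text \<open>Both depths grow by the same amount. This brings several descriptions of maps to a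
  common depth, and it leaves the difference \<open>b - a\<close>, the later exponent,
  unchanged.\<close>

lemma local_at_add:
  assumes g: "\<And>y. y \<in> C \<Longrightarrow> g y \<in> C" and x: "x \<in> C" and l: "local_at g x a b"
  shows "local_at g x (a + k) (b + k)"
  unfolding local_at_def
proof (intro ballI impI conjI)
  fix y assume y: "y \<in> C" "val (a + k) y = val (a + k) x"
  then have v: "val a y = val a x" using val_eq_mono x by (meson le_add1)
  have t: "tail b (g y) = tail a y" "tail b (g x) = tail a x" using local_atD(2)[OF l] y v x by auto
  then show "tail (b + k) (g y) = tail (a + k) y" by (simp add: tail_add)
  have vb: "val b (g y) = val b (g x)" using local_atD(1)[OF l] y v by auto
  have "snd (g y) i = snd (g x) i" if "i < b + k" for i
  proof (cases "i < b")
    case True then show ?thesis using vb val_eq_iff g x y by blast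
  next
    case False
    then have "snd (g y) i = tail b (g y) (i - b)" "snd (g x) i = tail b (g x) (i - b)"
      by (simp_all add: tail_def)
    then have "snd (g y) i = tail a y (i - b)" "snd (g x) i = tail a x (i - b)" by (simp_all only: t)
    moreover have "snd y (a + (i - b)) = snd x (a + (i - b))"
    proof -
      have "a + (i - b) < a + k" using that False by simp
      then show ?thesis using y x val_eq_iff by blast
    qed
    then have "tail a y (i - b) = tail a x (i - b)" by (simp add: tail_def)
    with calculation show ?thesis by simp
  qed
  moreover have "fst (g y) = fst (g x)" using vb val_eq_iff g x y by blast
  ultimately show "val (b + k) (g y) = val (b + k) (g x)" using val_eq_iff g x y by blast
qed

text \<open>The group described without antichains: bijections that replace prefixes locally and
  preserve the cyclic order. In this form closure under products and inverses needs no common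
  refinement of antichains. \<open>T_carrier_eq\<close> identifies it with
  \<open>T_carrier n r\<close>.\<close>

definition TT :: "(inf_word \<Rightarrow> inf_word) set" where
  "TT = {g \<in> extensional C. bij_betw g C C \<and> (\<forall>x\<in>C. \<exists>a b. local_at g x a b) \<and>
     (\<forall>x\<in>C. \<forall>y\<in>C. \<forall>z\<in>C. cyc x y z \<longrightarrow> cyc (g x) (g y) (g z))}"

lemma TT_in: "g \<in> TT \<Longrightarrow> x \<in> C \<Longrightarrow> g x \<in> C"
  unfolding TT_def by (auto dest: bij_betwE)

lemma TT_inj: "g \<in> TT \<Longrightarrow> x \<in> C \<Longrightarrow> y \<in> C \<Longrightarrow> g x = g y \<longleftrightarrow> x = y"
  unfolding TT_def bij_betw_def inj_on_def by blast

lemma TT_bij: "g \<in> TT \<Longrightarrow> bij_betw g C C"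
  unfolding TT_def by blast

lemma TT_surj: "g \<in> TT \<Longrightarrow> y \<in> C \<Longrightarrow> \<exists>x\<in>C. g x = y"
proof -
  assume "g \<in> TT" "y \<in> C"
  then have "y \<in> g ` C" using bij_betw_imp_surj_on[OF TT_bij] by simp
  then show ?thesis by blast
qed

lemma TT_local: "g \<in> TT \<Longrightarrow> x \<in> C \<Longrightarrow> \<exists>a b. local_at g x a b"
  unfolding TT_def by blast

lemma TT_cyc: "g \<in> TT \<Longrightarrow> x \<in> C \<Longrightarrow> y \<in> C \<Longrightarrow> z \<in> C \<Longrightarrow> cyc x y z \<Longrightarrow> cyc (g x) (g y) (g z)"
  unfolding TT_def by blast

lemma TT_cyc_iff:
  assumes "g \<in> TT" "x \<in> C" "y \<in> C" "z \<in> C"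
  shows "cyc (g x) (g y) (g z) \<longleftrightarrow> cyc x y z"
proof
  assume c: "cyc (g x) (g y) (g z)"
  then have "x \<noteq> y \<and> y \<noteq> z \<and> x \<noteq> z" using cyc_distinct[of "g x" "g y" "g z"] TT_in assms by blast
  then have "cyc x y z \<or> cyc x z y" using cyc_trichotomy assms by blast
  moreover have "\<not> cyc x z y" using c TT_cyc[of g x z y] cyc_asym[of "g x" "g y" "g z"] TT_in assms by blast
  ultimately show "cyc x y z" by blast
qed (use TT_cyc assms in blast)

lemma TT_ext: "g \<in> TT \<Longrightarrow> h \<in> TT \<Longrightarrow> (\<And>x. x \<in> C \<Longrightarrow> g x = h x) \<Longrightarrow> g = h"
  unfolding TT_def using extensionalityI by blast

text \<open>Compactness gives one depth for the whole domain; the depth \<open>b\<close> in the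
  image still depends on the point.\<close>

lemma TT_local_depth:
  assumes "g \<in> TT"
  obtains N where "\<And>x. x \<in> C \<Longrightarrow> \<exists>b. local_at g x N b"
proof (rule uniform_depth[where P = "\<lambda>N x. \<exists>b. local_at g x N b"])
  show "\<exists>N b. local_at g x N b" if "x \<in> C" for x using TT_local assms that by blast
  show "\<exists>b. local_at g y M b"
    if "x \<in> C" "y \<in> C" "\<exists>b. local_at g x N b" "N \<le> M" "val N y = val N x" for x y N M
    using that local_at_cong local_at_add[of g y N _ "M - N"] TT_in[OF assms] by (metis le_add_diff_inverse)
qed blast

text \<open>The two descriptions are refined until they meet at depth \<open>max b c\<close> at the
  intermediate point \<open>g x\<close>.\<close>

lemma local_at_compose:
  assumes g: "g \<in> TT" and h: "h \<in> TT" and x: "x \<in> C"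
    and ab: "local_at g x a b" and cd: "local_at h (g x) c d"
  shows "local_at (compose C h g) x (a + (max b c - b)) (d + (max b c - c))"
proof -
  define m where "m = max b c"
  have m: "b + (m - b) = m" "c + (m - c) = m" by (simp_all add: m_def)
  have 1: "local_at g x (a + (m - b)) m"
    using local_at_add[OF TT_in[OF g] x ab, of "m - b"] by (simp only: m)
  have 2: "local_at h (g x) m (d + (m - c))"
    using local_at_add[OF TT_in[OF h] TT_in[OF g x] cd, of "m - c"] by (simp only: m)
  show ?thesis
    unfolding local_at_def m_def[symmetric]
  proof (intro ballI impI)
    fix y assume y: "y \<in> C" "val (a + (m - b)) y = val (a + (m - b)) x"
    have "val m (g y) = val m (g x)" "tail m (g y) = tail (a + (m - b)) y" using local_atD[OF 1] y by auto
    then show "val (d + (m - c)) (compose C h g y) = val (d + (m - c)) (compose C h g x) \<and>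
        tail (d + (m - c)) (compose C h g y) = tail (a + (m - b)) y"
      using local_atD[OF 2, of "g y"] TT_in[OF g] x y by (simp add: compose_def)
  qed
qed

lemma TT_comp: "g \<in> TT \<Longrightarrow> h \<in> TT \<Longrightarrow> compose C h g \<in> TT"
proof -
  assume gh: "g \<in> TT" "h \<in> TT"
  have "\<exists>a b. local_at (compose C h g) x a b" if x: "x \<in> C" for x
  proof -
    obtain a b where ab: "local_at g x a b" using TT_local gh x by blast
    obtain c d where cd: "local_at h (g x) c d" using TT_local gh x TT_in by blast
    show ?thesis using local_at_compose[OF gh x ab cd] by blast
  qed
  moreover have "bij_betw (compose C h g) C C"
    using gh unfolding TT_def by (auto intro: bij_betw_compose)
  moreover have "\<forall>x\<in>C. \<forall>y\<in>C. \<forall>z\<in>C. cyc x y z \<longrightarrow>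
      cyc (compose C h g x) (compose C h g y) (compose C h g z)"
    using TT_cyc gh TT_in by (simp add: compose_def)
  ultimately show ?thesis unfolding TT_def by simp
qed

definition tinv :: "(inf_word \<Rightarrow> inf_word) \<Rightarrow> inf_word \<Rightarrow> inf_word" where
  "tinv g = restrict (inv_into C g) C"

lemma tinv_in: "g \<in> TT \<Longrightarrow> x \<in> C \<Longrightarrow> tinv g x \<in> C"
  and tinv_right: "g \<in> TT \<Longrightarrow> x \<in> C \<Longrightarrow> g (tinv g x) = x"
  and tinv_left: "g \<in> TT \<Longrightarrow> x \<in> C \<Longrightarrow> tinv g (g x) = x"
  unfolding TT_def tinv_def bij_betw_def by (auto simp: inv_into_into f_inv_into_f)

lemma TT_inv: "g \<in> TT \<Longrightarrow> tinv g \<in> TT"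
proof -
  assume g: "g \<in> TT"
  have "\<exists>a b. local_at (tinv g) y a b" if "y \<in> C" for y
  proof -
    define x where "x = tinv g y"
    have x: "x \<in> C" "g x = y" using g that tinv_in tinv_right by (auto simp: x_def)
    obtain a b where ab: "local_at g x a b" using TT_local g x by blast
    have "val a (tinv g z) = val a (tinv g y) \<and> tail a (tinv g z) = tail b z"
      if z: "z \<in> C" "val b z = val b y" for z
    proof -
      define w where "w = pt a (val a x) (tail b z)"
      have w: "w \<in> C" unfolding w_def using pt_in val_bound x tail_cantor z by blast
      have "val a w = val a x" "tail a w = tail b z" by (simp_all add: w_def)
      then have "g w = z" using local_atD[OF ab w] x z w g TT_in by (intro point_eqI[of _ _ b]) auto
      then have "tinv g z = w" using tinv_left g w by blast
      then show ?thesis by (simp add: w_def flip: x_def)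
    qed
    then show ?thesis unfolding local_at_def by blast
  qed
  moreover have "bij_betw (tinv g) C C"
    using g unfolding TT_def tinv_def by (simp add: bij_betw_inv_into cong: bij_betw_cong)
  moreover have "cyc (tinv g x) (tinv g y) (tinv g z)"
    if "x \<in> C" "y \<in> C" "z \<in> C" "cyc x y z" for x y z
    using TT_cyc_iff[OF g] tinv_in tinv_right g that by metis
  ultimately show ?thesis unfolding TT_def by (simp add: tinv_def)
qed

lemma TT_id: "restrict id C \<in> TT"
proof -
  have "local_at (restrict id C) x 0 0" if "x \<in> C" for x
    using that by (auto simp: local_at_def)
  moreover have "bij_betw (restrict id C) C C" by (simp add: bij_betw_def inj_on_def)
  ultimately show ?thesis unfolding TT_def by auto
qed

text \<open>By the hypothesis, \<open>low\<close> is an initial segment, \<open>g\<close> is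
  increasing on it and on its complement, and \<open>g\<close> puts the upper piece below the lower
  one. Cutting the line and exchanging the two pieces is a rotation of the circle. Both rotations of
  antichains and rotations of leaves have this shape.\<close>

lemma cyc_cut:
  assumes C: "\<And>x. x \<in> C \<Longrightarrow> g x \<in> C"
    and cut: "\<And>x y. x \<in> C \<Longrightarrow> y \<in> C \<Longrightarrow> x \<sqsubset> y \<Longrightarrow>
      if low x \<longleftrightarrow> low y then g x \<sqsubset> g y else low x \<and> g y \<sqsubset> g x"
    and xyz: "x \<in> C" "y \<in> C" "z \<in> C" "cyc x y z"
  shows "cyc (g x) (g y) (g z)"
proof -
  have *: "cyc (g x) (g y) (g z)" if "x \<in> C" "y \<in> C" "z \<in> C" "x \<sqsubset> y" "y \<sqsubset> z" for x y z
  proof -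
    have "x \<sqsubset> z" using lt_trans that by blast
    then show ?thesis using cut[of x y] cut[of y z] cut[of x z] that
      unfolding cyc_def by (metis (full_types))
  qed
  show ?thesis using xyz(4)[unfolded cyc_def] *[of x y z] *[of y z x] *[of z x y] cyc_rotate xyz(1-3) by blast
qed

end

section \<open>The group as a group of cyclically monotone maps\<close>

context thompson
begin

lemma openin_leaf: "openin (cantor_topology n r) {y \<in> C. val N y = val N x}" if x: "x \<in> C"
proof -
  have "openin (cantor_topology n r) ({fst x} \<times> PiE UNIV (\<lambda>i. if i < N then {snd x i} else {..<n}))"
    unfolding cantor_topology_def
    by (subst openin_prod_Times_iff, intro disjI2 conjI openin_PiE_gen[THEN iffD2] disjI2)
       (auto simp: fst_less[OF x] snd_less[OF x])
  moreover have "{fst x} \<times> PiE UNIV (\<lambda>i. if i < N then {snd x i} else {..<n}) = {y \<in> C. val N y = val N x}"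
  proof (rule Set.set_eqI)
    fix y
    have "y \<in> {fst x} \<times> PiE UNIV (\<lambda>i. if i < N then {snd x i} else {..<n}) \<longleftrightarrow>
        y \<in> C \<and> fst y = fst x \<and> (\<forall>i<N. snd y i = snd x i)"
    proof -
      have "y \<in> {fst x} \<times> PiE UNIV (\<lambda>i. if i < N then {snd x i} else {..<n}) \<longleftrightarrow>
          fst y = fst x \<and> (\<forall>i. snd y i \<in> (if i < N then {snd x i} else {..<n}))"
        by (simp add: mem_Times_iff PiE_def Pi_def)
      also have "\<dots> \<longleftrightarrow> y \<in> C \<and> fst y = fst x \<and> (\<forall>i<N. snd y i = snd x i)"
        using fst_less[OF x] snd_less[OF x] unfolding mem_dotted_cantor
        by (metis empty_iff insert_iff lessThan_iff)
      finally show ?thesis .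
    qed
    then show "y \<in> {fst x} \<times> PiE UNIV (\<lambda>i. if i < N then {snd x i} else {..<n}) \<longleftrightarrow>
        y \<in> {y \<in> C. val N y = val N x}"
      using x val_eq_iff by blast
  qed
  ultimately show ?thesis by simp
qed

text \<open>Continuity into a product is checked on the coordinates, and a map into a discrete space
  is continuous when it is locally constant.\<close>

lemma locally_const_continuous:
  assumes g: "\<And>x. x \<in> C \<Longrightarrow> g x \<in> C"
    and c: "\<And>x N. x \<in> C \<Longrightarrow> \<exists>M. \<forall>y\<in>C. val M y = val M x \<longrightarrow> val N (g y) = val N (g x)"
  shows "continuous_map (cantor_topology n r) (cantor_topology n r) g"
proof -
  have disc: "continuous_map (cantor_topology n r) (discrete_topology A) f"
    if f: "f \<in> C \<rightarrow> A"
      and lc: "\<And>x. x \<in> C \<Longrightarrow> \<exists>M. \<forall>y\<in>C. val M y = val M x \<longrightarrow> f y = f x" for f :: "inf_word \<Rightarrow> nat" and A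
    unfolding continuous_map_def
  proof (intro conjI allI impI)
    show "f \<in> topspace (cantor_topology n r) \<rightarrow> topspace (discrete_topology A)"
      using f by (simp add: topspace_cantor_topology)
    fix U
    show "openin (cantor_topology n r) {x \<in> topspace (cantor_topology n r). f x \<in> U}"
      unfolding topspace_cantor_topology
    proof (subst openin_subopen, intro ballI)
      fix x assume x: "x \<in> {x \<in> C. f x \<in> U}"
      then obtain M where "\<forall>y\<in>C. val M y = val M x \<longrightarrow> f y = f x" using lc by blast
      then show "\<exists>T. openin (cantor_topology n r) T \<and> x \<in> T \<and> T \<subseteq> {x \<in> C. f x \<in> U}"
        using x by (intro exI[of _ "{y \<in> C. val M y = val M x}"] conjI openin_leaf) auto
    qed
  qed
  have "continuous_map (cantor_topology n r) (discrete_topology {..<r}) (fst \<circ> g)"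
  proof (rule disc)
    show "\<exists>M. \<forall>y\<in>C. val M y = val M x \<longrightarrow> (fst \<circ> g) y = (fst \<circ> g) x" if "x \<in> C" for x
      using c[of x 0] that by simp
  qed (auto simp: fst_less g)
  moreover have "continuous_map (cantor_topology n r) (discrete_topology {..<n}) (\<lambda>x. snd (g x) i)" for i
  proof (rule disc)
    show "\<exists>M. \<forall>y\<in>C. val M y = val M x \<longrightarrow> snd (g y) i = snd (g x) i" if "x \<in> C" for x
      using c[of x "Suc i"] that g val_eq_iff lessI by meson
  qed (auto simp: snd_less g)
  ultimately show ?thesis
    unfolding cantor_topology_def[of n r, symmetric]
    by (subst (2) cantor_topology_def)
       (auto simp: continuous_map_pairwise continuous_map_componentwise_UNIV o_def)
qed

lemma TT_cont:
  assumes "g \<in> TT" "x \<in> C"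
  shows "\<exists>M\<ge>K. \<forall>y\<in>C. val M y = val M x \<longrightarrow> val N (g y) = val N (g x)"
proof -
  obtain a b where "local_at g x a b" using TT_local assms by blast
  then have l: "local_at g x (a + (N + K)) (b + (N + K))" using local_at_add TT_in assms by blast
  show ?thesis
  proof (intro exI[of _ "a + (N + K)"] conjI ballI impI)
    fix y assume y: "y \<in> C" "val (a + (N + K)) y = val (a + (N + K)) x"
    then have "val (b + (N + K)) (g y) = val (b + (N + K)) (g x)" using local_atD[OF l] by blast
    then show "val N (g y) = val N (g x)" using val_eq_mono TT_in assms y by (meson le_add1 le_add2 order_trans)
  qed simp
qed

lemma TT_homeo: "g \<in> TT \<Longrightarrow> homeomorphic_map (cantor_topology n r) (cantor_topology n r) g"
proof -
  assume g: "g \<in> TT"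
  have c: "continuous_map (cantor_topology n r) (cantor_topology n r) g" if "g \<in> TT" for g
    using locally_const_continuous TT_in TT_cont[where K = 0] that by (metis (no_types, lifting))
  have "homeomorphic_maps (cantor_topology n r) (cantor_topology n r) g (tinv g)"
    unfolding homeomorphic_maps_def topspace_cantor_topology
    using c g TT_inv tinv_left tinv_right by blast
  then show ?thesis using homeomorphic_map_maps by blast
qed

text \<open>The domain antichain consists of all words of one sufficiently large depth. The
  replacing words form a complete antichain because \<open>g\<close> is a bijection, and since
  \<open>g\<close> preserves the cyclic order they appear in lexicographic order when the list
  starts at the leaf whose image contains \<open>mn\<close>.\<close>

lemma TT_imp_T_carrier:
  assumes g: "g \<in> TT"
  shows "g \<in> T_carrier n r"
proof -
  obtain N where N: "\<And>x. x \<in> C \<Longrightarrow> \<exists>b. local_at g x N b" using TT_local_depth g by blast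
  define L where "L = r * n ^ N"
  have L0: "0 < L" unfolding L_def by (rule leaf_pos)
  have loC: "lo N k \<in> C" if "k < L" for k using lo_in that by (simp add: L_def)
  define b where "b k = (SOME b. local_at g (lo N k) N b)" for k
  have b: "local_at g (lo N k) N (b k)" if "k < L" for k
    unfolding b_def using N[OF loC[OF that]] by (rule someI_ex)
  define u where "u k = pre N (lo N k)" for k
  define v where "v k = pre (b k) (g (lo N k))" for k
  have uw: "u k \<in> dotted_words n r" "v k \<in> dotted_words n r" if "k < L" for k
    using pre_in loC TT_in[OF g] that by (auto simp: u_def v_def)
  have val_u: "val N (append_inf (u k) w) = k" if "k < L" "w \<in> cantor n" for k w
    using val_append_pre[OF loC] that by (simp add: u_def)
  have tail_u: "tail N (append_inf (u k) w) = w" for k w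
    using tail_append_inf[of "u k" w] by (simp add: u_def)
  have u_val: "append_inf (u (val N x)) (tail N x) = x" if "x \<in> C" for x
    unfolding u_def using append_inf_pre'[OF loC that, of "val N x" N] val_bound[OF that] by (simp add: L_def)
  have gu: "g (append_inf (u k) w) = append_inf (v k) w" if k: "k < L" and w: "w \<in> cantor n" for k w
  proof -
    let ?y = "append_inf (u k) w"
    have y: "?y \<in> C" using append_inf_in uw k w by blast
    have "val N ?y = val N (lo N k)" using val_u k w by simp
    then have 1: "val (b k) (g ?y) = val (b k) (g (lo N k))" "tail (b k) (g ?y) = w"
      using local_atD[OF b[OF k] y] tail_u by auto
    then show ?thesis
      using append_inf_pre'[OF TT_in[OF g loC[OF k]] TT_in[OF g y] 1(1)] by (simp add: v_def)
  qed
  have u_np: "\<not> dotted_prefix (u i) (u k)" if "i < L" "k < L" "i \<noteq> k" for i k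
  proof
    assume "dotted_prefix (u i) (u k)"
    then have "fst (u i) = fst (u k)" "prefix (snd (u i)) (snd (u k))" by (simp_all add: dotted_prefix_def)
    moreover from this have "snd (u i) = snd (u k)"
      using length_pre[of N] unfolding u_def prefix_def by (metis append_eq_append_conv append_Nil2)
    ultimately have "u i = u k" by (simp add: prod_eq_iff)
    then show False using val_u that zero_cantor by metis
  qed
  have v_np: "\<not> dotted_prefix (v i) (v k)" if "i < L" "k < L" "i \<noteq> k" for i k
  proof
    assume "dotted_prefix (v i) (v k)"
    then obtain z where z: "fst (v k) = fst (v i)" "snd (v k) = snd (v i) @ z"
      by (auto simp: dotted_prefix_def prefix_def)
    \<comment> \<open>The word \<open>v k\<close> followed by zeros equals \<open>v i\<close>
      followed by \<open>w\<close>, so this point would be the image of a point of leaf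
      \<open>k\<close> and of a point of leaf \<open>i\<close>.\<close>
    define w where "w = z \<frown> (\<lambda>_. 0)"
    have "z \<in> lists {..<n}" using uw(2)[OF that(2)] z by (auto simp: dotted_words_def mem_Times_iff)
    then have w: "w \<in> cantor n" unfolding w_def using conc_cantor zero_cantor by blast
    have "append_inf (v k) (\<lambda>_. 0) = append_inf (v i) w"
      by (simp add: append_inf_def z w_def)
    then have "g (append_inf (u k) (\<lambda>_. 0)) = g (append_inf (u i) w)" using gu that w zero_cantor by simp
    then have "append_inf (u k) (\<lambda>_. 0) = append_inf (u i) w"
      using TT_inj g append_inf_in uw that w zero_cantor by blast
    then show False using val_u that w zero_cantor by metis
  qed
  have cover: "(\<Union>k<L. cone n (u k)) = C" "(\<Union>k<L. cone n (v k)) = C"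
  proof -
    show "(\<Union>k<L. cone n (u k)) = C"
    proof
      show "(\<Union>k<L. cone n (u k)) \<subseteq> C"
        unfolding cone_def by (intro UN_least image_subsetI append_inf_in uw) auto
      show "C \<subseteq> (\<Union>k<L. cone n (u k))"
      proof
        fix x assume x: "x \<in> C"
        then have "val N x < L" "x \<in> cone n (u (val N x))"
          using val_bound u_val[OF x] tail_cantor[OF x] unfolding L_def cone_def by (auto intro: image_eqI[OF sym])
        then show "x \<in> (\<Union>k<L. cone n (u k))" by blast
      qed
    qed
    show "(\<Union>k<L. cone n (v k)) = C"
    proof
      show "(\<Union>k<L. cone n (v k)) \<subseteq> C"
        unfolding cone_def by (intro UN_least image_subsetI append_inf_in uw) auto
      show "C \<subseteq> (\<Union>k<L. cone n (v k))"
      proof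
        fix y assume "y \<in> C"
        then obtain x where x: "x \<in> C" "g x = y" using TT_surj g by blast
        have "y = append_inf (v (val N x)) (tail N x)"
          using gu[of "val N x" "tail N x"] u_val x val_bound[OF x(1)] tail_cantor[OF x(1)] by (simp add: L_def)
        then have "val N x < L" "y \<in> cone n (v (val N x))"
          using val_bound[OF x(1)] tail_cantor[OF x(1)] by (auto simp: L_def cone_def)
        then show "y \<in> (\<Union>k<L. cone n (v k))" by blast
      qed
    qed
  qed
  define X where "X k = g (lo N k)" for k
  have XC: "X k \<in> C" if "k < L" for k using loC TT_in g that by (simp add: X_def)
  have Xv: "X k = append_inf (v k) (\<lambda>_. 0)" if "k < L" for k
  proof -
    have "lo N k = append_inf (u k) (\<lambda>_. 0)"
      using u_val[OF loC[OF that]] tail_pt[of N k "\<lambda>_. 0"] by (simp add: lo_def)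
    then show ?thesis using gu[OF that zero_cantor] by (simp add: X_def)
  qed
  have lexv: "lex_less (v i) (v k)" if "i < L" "k < L" "X i \<sqsubset> X k" for i k
    using lt_lex_less[OF uw(2) uw(2) v_np v_np zero_cantor zero_cantor, of i k] that Xv lt_irrefl by metis
  define x0 where "x0 = tinv g mn"
  define m where "m = val N x0"
  have x0: "x0 \<in> C" "g x0 = mn" using tinv_in tinv_right g mn_in by (auto simp: x0_def)
  have mL: "m < L" using val_bound[OF x0(1)] by (simp add: m_def L_def)
  have mn_v: "mn = append_inf (v m) (tail N x0)"
    using gu[OF mL tail_cantor[OF x0(1), of N]] u_val[OF x0(1)] x0(2) unfolding m_def by metis
  \<comment> \<open>Both \<open>mn\<close> and \<open>X m\<close> begin with \<open>v m\<close>. The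
    comparison of \<open>mn\<close> with \<open>X k\<close> therefore passes to the words
    \<open>v m\<close> and \<open>v k\<close>, and from them to \<open>X m\<close>.\<close>
  have Xm: "X m \<sqsubset> X k" if "k < L" "k \<noteq> m" for k
  proof -
    have "mn \<noteq> X k"
    proof
      assume "mn = X k"
      then have "x0 = lo N k" using TT_inj[OF g x0(1) loC[OF that(1)]] x0(2) by (simp add: X_def)
      then show False using that(2) by (simp add: m_def)
    qed
    then have "mn \<sqsubset> X k" using mn_lt[of "X k"] XC[OF that(1)] by simp
    then have "append_inf (v m) (tail N x0) \<sqsubset> append_inf (v k) (\<lambda>_. 0)" using mn_v Xv that by simp
    then have "lex_less (v m) (v k)"
      using lt_lex_less[OF uw(2)[OF mL] uw(2)[OF that(1)] v_np[of m k] v_np[of k m] tail_cantor[OF x0(1)] zero_cantor]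
        mL that by simp
    then show ?thesis
      using lex_less_lt[OF uw(2)[OF mL] uw(2)[OF that(1)] _ v_np[of m k] zero_cantor zero_cantor]
        mL that Xv by simp
  qed
  define p where "p i = (i + m) mod L" for i
  have pL: "p i < L" for i using L0 by (simp add: p_def)
  have pcase: "p i = (if i + m < L then i + m else i + m - L)" if "i < L" for i
    using that mL by (auto simp: p_def mod_if)
  \<comment> \<open>Seen from its smallest member \<open>X m\<close>, the cyclic order of the images
    is their linear order.\<close>
  have Xp: "X (p i) \<sqsubset> X (p k)" if ik: "i < k" "k < L" for i k
  proof (cases "i = 0")
    case True
    then have "p i = m" using mL by (simp add: p_def)
    moreover have "p k \<noteq> m" using ik True pcase[of k] by auto
    ultimately show ?thesis using Xm pL by simp
  next
    case False
    have ne: "p i \<noteq> m" "p k \<noteq> m" using ik False mL pcase[of i] pcase[of k] by auto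
    have lol: "lo N c \<sqsubset> lo N d" if "c < d" for c d
      using that by (auto simp: lt_def intro!: exI[of _ N])
    have "m < p i \<and> p i < p k \<or> p i < p k \<and> p k < m \<or> p k < m \<and> m < p i"
      using ik False mL pcase[of i] pcase[of k] by auto
    then have "cyc (lo N m) (lo N (p i)) (lo N (p k))" unfolding cyc_def using lol by blast
    then have "cyc (X m) (X (p i)) (X (p k))" unfolding X_def using TT_cyc g loC mL pL by blast
    then show ?thesis using Xm[OF pL ne(1)] Xm[OF pL ne(2)] lt_asym XC mL pL unfolding cyc_def by blast
  qed
  define us where "us = map u [0..<L]"
  define vs where "vs = map (\<lambda>i. v (p i)) [0..<L]"
  have p_surj: "(\<lambda>i. p i) ` {..<L} = {..<L}"
  proof -
    have "inj_on p {..<L}" using Xp by (intro inj_onI) (metis lessThan_iff linorder_neqE_nat lt_irrefl)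
    moreover have "p ` {..<L} \<subseteq> {..<L}" using pL by auto
    ultimately show ?thesis by (simp add: card_image card_subset_eq)
  qed
  have sets: "set us = u ` {..<L}" "set vs = v ` {..<L}"
    using p_surj by (simp_all add: us_def vs_def image_image[of v p, symmetric] atLeast0LessThan)
  have ca: "complete_antichain n r (w ` {..<L})"
    if "\<And>k. k < L \<Longrightarrow> w k \<in> dotted_words n r" "\<And>i k. i < L \<Longrightarrow> k < L \<Longrightarrow> i \<noteq> k \<Longrightarrow> \<not> dotted_prefix (w i) (w k)"
      "(\<Union>k<L. cone n (w k)) = C" for w
    unfolding complete_antichain_def
  proof (intro conjI)
    show "(\<Union>u\<in>w ` {..<L}. cone n u) = C" using that(3) by (simp add: image_image)
    show "\<forall>u\<in>w ` {..<L}. \<forall>v\<in>w ` {..<L}. u \<noteq> v \<longrightarrow> \<not> dotted_prefix u v"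
    proof (intro ballI impI)
      fix x y assume xy: "x \<in> w ` {..<L}" "y \<in> w ` {..<L}" "x \<noteq> y"
      then obtain i k where "i < L" "x = w i" "k < L" "y = w k" by blast
      with xy(3) show "\<not> dotted_prefix x y" using that(2)[of i k] by blast
    qed
  qed (use that(1) in auto)
  have sort_u: "sorted_wrt lex_less us"
  proof (unfold sorted_wrt_iff_nth_less, intro allI impI)
    fix i j assume ij: "i < j" "j < length us"
    then have l: "i < L" "j < L" "us ! i = u i" "us ! j = u j" by (auto simp: us_def)
    have "append_inf (u i) (\<lambda>_. 0) \<sqsubset> append_inf (u j) (\<lambda>_. 0)"
      unfolding lt_def using val_u[OF _ zero_cantor] l ij by (intro exI[of _ N]) simp
    then show "lex_less (us ! i) (us ! j)"
      unfolding l using lt_lex_less[OF uw(1) uw(1) u_np u_np zero_cantor zero_cantor] l ij by blast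
  qed
  have sort_v: "sorted_wrt lex_less vs"
    unfolding sorted_wrt_iff_nth_less using Xp lexv pL by (auto simp: vs_def)
  have la: "lists_antichain n r us" "lists_antichain n r vs"
    unfolding lists_antichain_def sets using ca[of u] ca[of v] uw u_np v_np cover sort_u sort_v by auto
  have len: "length us = L" "length vs = L" by (auto simp: us_def vs_def)
  \<comment> \<open>As \<open>vs\<close> starts with \<open>v m\<close>, the word \<open>v i\<close>
    stands at position \<open>i - m\<close> modulo \<open>L\<close>; the shift is written
    \<open>L - m\<close> to stay within the natural numbers.\<close>
  have "\<forall>i<length us. \<forall>x\<in>cantor n. g (append_inf (us ! i) x) = append_inf (vs ! ((i + (L - m)) mod length us)) x"
  proof (intro allI impI ballI)
    fix i x assume i: "i < length us" and x: "x \<in> cantor n"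
    have "p ((i + (L - m)) mod L) = (i + (L - m) + m) mod L" unfolding p_def by (simp add: mod_add_left_eq)
    also have "\<dots> = i" using i mL by (simp add: us_def)
    finally show "g (append_inf (us ! i) x) = append_inf (vs ! ((i + (L - m)) mod length us)) x"
      using gu[of i x] i x L0 by (simp add: us_def vs_def)
  qed
  then have "\<exists>us vs j. lists_antichain n r us \<and> lists_antichain n r vs \<and> length us = length vs \<and>
      (\<forall>i<length us. \<forall>x\<in>cantor n. g (append_inf (us ! i) x) = append_inf (vs ! ((i + j) mod length us)) x)"
    using la len by metis
  then show ?thesis
    unfolding T_carrier_def using g TT_homeo[OF g] by (simp add: TT_def)
qed

text \<open>On each cone \<open>g\<close> replaces one prefix and is increasing, and the cones are
  permuted by a rotation of the sorted list. So \<open>cyc_cut\<close> applies, \<open>low\<close>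
  being the union of the cones whose index does not wrap around.\<close>

lemma T_carrier_imp_TT:
  assumes g: "g \<in> T_carrier n r"
  shows "g \<in> TT"
proof -
  have gh: "homeomorphic_map (cantor_topology n r) (cantor_topology n r) g"
    using g by (simp add: T_carrier_def)
  have bij: "bij_betw g C C" unfolding bij_betw_def
    using homeomorphic_imp_injective_map[OF gh] homeomorphic_imp_surjective_map[OF gh]
    by (simp add: topspace_cantor_topology)
  obtain us vs j where us: "lists_antichain n r us" and vs: "lists_antichain n r vs"
    and len: "length us = length vs"
    and gu: "\<And>i x. i < length us \<Longrightarrow> x \<in> cantor n \<Longrightarrow>
      g (append_inf (us ! i) x) = append_inf (vs ! ((i + j) mod length us)) x"
    using g unfolding T_carrier_def by blast
  define l where "l = length us"
  have word: "us ! i \<in> dotted_words n r" "vs ! i \<in> dotted_words n r" if "i < l" for i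
    using us vs that len nth_mem unfolding lists_antichain_def complete_antichain_def l_def by (metis subsetD)+
  have less: "append_inf (ws ! i) x \<sqsubset> append_inf (ws ! k) y"
    if "lists_antichain n r ws" "i < k" "k < length ws" "x \<in> cantor n" "y \<in> cantor n" for ws i k x y
  proof -
    have l: "lex_less (ws ! i) (ws ! k)"
      using that unfolding lists_antichain_def sorted_wrt_iff_nth_less by blast
    moreover have "ws ! i \<noteq> ws ! k"
    proof
      assume "ws ! i = ws ! k"
      with l show False using lexord_irreflexive[of less_than "snd (ws ! k)"]
        by (cases "ws ! k") (auto simp: lex_less_def)
    qed
    moreover have m: "ws ! i \<in> set ws" "ws ! k \<in> set ws" using that(2,3) by auto
    moreover have "ws ! i \<in> dotted_words n r" "ws ! k \<in> dotted_words n r" "\<not> dotted_prefix (ws ! i) (ws ! k)"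
      using that(1) m \<open>ws ! i \<noteq> ws ! k\<close> unfolding lists_antichain_def complete_antichain_def by blast+
    ultimately show ?thesis using that(4,5) lex_less_lt by blast
  qed
  have cover: "\<exists>i<l. \<exists>w\<in>cantor n. x = append_inf (us ! i) w" if x: "x \<in> C" for x
  proof -
    have "x \<in> (\<Union>u\<in>set us. cone n u)" using us x unfolding lists_antichain_def complete_antichain_def by simp
    then obtain u w where u: "u \<in> set us" "w \<in> cantor n" "x = append_inf u w" unfolding cone_def by blast
    then obtain i where "i < length us" "us ! i = u" by (auto simp: in_set_conv_nth)
    then show ?thesis using u unfolding l_def by blast
  qed
  have l0: "0 < l" using cover[OF mn_in] by auto
  have jl: "(i + j) mod l < l" for i using l0 by simp
  have loc: "\<exists>a b. local_at g x a b" if x: "x \<in> C" for x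
  proof -
    obtain i w where i: "i < l" "w \<in> cantor n" "x = append_inf (us ! i) w" using cover x by blast
    let ?u = "us ! i" and ?v = "vs ! ((i + j) mod l)"
    have "val (length (snd ?v)) (g y) = val (length (snd ?v)) (g x) \<and> tail (length (snd ?v)) (g y) = tail (length (snd ?u)) y"
      if y: "y \<in> C" "val (length (snd ?u)) y = val (length (snd ?u)) x" for y
    proof -
      let ?t = "tail (length (snd ?u)) y"
      have t: "?t \<in> cantor n" using tail_cantor y by blast
      have "append_inf ?u ?t = y"
        using y i word append_inf_in t val_append_inf[OF word(1)[OF i(1)] t i(2)]
        by (intro point_eqI[of _ _ "length (snd ?u)"]) auto
      then have "g y = append_inf ?v ?t" using gu[of i ?t] i t by (simp add: l_def)
      moreover have "g x = append_inf ?v w" using gu i by (simp add: l_def)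
      ultimately show ?thesis using val_append_inf[OF word(2)[OF jl] t i(2)] by simp
    qed
    then show ?thesis unfolding local_at_def by blast
  qed
  define j' where "j' = j mod l"
  have j': "j' < l" using l0 by (simp add: j'_def)
  have rot: "(i + j) mod l = (if i + j' < l then i + j' else i + j' - l)" if "i < l" for i
  proof -
    have "(i + j) mod l = (i + j') mod l" unfolding j'_def by (simp add: mod_add_right_eq)
    then show ?thesis using that j' by (auto simp: mod_if)
  qed
  define low where "low x \<longleftrightarrow> (\<exists>i w. i < l \<and> w \<in> cantor n \<and> x = append_inf (us ! i) w \<and> i + j' < l)" for x
  have uniq: "i = k" if "i < l" "k < l" "w \<in> cantor n" "z \<in> cantor n" "append_inf (us ! i) w = append_inf (us ! k) z" for i k w z
    using less[OF us, of i k w z] less[OF us, of k i z w] that lt_irrefl by (metis l_def linorder_neqE_nat)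
  have low: "low (append_inf (us ! i) w) \<longleftrightarrow> i + j' < l" if "i < l" "w \<in> cantor n" for i w
    unfolding low_def using uniq that by metis
  have cut: "if low x \<longleftrightarrow> low y then g x \<sqsubset> g y else low x \<and> g y \<sqsubset> g x"
    if xy: "x \<in> C" "y \<in> C" "x \<sqsubset> y" for x y
  proof -
    obtain i w where i: "i < l" "w \<in> cantor n" "x = append_inf (us ! i) w" using cover xy by blast
    obtain k z where k: "k < l" "z \<in> cantor n" "y = append_inf (us ! k) z" using cover xy by blast
    have ik: "i \<le> k"
    proof (rule ccontr)
      assume "\<not> i \<le> k"
      then have "y \<sqsubset> x" using less[OF us, of k i z w] i k by (simp add: l_def)
      then show False using lt_asym xy by blast
    qed
    have gx: "g x = append_inf (vs ! ((i + j) mod l)) w" "g y = append_inf (vs ! ((k + j) mod l)) z"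
      using gu i k by (auto simp: l_def)
    have lw: "low x \<longleftrightarrow> i + j' < l" "low y \<longleftrightarrow> k + j' < l" using low i k by auto
    show ?thesis
    proof (cases "i = k")
      case True
      let ?u = "us ! i" and ?v = "vs ! ((i + j) mod l)"
      have "seq_less w z"
        using lt_tail[of x y "length (snd ?u)"] xy i k True val_append_inf word tail_append_inf by metis
      then have "g x \<sqsubset> g y"
        using lt_tail[of "g x" "g y" "length (snd ?v)"] gx True val_append_inf[OF word(2)[OF jl] i(2) k(2)]
          append_inf_in[OF word(2)[OF jl]] i k tail_append_inf by metis
      then show ?thesis using lw True by simp
    next
      case False
      then have "i < k" using ik by simp
      then show ?thesis
        using less[OF vs, of "(i + j) mod l" "(k + j) mod l" w z] less[OF vs, of "(k + j) mod l" "(i + j) mod l" z w]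
          rot[OF i(1)] rot[OF k(1)] lw gx i k j' len
        by (auto simp: l_def[symmetric])
    qed
  qed
  have gC: "g x \<in> C" if "x \<in> C" for x using bij that bij_betwE by blast
  show ?thesis
    unfolding TT_def using g bij loc cyc_cut[of g low, OF gC cut] by (simp add: T_carrier_def)
qed

lemma T_carrier_eq: "T_carrier n r = TT"
  using TT_imp_T_carrier T_carrier_imp_TT by blast

definition GT :: "(inf_word \<Rightarrow> inf_word) monoid" where "GT = T_group n r"

lemma carrier_GT [simp]: "carrier GT = TT"
  by (simp add: GT_def T_group_def T_carrier_eq)

lemma mult_GT: "g \<otimes>\<^bsub>GT\<^esub> h = compose C h g"
  by (simp add: GT_def T_group_def)

lemma one_GT: "\<one>\<^bsub>GT\<^esub> = restrict id C"
  by (simp add: GT_def T_group_def id_def)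

lemma mult_app: "x \<in> C \<Longrightarrow> (g \<otimes>\<^bsub>GT\<^esub> h) x = h (g x)"
  by (simp add: mult_GT compose_def)

lemma one_app: "x \<in> C \<Longrightarrow> \<one>\<^bsub>GT\<^esub> x = x"
  by (simp add: one_GT)

sublocale GT: group GT
proof (rule groupI)
  show "x \<otimes>\<^bsub>GT\<^esub> y \<in> carrier GT" if "x \<in> carrier GT" "y \<in> carrier GT" for x y
    using that TT_comp by (simp add: mult_GT)
  show "\<one>\<^bsub>GT\<^esub> \<in> carrier GT" using TT_id by (simp add: one_GT)
  show "x \<otimes>\<^bsub>GT\<^esub> y \<otimes>\<^bsub>GT\<^esub> z = x \<otimes>\<^bsub>GT\<^esub> (y \<otimes>\<^bsub>GT\<^esub> z)"
    if "x \<in> carrier GT" "y \<in> carrier GT" "z \<in> carrier GT" for x y z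
    using that TT_in by (auto simp: mult_GT compose_def)
  show "\<one>\<^bsub>GT\<^esub> \<otimes>\<^bsub>GT\<^esub> x = x" if "x \<in> carrier GT" for x
    using that TT_in TT_comp[OF TT_id] by (intro TT_ext) (auto simp: mult_app one_app one_GT, simp add: mult_GT)
  show "\<exists>y\<in>carrier GT. y \<otimes>\<^bsub>GT\<^esub> x = \<one>\<^bsub>GT\<^esub>" if "x \<in> carrier GT" for x
    using that TT_inv tinv_right TT_comp[OF TT_inv] TT_id
    by (intro bexI[of _ "tinv x"] TT_ext) (simp_all add: mult_app one_app, simp_all add: mult_GT one_GT)
qed

lemma inv_GT: "g \<in> TT \<Longrightarrow> inv\<^bsub>GT\<^esub> g = tinv g"
proof -
  assume g: "g \<in> TT"
  have "tinv g \<otimes>\<^bsub>GT\<^esub> g = \<one>\<^bsub>GT\<^esub>"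
    using g tinv_right TT_comp[OF TT_inv] TT_id by (intro TT_ext) (simp_all add: mult_app one_app, simp_all add: mult_GT one_GT)
  then show ?thesis using GT.inv_equality g TT_inv by simp
qed

end

section \<open>Elements of the group\<close>

lemma seq_less_Suc: "seq_less w z \<longleftrightarrow> w 0 < z 0 \<or> w 0 = z 0 \<and> seq_less (w \<circ> Suc) (z \<circ> Suc)"
proof
  assume "seq_less w z"
  then obtain m where m: "\<forall>i<m. w i = z i" "w m < z m" by (auto simp: seq_less_def)
  show "w 0 < z 0 \<or> w 0 = z 0 \<and> seq_less (w \<circ> Suc) (z \<circ> Suc)"
  proof (cases m)
    case (Suc k)
    then have "seq_less (w \<circ> Suc) (z \<circ> Suc)" using m by (auto simp: seq_less_def intro!: exI[of _ k])
    then show ?thesis using m Suc by simp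
  qed (use m in simp)
next
  assume *: "w 0 < z 0 \<or> w 0 = z 0 \<and> seq_less (w \<circ> Suc) (z \<circ> Suc)"
  show "seq_less w z"
  proof (cases "w 0 < z 0")
    case True then show ?thesis by (auto simp: seq_less_def intro!: exI[of _ 0])
  next
    case False
    then obtain m where m: "\<forall>i<m. w (Suc i) = z (Suc i)" "w (Suc m) < z (Suc m)" "w 0 = z 0"
      using * by (auto simp: seq_less_def)
    then have "w i = z i" if "i < Suc m" for i using that by (cases i) auto
    then show ?thesis using m unfolding seq_less_def by blast
  qed
qed

context thompson
begin

lemma cantor_less: "w \<in> cantor n \<Longrightarrow> w i < n" by (simp add: cantor_def)

lemma lt_pt:
  assumes "q < r * n ^ N" "q' < r * n ^ N" "w \<in> cantor n" "w' \<in> cantor n"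
  shows "pt N q w \<sqsubset> pt N q' w' \<longleftrightarrow> q < q' \<or> q = q' \<and> seq_less w w'"
proof -
  have C: "pt N q w \<in> C" "pt N q' w' \<in> C" using assms pt_in by auto
  show ?thesis
  proof (cases q q' rule: linorder_cases)
    case less
    then show ?thesis by (auto simp: lt_def intro!: exI[of _ N])
  next
    case equal
    then show ?thesis using lt_tail[OF C, of N] by simp
  next
    case greater
    then have "pt N q' w' \<sqsubset> pt N q w" by (auto simp: lt_def intro!: exI[of _ N])
    then show ?thesis using lt_asym C greater by auto
  qed
qed

lemma pt_cases:
  assumes "x \<in> C"
  obtains q w where "q < r * n ^ N" "w \<in> cantor n" "x = pt N q w"
  using pt_val[OF assms, of N] val_bound[OF assms] tail_cantor[OF assms] by metis

lemma increasing_TT: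
  assumes ext: "g \<in> extensional C" and C: "\<And>x. x \<in> C \<Longrightarrow> g x \<in> C"
    and inc: "\<And>x y. x \<in> C \<Longrightarrow> y \<in> C \<Longrightarrow> x \<sqsubset> y \<Longrightarrow> g x \<sqsubset> g y"
    and surj: "\<And>y. y \<in> C \<Longrightarrow> \<exists>x\<in>C. g x = y"
    and loc: "\<And>x. x \<in> C \<Longrightarrow> \<exists>a b. local_at g x a b"
  shows "g \<in> TT"
proof -
  have "inj_on g C" using inc by (intro inj_onI) (metis lt_irrefl lt_total)
  moreover have "g ` C = C" using C surj by (auto simp: image_iff) metis
  ultimately have "bij_betw g C C" by (simp add: bij_betw_def)
  moreover have "cyc (g x) (g y) (g z)" if "x \<in> C" "y \<in> C" "z \<in> C" "cyc x y z" for x y z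
    using that inc unfolding cyc_def by blast
  ultimately show ?thesis unfolding TT_def using ext loc by blast
qed

text \<open>
  On the adjacent leaves \<open>k\<close> and \<open>k + 1\<close> of depth \<open>N\<close>, this is \<open>k 0 w \<mapsto> k w\<close>,
  \<open>k i w \<mapsto> (k + 1) (i - 1) w\<close> for \<open>i > 0\<close>, and \<open>(k + 1) w \<mapsto> (k + 1) (n - 1) w\<close>.
\<close>

definition cross :: "nat \<Rightarrow> nat \<Rightarrow> inf_word \<Rightarrow> inf_word" where
  "cross N k = (\<lambda>x\<in>C. let w = tail N x in
     if val N x = k then (if w 0 = 0 then pt N k (w \<circ> Suc) else pt N (Suc k) (w(0 := w 0 - 1)))
     else if val N x = Suc k then pt N (Suc k) (case_nat (n - 1) w)
     else x)"

lemma cantor_ops: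
  assumes "w \<in> cantor n"
  shows "w \<circ> Suc \<in> cantor n" "w(0 := w 0 - 1) \<in> cantor n" "c < n \<Longrightarrow> case_nat c w \<in> cantor n"
    "c < n \<Longrightarrow> w(0 := c) \<in> cantor n"
  using assms by (auto simp: cantor_def less_imp_diff_less split: nat.splits)

lemma cross_pt:
  assumes "Suc k < r * n ^ N" "w \<in> cantor n"
  shows "w 0 = 0 \<Longrightarrow> cross N k (pt N k w) = pt N k (w \<circ> Suc)"
    and "w 0 \<noteq> 0 \<Longrightarrow> cross N k (pt N k w) = pt N (Suc k) (w(0 := w 0 - 1))"
    and "cross N k (pt N (Suc k) w) = pt N (Suc k) (case_nat (n - 1) w)"
    and "q < r * n ^ N \<Longrightarrow> q \<noteq> k \<Longrightarrow> q \<noteq> Suc k \<Longrightarrow> cross N k (pt N q w) = pt N q w"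
  using assms pt_in by (simp_all add: cross_def)

lemma cross_out: "x \<in> C \<Longrightarrow> val N x \<noteq> k \<Longrightarrow> val N x \<noteq> Suc k \<Longrightarrow> cross N k x = x"
  by (simp add: cross_def Let_def)

lemma case_nat_Suc: "case_nat c w \<circ> Suc = w" by auto

lemma tail_Suc: "tail (Suc N) y = tail N y \<circ> Suc"
  by (auto simp: tail_def)

lemma cross_local_bottom:
  assumes x: "x \<in> C" "val N x = k" "tail N x 0 = 0"
  shows "local_at (cross N k) x (Suc N) N"
  unfolding local_at_def
proof (intro ballI impI)
  fix y assume y: "y \<in> C" "val (Suc N) y = val (Suc N) x"
  then have "val N y = k" "snd y N = snd x N"
    using x val_eq_iff[of y x "Suc N"] val_eq_iff[of y x N] by simp_all
  then have "val N y = k" "tail N y 0 = 0" using x(3) by (simp_all add: tail_def)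
  then show "val N (cross N k y) = val N (cross N k x) \<and> tail N (cross N k y) = tail (Suc N) y"
    using y x by (simp add: cross_def Let_def tail_Suc)
qed

lemma cross_local_top:
  assumes x: "x \<in> C" "val N x = Suc k"
  shows "local_at (cross N k) x N (Suc N)"
  unfolding local_at_def
proof (intro ballI impI conjI)
  fix y assume y: "y \<in> C" "val N y = val N x"
  have e: "cross N k y = pt N (Suc k) (case_nat (n - 1) (tail N y))" if "y \<in> C" "val N y = val N x" for y
    using x that by (simp add: cross_def Let_def)
  have "snd (pt N (Suc k) (case_nat (n - 1) w)) N = n - 1" for w by (simp add: pt_def)
  then show "val (Suc N) (cross N k y) = val (Suc N) (cross N k x)" using e y x by simp
  show "tail (Suc N) (cross N k y) = tail N y" using e y by (auto simp: tail_Suc)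
qed

text \<open>The consecutive cones \<open>k 0\<close>, \<open>k 1\<close>, ...,
  \<open>k (n - 1)\<close>, \<open>k + 1\<close> are carried in this order onto the consecutive
  cones \<open>k\<close>, \<open>(k + 1) 0\<close>, ..., \<open>(k + 1) (n - 1)\<close>, and each is
  carried by prefix replacement. This makes the map an increasing bijection.\<close>

lemma cross_TT:
  assumes k: "Suc k < r * n ^ N"
  shows "cross N k \<in> TT"
    and "\<And>x y. x \<in> C \<Longrightarrow> y \<in> C \<Longrightarrow> x \<sqsubset> y \<Longrightarrow> cross N k x \<sqsubset> cross N k y"
proof -
  let ?g = "cross N k"
  have k0: "k < r * n ^ N" using k by simp
  have n1: "n - 1 < n" using n_pos by simp
  have C: "?g x \<in> C" if x: "x \<in> C" for x
  proof -
    obtain q w where q: "q < r * n ^ N" "w \<in> cantor n" "x = pt N q w" using pt_cases x by blast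
    consider "q = k" "w 0 = 0" | "q = k" "w 0 \<noteq> 0" | "q = Suc k" | "q \<noteq> k" "q \<noteq> Suc k" by blast
    then show ?thesis
      by cases (use q k k0 n1 cross_pt[OF k q(2)] cantor_ops[OF q(2)] pt_in in auto)
  qed
  show inc: "?g x \<sqsubset> ?g y" if xy: "x \<in> C" "y \<in> C" "x \<sqsubset> y" for x y
  proof -
    obtain q w where q: "q < r * n ^ N" "w \<in> cantor n" "x = pt N q w" using pt_cases xy by blast
    obtain p z where p: "p < r * n ^ N" "z \<in> cantor n" "y = pt N p z" using pt_cases xy by blast
    have l: "q < p \<or> q = p \<and> seq_less w z" using lt_pt q p xy by blast
    note cw = cross_pt[OF k q(2)] cantor_ops[OF q(2)] cross_pt[OF k p(2)] cantor_ops[OF p(2)]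
    have wn: "w 0 < n" "z 0 < n" using q p cantor_less by auto
    have eq_o: "w(0 := c) \<circ> Suc = w \<circ> Suc" for w :: "nat \<Rightarrow> nat" and c by auto
    have ss: "seq_less w z \<Longrightarrow> w 0 \<le> z 0" using seq_less_Suc[of w z] by auto
    consider (a) "q = k" "p = k" | (b) "q = k" "p = Suc k" | (c) "q = Suc k" "p = Suc k"
      | (d) "q = k" "p \<noteq> k" "p \<noteq> Suc k" | (e) "q = Suc k" "p \<noteq> k" "p \<noteq> Suc k"
      | (f) "q \<noteq> k" "q \<noteq> Suc k" "p = k" | (g) "q \<noteq> k" "q \<noteq> Suc k" "p = Suc k"
      | (h) "q \<noteq> k" "q \<noteq> Suc k" "p \<noteq> k" "p \<noteq> Suc k" | (i) "q = Suc k" "p = k" by blast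
    then show ?thesis
    proof cases
      case a
      then have sl: "seq_less w z" using l by simp
      consider "w 0 = 0" "z 0 = 0" | "w 0 = 0" "z 0 \<noteq> 0" | "w 0 \<noteq> 0" "z 0 \<noteq> 0" using ss sl by linarith
      then show ?thesis
      proof cases
        case 1
        then show ?thesis using a cw lt_pt k k0 sl seq_less_Suc[of w z] q p by simp
      next
        case 2
        then show ?thesis using a cw lt_pt k k0 q p by simp
      next
        case 3
        then have "seq_less (w(0 := w 0 - 1)) (z(0 := z 0 - 1))"
          using sl seq_less_Suc[of w z] unfolding seq_less_Suc[of "w(0 := w 0 - 1)"] eq_o by auto
        then show ?thesis using 3 a cw lt_pt k k0 q p by simp
      qed
    next
      case b
      have "seq_less (w(0 := w 0 - 1)) (case_nat (n - 1) z)" if "w 0 \<noteq> 0"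
        using wn that unfolding seq_less_Suc[of "w(0 := w 0 - 1)"] by auto
      then show ?thesis using b cw lt_pt k k0 n1 q p by (cases "w 0 = 0") auto
    next
      case c
      then have "seq_less (case_nat (n - 1) w) (case_nat (n - 1) z)"
        using l unfolding seq_less_Suc[of "case_nat (n - 1) w"] case_nat_Suc by simp
      then show ?thesis using c cw lt_pt k k0 n1 q p by simp
    next
      case d
      then show ?thesis using l cw lt_pt k k0 n1 q p by (cases "w 0 = 0") auto
    next
      case e
      then show ?thesis using l cw lt_pt k k0 n1 q p by auto
    next
      case f
      then show ?thesis using l cw lt_pt k k0 n1 q p by (cases "z 0 = 0") auto
    next
      case g
      then show ?thesis using l cw lt_pt k k0 n1 q p by auto
    next
      case h
      then show ?thesis using l cw lt_pt k k0 n1 q p by auto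
    next
      case i
      then show ?thesis using l by auto
    qed
  qed
  show "?g \<in> TT"
  proof (rule increasing_TT)
    show "?g \<in> extensional C" by (simp add: cross_def)
  next
    fix y assume "y \<in> C"
    then obtain p z where p: "p < r * n ^ N" "z \<in> cantor n" "y = pt N p z" using pt_cases by blast
    have z: "z 0 < n" using p cantor_less by blast
    consider "p = k" | "p = Suc k" "z 0 = n - 1" | "p = Suc k" "z 0 < n - 1" | "p \<noteq> k" "p \<noteq> Suc k" using z by linarith
    then show "\<exists>x\<in>C. ?g x = y"
    proof cases
      case 1
      then show ?thesis using cross_pt(1)[OF k, of "case_nat 0 z"] cantor_ops(3)[OF p(2), of 0] n_pos p pt_in
        by (intro bexI[of _ "pt N k (case_nat 0 z)"]) (auto simp: case_nat_Suc)
    next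
      case 2
      have "case_nat (n - 1) (z \<circ> Suc) = z" using 2 by (auto split: nat.splits)
      then show ?thesis using 2 cross_pt(3)[OF k, of "z \<circ> Suc"] cantor_ops(1)[OF p(2)] p pt_in
        by (intro bexI[of _ "pt N (Suc k) (z \<circ> Suc)"]) auto
    next
      case 3
      have w: "z(0 := Suc (z 0)) \<in> cantor n" using cantor_ops(4) p 3 by simp
      moreover have "(z(0 := Suc (z 0)))(0 := (z(0 := Suc (z 0))) 0 - 1) = z" by auto
      ultimately show ?thesis using cross_pt(2)[OF k w] 3 p pt_in k0
        by (intro bexI[of _ "pt N k (z(0 := Suc (z 0)))"]) auto
    next
      case 4
      then show ?thesis using cross_pt(4)[OF k p(2,1)] p pt_in by blast
    qed
  next
    fix x assume x: "x \<in> C"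
    have t0: "tail N y 0 = snd y N" for y by (simp add: tail_def)
    have vS: "val N y = val N x \<and> tail N y 0 = tail N x 0" if "y \<in> C" "val (Suc N) y = val (Suc N) x" for y
      using that x val_eq_iff[of y x "Suc N"] val_eq_iff[of y x N] by (simp add: t0)
    consider (a) "val N x = k" "tail N x 0 = 0" | (b) "val N x = k" "tail N x 0 \<noteq> 0" | (c) "val N x = Suc k"
      | (d) "val N x \<noteq> k" "val N x \<noteq> Suc k" by blast
    then show "\<exists>a b. local_at ?g x a b"
    proof cases
      case a
      have "local_at ?g x (Suc N) N" using cross_local_bottom x a by blast
      then show ?thesis by blast
    next
      case b
      have "local_at ?g x (Suc N) (Suc N)"
        unfolding local_at_def
      proof (intro ballI impI conjI)
        fix y assume y: "y \<in> C" "val (Suc N) y = val (Suc N) x"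
        have e: "?g y = pt N (Suc k) ((tail N y)(0 := tail N x 0 - 1))" if "y \<in> C" "val (Suc N) y = val (Suc N) x" for y
          using vS[OF that] b that(1) by (simp add: cross_def Let_def)
        have "snd (pt N (Suc k) ((tail N y)(0 := tail N x 0 - 1))) N = tail N x 0 - 1" for y by (simp add: pt_def)
        then show "val (Suc N) (?g y) = val (Suc N) (?g x)" using e y x by simp
        show "tail (Suc N) (?g y) = tail (Suc N) y" using e y by (auto simp: tail_Suc)
      qed
      then show ?thesis by blast
    next
      case c
      have "local_at ?g x N (Suc N)" using cross_local_top x c by blast
      then show ?thesis by blast
    next
      case d
      have "local_at ?g x N N"
        unfolding local_at_def using d x by (auto simp: cross_def Let_def)
      then show ?thesis by blast
    qed
  qed (use C inc in auto)
qed

lemma cross_lo: "Suc k < r * n ^ N \<Longrightarrow> cross N k (lo N k) = lo N k"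
  using cross_pt(1)[of k N "\<lambda>_. 0"] zero_cantor by (simp add: lo_def o_def)

lemma cross_hi: "Suc k < r * n ^ N \<Longrightarrow> cross N k (hi N (Suc k)) = hi N (Suc k)"
proof -
  have "case_nat (n - 1) (\<lambda>_. n - 1) = (\<lambda>_. n - 1)" by (auto split: nat.splits)
  then show "Suc k < r * n ^ N \<Longrightarrow> cross N k (hi N (Suc k)) = hi N (Suc k)"
    using cross_pt(3)[of k N "\<lambda>_. n - 1"] last_cantor by (simp add: hi_def)
qed

text \<open>Deleting a leading zero brings the first nonzero letter one place forward, and inserting
  a leading \<open>n - 1\<close> delays the first smaller letter. Both enlarge the word unless it is
  constant, and the two constant words give the excluded points.\<close>

lemma cross_gt:
  assumes k: "Suc k < r * n ^ N" and x: "x \<in> C" "val N x = k \<or> val N x = Suc k" "x \<noteq> lo N k" "x \<noteq> hi N (Suc k)"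
  shows "x \<sqsubset> cross N k x"
proof -
  obtain q w where q: "q < r * n ^ N" "w \<in> cantor n" "x = pt N q w" using pt_cases x by blast
  note cw = cross_pt[OF k q(2)] cantor_ops[OF q(2)]
  have n1: "n - 1 < n" using n_pos by simp
  consider "q = k" "w 0 = 0" | "q = k" "w 0 \<noteq> 0" | "q = Suc k" using x q by auto
  then show ?thesis
  proof cases
    case 1
    have "w \<noteq> (\<lambda>_. 0)" using x(3) q 1 by (auto simp: lo_def)
    then have "\<exists>m. w m \<noteq> 0" by auto
    then obtain m where m: "w m \<noteq> 0" "\<forall>i<m. w i = 0" using exists_least_iff[of "\<lambda>m. w m \<noteq> 0"] by auto
    then obtain j where j: "m = Suc j" using 1 by (cases m) auto
    have "seq_less w (w \<circ> Suc)" unfolding seq_less_def using m j by (intro exI[of _ j]) auto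
    then show ?thesis using 1 cw lt_pt q by simp
  next
    case 2
    then show ?thesis using cw lt_pt q k by simp
  next
    case 3
    have "w \<noteq> (\<lambda>_. n - 1)" using x(4) q 3 by (auto simp: hi_def)
    then have "\<exists>m. w m \<noteq> n - 1" by auto
    then obtain m where m: "w m \<noteq> n - 1" "\<forall>i<m. w i = n - 1" using exists_least_iff[of "\<lambda>m. w m \<noteq> n - 1"] by auto
    moreover have "w m < n" using q cantor_less by blast
    ultimately have "w m < n - 1" by simp
    then have "seq_less w (case_nat (n - 1) w)" unfolding seq_less_def using m by (intro exI[of _ m]) (auto split: nat.splits)
    then show ?thesis using 3 cw lt_pt q n1 by simp
  qed
qed

lemma cross_ge: "Suc k < r * n ^ N \<Longrightarrow> x \<in> C \<Longrightarrow> \<not> cross N k x \<sqsubset> x"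
  by (metis cross_gt cross_hi cross_lo cross_out cross_TT(1) lt_asym lt_irrefl TT_in)

section \<open>Cyclic permutations of the leaves, and the reflection\<close>

definition rot :: "nat \<Rightarrow> nat \<Rightarrow> inf_word \<Rightarrow> inf_word" where
  "rot N m = (\<lambda>x\<in>C. pt N ((val N x + m) mod (r * n ^ N)) (tail N x))"

lemma rot_TT:
  assumes m: "m < r * n ^ N"
  shows "rot N m \<in> TT"
proof -
  let ?L = "r * n ^ N"
  define s where "s q = (if q + m < ?L then q + m else q + m - ?L)" for q
  have s: "(q + m) mod ?L = s q" if "q < ?L" for q
    using that m by (auto simp: s_def mod_if)
  have rp: "rot N m (pt N q w) = pt N (s q) w" if "q < ?L" "w \<in> cantor n" for q w
    using that pt_in s by (simp add: rot_def)
  have sL: "s q < ?L" if "q < ?L" for q using that m by (auto simp: s_def)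
  have C: "rot N m x \<in> C" if "x \<in> C" for x
    using that sL rp pt_in by (metis pt_cases)
  have loc: "local_at (rot N m) x N N" if "x \<in> C" for x
    using that by (simp add: local_at_def rot_def)
  have cut: "if val N x + m < ?L \<longleftrightarrow> val N y + m < ?L then rot N m x \<sqsubset> rot N m y
      else val N x + m < ?L \<and> rot N m y \<sqsubset> rot N m x"
    if xy: "x \<in> C" "y \<in> C" "x \<sqsubset> y" for x y
  proof -
    obtain q w where q: "q < ?L" "w \<in> cantor n" "x = pt N q w" using pt_cases xy by blast
    obtain p z where p: "p < ?L" "z \<in> cantor n" "y = pt N p z" using pt_cases xy by blast
    have l: "q < p \<or> q = p \<and> seq_less w z" using lt_pt q p xy by blast
    have sq: "s q < ?L" "s p < ?L" using sL q p by auto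
    show ?thesis using l rp q p lt_pt[OF sq q(2) p(2)] lt_pt[OF sq(2,1) p(2) q(2)] m
      by (auto simp: s_def)
  qed
  have inj: "inj_on (rot N m) C"
  proof (rule inj_onI)
    fix x y assume "x \<in> C" "y \<in> C" "rot N m x = rot N m y"
    then show "x = y" using cut[of x y] cut[of y x] lt_total[of x y] lt_irrefl by metis
  qed
  have surj: "\<exists>x\<in>C. rot N m x = y" if y: "y \<in> C" for y
  proof -
    obtain p z where p: "p < ?L" "z \<in> cantor n" "y = pt N p z" using pt_cases y by blast
    define q where "q = (if p < m then p + ?L - m else p - m)"
    have "q < ?L" "s q = p" using p m by (auto simp: q_def s_def)
    then show ?thesis using rp p pt_in by blast
  qed
  have "rot N m ` C = C" using C surj by (auto simp: image_iff) metis
  moreover have "rot N m \<in> extensional C" by (simp add: rot_def)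
  ultimately show ?thesis unfolding TT_def bij_betw_def
    using inj loc cyc_cut[of "rot N m" "\<lambda>x. val N x + m < ?L", OF C cut] by blast
qed

text \<open>The reflection reverses the order and exchanges \<open>mn\<close> with
  \<open>mx\<close>; conjugation by it, \<open>fconj\<close>, preserves the group. This reduces the
  behaviour of an element at \<open>mx\<close> to that of another element at
  \<open>mn\<close>.\<close>

definition flip :: "inf_word \<Rightarrow> inf_word" where
  "flip x = (r - 1 - fst x, \<lambda>i. n - 1 - snd x i)"

lemma flip_in: "x \<in> C \<Longrightarrow> flip x \<in> C"
  using n_pos r1 by (auto simp: flip_def mem_dotted_cantor)

lemma flip_flip: "x \<in> C \<Longrightarrow> flip (flip x) = x"
proof -
  assume x: "x \<in> C"
  have "n - 1 - (n - 1 - snd x i) = snd x i" for i using snd_less[OF x, of i] by simp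
  moreover have "r - 1 - (r - 1 - fst x) = fst x" using fst_less[OF x] by simp
  ultimately show ?thesis by (simp add: flip_def)
qed

lemma val_flip: "x \<in> C \<Longrightarrow> Suc (val N (flip x) + val N x) = r * n ^ N"
proof (induction N)
  case 0 then show ?case using fst_less[of x] by (simp add: flip_def)
next
  case (Suc N)
  have "Suc (val (Suc N) (flip x) + val (Suc N) x) = n * (val N (flip x) + val N x) + Suc (snd (flip x) N + snd x N)"
    by (simp add: algebra_simps)
  also have "Suc (snd (flip x) N + snd x N) = n" using snd_less[OF Suc.prems, of N] by (simp add: flip_def)
  also have "n * (val N (flip x) + val N x) + n = n * Suc (val N (flip x) + val N x)" by simp
  also have "\<dots> = n * (r * n ^ N)" using Suc by simp
  finally show ?case by (simp add: mult_ac)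
qed

lemma val_flip_eq: "x \<in> C \<Longrightarrow> y \<in> C \<Longrightarrow> val N (flip x) = val N (flip y) \<longleftrightarrow> val N x = val N y"
  using val_flip[of x N] val_flip[of y N] by linarith

lemma flip_lt: "x \<in> C \<Longrightarrow> y \<in> C \<Longrightarrow> flip x \<sqsubset> flip y \<longleftrightarrow> y \<sqsubset> x"
proof -
  assume "x \<in> C" "y \<in> C"
  then have "val N (flip x) < val N (flip y) \<longleftrightarrow> val N y < val N x" for N
    using val_flip[of x N] val_flip[of y N] by linarith
  then show ?thesis by (simp add: lt_def)
qed

lemma flip_cyc: "x \<in> C \<Longrightarrow> y \<in> C \<Longrightarrow> z \<in> C \<Longrightarrow> cyc (flip x) (flip y) (flip z) \<longleftrightarrow> cyc z y x"
  by (auto simp: cyc_def flip_lt)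

lemma flip_mn: "flip mn = mx" and flip_mx: "flip mx = mn"
  by (auto simp: flip_def mn_def mx_def)

lemma flip_bij: "bij_betw flip C C"
  by (rule bij_betw_byWitness[where f' = flip]) (auto simp: flip_flip flip_in)

definition fconj :: "(inf_word \<Rightarrow> inf_word) \<Rightarrow> inf_word \<Rightarrow> inf_word" where
  "fconj g = (\<lambda>x\<in>C. flip (g (flip x)))"

lemma fconj_app: "x \<in> C \<Longrightarrow> fconj g x = flip (g (flip x))"
  by (simp add: fconj_def)

lemma fconj_local:
  assumes g: "g \<in> TT" and x: "x \<in> C" and ab: "local_at g (flip x) a b"
  shows "local_at (fconj g) x a b"
  unfolding local_at_def
proof (intro ballI impI)
  have tf: "tail N (flip x) = (\<lambda>i. n - 1 - tail N x i)" for N x by (simp add: tail_def flip_def)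
  fix y assume y: "y \<in> C" "val a y = val a x"
  then have "val a (flip y) = val a (flip x)" using val_flip_eq x by blast
  then have 1: "val b (g (flip y)) = val b (g (flip x))" "tail b (g (flip y)) = tail a (flip y)"
    using local_atD[OF ab] flip_in y by auto
  then have "val b (flip (g (flip y))) = val b (flip (g (flip x)))"
    using val_flip_eq TT_in g flip_in x y by blast
  moreover have "tail b (flip (g (flip y))) = tail a (flip (flip y))" unfolding tf using 1(2) tf by simp
  ultimately show "val b (fconj g y) = val b (fconj g x) \<and> tail b (fconj g y) = tail a y"
    using x y by (simp add: fconj_app flip_flip)
qed

lemma fconj_TT: "g \<in> TT \<Longrightarrow> fconj g \<in> TT"
proof -
  assume g: "g \<in> TT"
  have "\<exists>a b. local_at (fconj g) x a b" if x: "x \<in> C" for x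
    using TT_local[OF g flip_in[OF x]] fconj_local[OF g x] by blast
  moreover have "bij_betw (fconj g) C C"
  proof -
    have "bij_betw (flip \<circ> (g \<circ> flip)) C C"
      using bij_betw_trans[OF bij_betw_trans[OF flip_bij TT_bij[OF g]] flip_bij] by (simp add: o_assoc)
    then show ?thesis by (rule bij_betw_cong[THEN iffD1, rotated]) (simp add: fconj_app)
  qed
  moreover have "cyc (fconj g x) (fconj g y) (fconj g z)" if "x \<in> C" "y \<in> C" "z \<in> C" "cyc x y z" for x y z
    using that TT_cyc_iff[OF g] flip_in TT_in[OF g] flip_cyc by (simp add: fconj_app)
  ultimately show ?thesis unfolding TT_def by (simp add: fconj_def)
qed

end

section \<open>Supports and commutation\<close>

definition commutator :: "('a, 'b) monoid_scheme \<Rightarrow> 'a \<Rightarrow> 'a \<Rightarrow> 'a" where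
  "commutator G a b = inv\<^bsub>G\<^esub> a \<otimes>\<^bsub>G\<^esub> inv\<^bsub>G\<^esub> b \<otimes>\<^bsub>G\<^esub> a \<otimes>\<^bsub>G\<^esub> b"

definition commutes :: "('a, 'b) monoid_scheme \<Rightarrow> 'a \<Rightarrow> 'a \<Rightarrow> bool" where
  "commutes G a b \<longleftrightarrow> a \<otimes>\<^bsub>G\<^esub> b = b \<otimes>\<^bsub>G\<^esub> a"

text \<open>
  The criteria of Belk, Elliott and Matucci for disjoint supports and for inclusion of closed supports.
  The exponent 12 is divisible by 1, 2, 3 and 4: a point moved by \<open>g\<^sup>1\<^sup>2\<close> has at least five
  translates under \<open>g\<close>, whereas the double commutator is supported in four translates of a small set.
\<close>

definition alg_disjoint :: "('a, 'b) monoid_scheme \<Rightarrow> 'a \<Rightarrow> 'a \<Rightarrow> bool" where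
  "alg_disjoint G f g \<longleftrightarrow> (\<forall>h\<in>carrier G. \<not> commutes G f h \<longrightarrow>
     (\<exists>f1\<in>carrier G. \<exists>f2\<in>carrier G. commutes G f1 g \<and> commutes G f2 g \<and>
        commutator G f1 (commutator G f2 h) \<noteq> \<one>\<^bsub>G\<^esub> \<and>
        commutes G (commutator G f1 (commutator G f2 h)) g))"

definition dominated :: "('a, 'b) monoid_scheme \<Rightarrow> 'a \<Rightarrow> 'a \<Rightarrow> bool" where
  "dominated G k f \<longleftrightarrow> (\<forall>g\<in>carrier G. alg_disjoint G f g \<longrightarrow> commutes G k (g [^]\<^bsub>G\<^esub> (12::nat)))"

lemma (in group) commutator_closed [simp]:
  "a \<in> carrier G \<Longrightarrow> b \<in> carrier G \<Longrightarrow> commutator G a b \<in> carrier G"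
  by (simp add: commutator_def)

section \<open>Invariance of the commutation criteria under automorphisms\<close>

context
  fixes G :: "('a, 'b) monoid_scheme" and \<phi> :: "'a \<Rightarrow> 'a"
  assumes G: "group G" and \<phi>: "\<phi> \<in> iso G G"
begin

interpretation group G by (rule G)

lemma auto_closed: "a \<in> carrier G \<Longrightarrow> \<phi> a \<in> carrier G"
  using \<phi> by (auto simp: iso_def hom_def)

lemma auto_mult: "a \<in> carrier G \<Longrightarrow> b \<in> carrier G \<Longrightarrow> \<phi> (a \<otimes>\<^bsub>G\<^esub> b) = \<phi> a \<otimes>\<^bsub>G\<^esub> \<phi> b"
  using \<phi> by (auto simp: iso_def hom_def)

lemma auto_group_hom: "group_hom G G \<phi>"
  using G \<phi> by (simp add: group_hom_def group_hom_axioms_def iso_def)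

lemma auto_inv: "a \<in> carrier G \<Longrightarrow> \<phi> (inv\<^bsub>G\<^esub> a) = inv\<^bsub>G\<^esub> \<phi> a"
  using group_hom.hom_inv[OF auto_group_hom] .

lemma auto_one: "\<phi> \<one>\<^bsub>G\<^esub> = \<one>\<^bsub>G\<^esub>"
  using group_hom.hom_one[OF auto_group_hom] .

lemma auto_pow: "a \<in> carrier G \<Longrightarrow> \<phi> (a [^]\<^bsub>G\<^esub> (m::nat)) = \<phi> a [^]\<^bsub>G\<^esub> m"
  using group_hom.hom_nat_pow[OF auto_group_hom] .

lemma auto_inj: "a \<in> carrier G \<Longrightarrow> b \<in> carrier G \<Longrightarrow> \<phi> a = \<phi> b \<longleftrightarrow> a = b"
  using \<phi> by (auto simp: iso_def bij_betw_def inj_on_def)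

lemma auto_surj: "b \<in> carrier G \<Longrightarrow> \<exists>a\<in>carrier G. \<phi> a = b"
proof -
  assume "b \<in> carrier G"
  then have "b \<in> \<phi> ` carrier G" using \<phi> by (simp add: iso_def bij_betw_def)
  then show ?thesis by blast
qed

lemma auto_commutator:
  "a \<in> carrier G \<Longrightarrow> b \<in> carrier G \<Longrightarrow> \<phi> (commutator G a b) = commutator G (\<phi> a) (\<phi> b)"
  by (simp add: commutator_def auto_mult auto_inv)

lemma auto_commutes:
  "a \<in> carrier G \<Longrightarrow> b \<in> carrier G \<Longrightarrow> commutes G (\<phi> a) (\<phi> b) \<longleftrightarrow> commutes G a b"
  by (simp add: commutes_def auto_inj flip: auto_mult)

text \<open>The formula is built from the group operations and from quantifiers over the carrier,
  and an automorphism permutes the carrier; so the quantifiers may be taken over its image.\<close>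

lemma auto_alg_disjoint:
  assumes "f \<in> carrier G" "g \<in> carrier G"
  shows "alg_disjoint G (\<phi> f) (\<phi> g) \<longleftrightarrow> alg_disjoint G f g"
proof -
  have im: "\<phi> ` carrier G = carrier G" using \<phi> by (auto simp: iso_def bij_betw_def)
  have k: "commutator G (\<phi> f1) (commutator G (\<phi> f2) (\<phi> h)) = \<phi> (commutator G f1 (commutator G f2 h))"
    if "f1 \<in> carrier G" "f2 \<in> carrier G" "h \<in> carrier G" for f1 f2 h
    using that by (simp add: auto_commutator)
  have one: "\<phi> a = \<one>\<^bsub>G\<^esub> \<longleftrightarrow> a = \<one>\<^bsub>G\<^esub>" if "a \<in> carrier G" for a
    using auto_inj[OF that one_closed] by (simp add: auto_one)
  have "alg_disjoint G (\<phi> f) (\<phi> g) \<longleftrightarrow> (\<forall>h\<in>\<phi> ` carrier G. \<not> commutes G (\<phi> f) h \<longrightarrow>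
     (\<exists>f1\<in>\<phi> ` carrier G. \<exists>f2\<in>\<phi> ` carrier G. commutes G f1 (\<phi> g) \<and> commutes G f2 (\<phi> g) \<and>
        commutator G f1 (commutator G f2 h) \<noteq> \<one>\<^bsub>G\<^esub> \<and>
        commutes G (commutator G f1 (commutator G f2 h)) (\<phi> g)))"
    unfolding alg_disjoint_def im ..
  also have "\<dots> \<longleftrightarrow> alg_disjoint G f g"
    unfolding alg_disjoint_def using assms by (simp add: k one auto_commutes cong: ball_cong bex_cong)
  finally show ?thesis .
qed

lemma auto_dominated:
  assumes "f \<in> carrier G" "k \<in> carrier G"
  shows "dominated G (\<phi> k) (\<phi> f) \<longleftrightarrow> dominated G k f"
proof -
  have im: "\<phi> ` carrier G = carrier G" using \<phi> by (auto simp: iso_def bij_betw_def)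
  have "dominated G (\<phi> k) (\<phi> f) \<longleftrightarrow> (\<forall>g\<in>\<phi> ` carrier G. alg_disjoint G (\<phi> f) g \<longrightarrow>
      commutes G (\<phi> k) (g [^]\<^bsub>G\<^esub> (12::nat)))"
    unfolding dominated_def im ..
  also have "\<dots> \<longleftrightarrow> dominated G k f"
    unfolding dominated_def using assms
    by (simp add: auto_alg_disjoint auto_commutes flip: auto_pow cong: ball_cong)
  finally show ?thesis .
qed

end

context thompson
begin

abbreviation gm :: "(inf_word \<Rightarrow> inf_word) \<Rightarrow> (inf_word \<Rightarrow> inf_word) \<Rightarrow> inf_word \<Rightarrow> inf_word" (infixl "\<odot>" 70) where
  "g \<odot> h \<equiv> g \<otimes>\<^bsub>GT\<^esub> h"

abbreviation gi :: "(inf_word \<Rightarrow> inf_word) \<Rightarrow> inf_word \<Rightarrow> inf_word" where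
  "gi g \<equiv> inv\<^bsub>GT\<^esub> g"

lemma gm_TT: "g \<in> TT \<Longrightarrow> h \<in> TT \<Longrightarrow> g \<odot> h \<in> TT"
  using GT.m_closed by simp

lemma gi_TT: "g \<in> TT \<Longrightarrow> gi g \<in> TT"
  using GT.inv_closed by simp

lemma one_TT: "\<one>\<^bsub>GT\<^esub> \<in> TT"
  using GT.one_closed by simp

lemma gi_right: "g \<in> TT \<Longrightarrow> x \<in> C \<Longrightarrow> g (gi g x) = x"
  and gi_left: "g \<in> TT \<Longrightarrow> x \<in> C \<Longrightarrow> gi g (g x) = x"
  by (simp_all add: inv_GT tinv_right tinv_left)

lemma gi_in: "g \<in> TT \<Longrightarrow> x \<in> C \<Longrightarrow> gi g x \<in> C"
  by (simp add: inv_GT tinv_in)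

lemma gi_eq_iff: "g \<in> TT \<Longrightarrow> x \<in> C \<Longrightarrow> y \<in> C \<Longrightarrow> gi g x = y \<longleftrightarrow> x = g y"
  using gi_right gi_left by metis

lemma gpow_TT: "g \<in> TT \<Longrightarrow> g [^]\<^bsub>GT\<^esub> (m::nat) \<in> TT"
  using GT.nat_pow_closed[of g m] by simp

lemma funpow_in: "(\<And>x. x \<in> A \<Longrightarrow> g x \<in> A) \<Longrightarrow> x \<in> A \<Longrightarrow> (g ^^ m) x \<in> A"
  by (induction m) auto

lemma gpow_app: "g \<in> TT \<Longrightarrow> x \<in> C \<Longrightarrow> (g [^]\<^bsub>GT\<^esub> (m::nat)) x = (g ^^ m) x"
proof (induction m)
  case (Suc m)
  then show ?case by (simp add: mult_app)
qed (simp add: one_app)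

lemma commutes_iff:
  assumes "f \<in> TT" "g \<in> TT"
  shows "commutes GT f g \<longleftrightarrow> (\<forall>x\<in>C. g (f x) = f (g x))"
proof
  assume "commutes GT f g"
  then have e: "f \<odot> g = g \<odot> f" by (simp add: commutes_def)
  show "\<forall>x\<in>C. g (f x) = f (g x)"
  proof
    fix x assume "x \<in> C"
    then show "g (f x) = f (g x)" using fun_cong[OF e, of x] by (simp add: mult_app)
  qed
next
  assume "\<forall>x\<in>C. g (f x) = f (g x)"
  then show "commutes GT f g" unfolding commutes_def
    using gm_TT assms by (intro TT_ext) (auto simp: mult_app)
qed

text \<open>A bijection maps the set of points that it moves to itself, so a point moved by one of
  the maps stays outside the reach of the other.\<close>

lemma disjoint_commutes:
  assumes "f \<in> TT" "g \<in> TT" "\<And>x. x \<in> C \<Longrightarrow> f x = x \<or> g x = x"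
  shows "commutes GT f g"
  unfolding commutes_iff[OF assms(1,2)]
proof
  fix x assume x: "x \<in> C"
  show "g (f x) = f (g x)"
  proof (cases "f x = x")
    case True
    have "f (g x) = g x"
    proof (cases "g x = x")
      case False
      then have "g (g x) \<noteq> g x" using TT_inj assms TT_in x by metis
      then show ?thesis using assms(3) TT_in assms x by blast
    qed (use True in simp)
    then show ?thesis using True by simp
  next
    case False
    then have "g x = x" "f (f x) \<noteq> f x" using assms x TT_inj TT_in by metis+
    then have "g (f x) = f x" using assms(3) TT_in assms x by blast
    then show ?thesis using \<open>g x = x\<close> by simp
  qed
qed

text \<open>The closed support: the closure of the set of moved points.\<close>

definition S :: "(inf_word \<Rightarrow> inf_word) \<Rightarrow> inf_word set" where
  "S g = {x \<in> C. \<forall>N. \<exists>y\<in>C. val N y = val N x \<and> g y \<noteq> y}"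

text \<open>A supply of elements with arbitrarily small support around \<open>x\<close>. The
  construction crosses two neighbouring children of the leaf of \<open>x\<close> at depth
  \<open>N\<close>, one of which contains \<open>x\<close>: the child of \<open>x\<close> and the
  next one, or the previous one if that child is the last. The point \<open>x\<close> may itself be
  fixed, hence the conclusion \<open>x \<in> S g\<close>. Monotonicity is recorded because it keeps
  the powers from becoming trivial.\<close>

lemma bump:
  assumes x: "x \<in> C"
  obtains g where "g \<in> TT" "\<And>y. y \<in> C \<Longrightarrow> g y \<noteq> y \<Longrightarrow> val N y = val N x" "x \<in> S g"
    "\<And>y z. y \<in> C \<Longrightarrow> z \<in> C \<Longrightarrow> y \<sqsubset> z \<Longrightarrow> g y \<sqsubset> g z" "\<And>y. y \<in> C \<Longrightarrow> \<not> g y \<sqsubset> y"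
proof -
  define d where "d = snd x N"
  define k where "k = (if d < n - 1 then val (Suc N) x else val (Suc N) x - 1)"
  have d: "d < n" using snd_less x by (simp add: d_def)
  have v: "val (Suc N) x = n * val N x + d" by (simp add: d_def)
  have kx: "val (Suc N) x = k \<or> val (Suc N) x = Suc k" using v d n2 by (auto simp: k_def)
  have kd: "k div n = val N x" "Suc k div n = val N x"
  proof -
    obtain e where e: "k = n * val N x + e" "Suc e < n"
      using v d n2 by (cases "d < n - 1") (auto simp: k_def intro: that[of d] that[of "d - 1"])
    show "k div n = val N x" using e by simp
    have "Suc k = n * val N x + Suc e" using e by simp
    then show "Suc k div n = val N x" using e(2) by (simp only: div_mult_self4 div_less mult.commute[of n] div_mult_self3)
  qed
  have "Suc k < r * n ^ Suc N"
  proof -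
    have "Suc k div n < r * n ^ N" using kd val_bound x by simp
    then show ?thesis using n_pos by (simp add: div_less_iff_less_mult mult_ac)
  qed
  note k = this
  let ?g = "cross (Suc N) k"
  have "val N y = val N x" if "y \<in> C" "?g y \<noteq> y" for y
    using that cross_out[OF that(1), of "Suc N" k] kd val_Suc_div[OF that(1), of N] by metis
  moreover have "x \<in> S ?g"
    unfolding S_def
  proof (intro CollectI conjI allI x)
    fix M
    define K where "K = M + Suc N"
    \<comment> \<open>The tail \<open>1 0 0 ...\<close> is neither all zeros nor all
      \<open>n - 1\<close>, even for \<open>n = 2\<close>, so \<open>y\<close> differs from the two
      end points that the crossing fixes.\<close>
    define y where "y = pt K (val K x) (\<lambda>i. if i = 0 then 1 else 0)"
    have w: "(\<lambda>i. if i = 0 then 1 else 0) \<in> cantor n" using n2 by (auto simp: cantor_def)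
    have y: "y \<in> C" unfolding y_def using pt_in[OF val_bound[OF x] w] .
    have yK: "val K y = val K x" by (simp add: y_def)
    have yN: "val (Suc N) y = val (Suc N) x" and yM: "val M y = val M x"
      by (rule val_eq_mono[OF y x yK]; simp add: K_def)+
    have "snd y K = 1" "snd y (Suc K) = 0" by (simp_all add: y_def pt_def)
    moreover have "snd (lo (Suc N) k) K = 0" "snd (hi (Suc N) (Suc k)) (Suc K) = n - 1"
      by (simp_all add: lo_def hi_def pt_def K_def)
    ultimately have "y \<noteq> lo (Suc N) k" "y \<noteq> hi (Suc N) (Suc k)" using n2 by auto
    then have "?g y \<noteq> y" using cross_gt[OF k y] kx yN by (metis lt_irrefl)
    then show "\<exists>y\<in>C. val M y = val M x \<and> ?g y \<noteq> y" using y yM by blast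
  qed
  ultimately show ?thesis using that cross_TT[OF k] cross_ge[OF k] by blast
qed

lemma S_moved: "x \<in> S g \<Longrightarrow> \<exists>y\<in>C. val N y = val N x \<and> g y \<noteq> y"
  by (simp add: S_def)

lemma moved_S: "x \<in> C \<Longrightarrow> g x \<noteq> x \<Longrightarrow> x \<in> S g"
  by (auto simp: S_def)

lemma moved_disjoint:
  assumes f: "f \<in> TT" and x: "x \<in> C" "f x \<noteq> x"
  shows "\<exists>N0. \<forall>N\<ge>N0. \<forall>y\<in>C. val N y = val N x \<longrightarrow> val N (f y) \<noteq> val N x"
proof -
  obtain N0 where N0: "val N0 (f x) \<noteq> val N0 x" using neq_val[OF TT_in[OF f x(1)] x] by blast
  obtain M where M: "M \<ge> N0" "\<forall>y\<in>C. val M y = val M x \<longrightarrow> val N0 (f y) = val N0 (f x)"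
    using TT_cont[OF f x(1)] by blast
  show ?thesis
  proof (intro exI[of _ M] allI ballI impI)
    fix N y assume N: "M \<le> N" and y: "y \<in> C" "val N y = val N x"
    then have "val M y = val M x" using val_eq_mono x by blast
    then have "val N0 (f y) \<noteq> val N0 x" using M y N0 by simp
    then show "val N (f y) \<noteq> val N x"
      using val_eq_mono[OF TT_in[OF f y(1)] x(1), of N N0] M N by linarith
  qed
qed

lemma moved_nbhd:
  assumes f: "f \<in> TT" and x: "x \<in> C" "f x \<noteq> x"
  shows "\<exists>N0. \<forall>N\<ge>N0. \<forall>y\<in>C. val N y = val N x \<longrightarrow> f y \<noteq> y"
  using moved_disjoint[OF assms] by metis

lemma commutator_app:
  "f \<in> TT \<Longrightarrow> g \<in> TT \<Longrightarrow> x \<in> C \<Longrightarrow> commutator GT f g x = g (f (gi g (gi f x)))"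
  by (simp add: commutator_def mult_app gi_in TT_in)

lemma commutator_TT: "f \<in> TT \<Longrightarrow> g \<in> TT \<Longrightarrow> commutator GT f g \<in> TT"
  using GT.commutator_closed by simp

text \<open>If \<open>f\<close> and \<open>h\<close> do not commute, both move some
  \<open>x\<close>. On a small leaf \<open>V\<close> around \<open>x\<close> the map
  \<open>g\<close> is the identity, and \<open>h\<close> carries \<open>V\<close> off itself. For
  \<open>f2\<close> supported in \<open>V\<close>, the commutator with \<open>h\<close> acts on
  \<open>V\<close> as the inverse of \<open>f2\<close>. An \<open>f1\<close> whose support is a
  still smaller leaf carried off itself by \<open>f2\<close> then gives a nontrivial double
  commutator that fixes all points outside \<open>V\<close>, and so commutes with
  \<open>g\<close>.\<close>

lemma disjoint_alg_disjoint:
  assumes f: "f \<in> TT" and g: "g \<in> TT" and fg: "\<And>x. x \<in> C \<Longrightarrow> f x = x \<or> g x = x"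
  shows "alg_disjoint GT f g"
  unfolding alg_disjoint_def carrier_GT
proof (intro ballI impI)
  fix h assume h: "h \<in> TT" and nc: "\<not> commutes GT f h"
  obtain x where x: "x \<in> C" "f x \<noteq> x" "h x \<noteq> x" using disjoint_commutes[OF f h] nc by blast
  obtain N1 where N1: "\<forall>N\<ge>N1. \<forall>y\<in>C. val N y = val N x \<longrightarrow> val N (h y) \<noteq> val N x"
    using moved_disjoint[OF h x(1,3)] by blast
  obtain N2 where N2: "\<forall>N\<ge>N2. \<forall>y\<in>C. val N y = val N x \<longrightarrow> f y \<noteq> y"
    using moved_nbhd[OF f x(1,2)] by blast
  define N where "N = max N1 N2"
  define V where "V = {y \<in> C. val N y = val N x}"
  have Vh: "h y \<notin> V" if "y \<in> V" for y using that N1 by (auto simp: V_def N_def)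
  have Vg: "g y = y" if "y \<in> V" for y
  proof -
    have "N2 \<le> N" by (simp add: N_def)
    then have "f y \<noteq> y" using that N2 unfolding V_def by blast
    then show ?thesis using fg that unfolding V_def by blast
  qed
  have VC: "y \<in> C" if "y \<in> V" for y using that by (simp add: V_def)
  obtain f2 where f2: "f2 \<in> TT" "\<And>y. y \<in> C \<Longrightarrow> f2 y \<noteq> y \<Longrightarrow> val N y = val N x" "x \<in> S f2"
    using bump[OF x(1)] by metis
  obtain p where p: "p \<in> C" "f2 p \<noteq> p" using S_moved[OF f2(3)] by blast
  obtain N3 where N3: "\<forall>M\<ge>N3. \<forall>y\<in>C. val M y = val M p \<longrightarrow> val M (f2 y) \<noteq> val M p"
    using moved_disjoint[OF f2(1) p] by blast
  define M where "M = max N N3"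
  obtain f1 where f1: "f1 \<in> TT" "\<And>y. y \<in> C \<Longrightarrow> f1 y \<noteq> y \<Longrightarrow> val M y = val M p" "p \<in> S f1"
    using bump[OF p(1)] by metis
  have F2: "f2 y = y" if "y \<in> C" "y \<notin> V" for y using f2(2)[OF that(1)] that unfolding V_def by blast
  have F1: "f1 y = y" if "y \<in> C" "y \<notin> V" for y
  proof (rule ccontr)
    assume "f1 y \<noteq> y"
    then have "val M y = val M p" using f1 that by blast
    then have "val N y = val N p" using val_eq_mono[OF that(1) p(1)] by (simp add: M_def)
    then show False using that f2(2)[OF p] by (simp add: V_def)
  qed
  have pres: "a y \<in> V" "gi a y \<in> V" if a: "a \<in> TT" "\<And>y. y \<in> C \<Longrightarrow> y \<notin> V \<Longrightarrow> a y = y" and y: "y \<in> V" for a y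
  proof -
    show "a y \<in> V" using a y VC TT_in TT_inj by metis
    show "gi a y \<in> V" using a(2)[of "gi a y"] gi_in[OF a(1) VC[OF y]] gi_right[OF a(1) VC[OF y]] y by metis
  qed
  have c1: "commutes GT f1 g" using F1 Vg by (intro disjoint_commutes f1 g) blast
  have c2: "commutes GT f2 g" using F2 Vg by (intro disjoint_commutes f2 g) blast
  define c where "c = commutator GT f2 h"
  have cT: "c \<in> TT" using commutator_TT f2 h by (simp add: c_def)
  have cV: "c y = gi f2 y" if y: "y \<in> V" for y
  proof -
    have 1: "gi f2 y \<in> V" using pres f2(1) F2 y by blast
    have C1: "gi h (gi f2 y) \<in> C" using gi_in h VC[OF 1] by blast
    have "gi h (gi f2 y) \<notin> V" using Vh gi_right[OF h VC[OF 1]] 1 by metis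
    then have "f2 (gi h (gi f2 y)) = gi h (gi f2 y)" using F2 C1 by blast
    then show ?thesis unfolding c_def commutator_app[OF f2(1) h VC[OF y]]
      using gi_right[OF h VC[OF 1]] by simp
  qed
  have cVV: "c y \<in> V" if "y \<in> V" for y using cV that pres f2(1) F2 by metis
  have ciV: "gi c y = f2 y" if y: "y \<in> V" for y
  proof -
    have 1: "f2 y \<in> V" using pres f2(1) F2 y by blast
    then have "c (f2 y) = y" using cV gi_left[OF f2(1) VC[OF y]] by simp
    then show ?thesis using gi_left[OF cT VC[OF 1]] by simp
  qed
  define k where "k = commutator GT f1 c"
  have kT: "k \<in> TT" using commutator_TT f1 cT by (simp add: k_def)
  have kapp: "k y = c (f1 (gi c (gi f1 y)))" if "y \<in> C" for y
    unfolding k_def using commutator_app[OF f1(1) cT that] .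
  have kout: "k y = y" if y: "y \<in> C" "y \<notin> V" for y
  proof -
    have "gi f1 y = y" using F1[OF y] gi_left[OF f1(1) y(1)] by simp
    moreover have n: "gi c y \<notin> V" using cVV gi_right[OF cT y(1)] y by metis
    ultimately show ?thesis using kapp y F1[OF gi_in[OF cT y(1)] n] gi_right[OF cT y(1)] by simp
  qed
  have kg: "commutes GT k g" using kout Vg by (intro disjoint_commutes kT g) blast
  \<comment> \<open>The map \<open>f2\<close> carries \<open>z\<close> out of the support of
    \<open>f1\<close>, so \<open>f1\<close> fixes \<open>f2 z\<close>. This makes \<open>k\<close>
    send \<open>f1 z\<close> back to \<open>z\<close>, which witnesses that \<open>k\<close> is not
    trivial.\<close>
  obtain z where z: "z \<in> C" "val M z = val M p" "f1 z \<noteq> z" using S_moved[OF f1(3)] by blast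
  have zV: "z \<in> V" using F1 z by blast
  have "val M (f2 z) \<noteq> val M p" using N3 z by (simp add: M_def)
  then have f12: "f1 (f2 z) = f2 z" using f1(2) TT_in f2 z by blast
  have zz: "f1 z \<in> V" using pres f1(1) F1 zV by blast
  have "k (f1 z) = c (f1 (gi c z))" using kapp[OF VC[OF zz]] gi_left[OF f1(1) z(1)] by simp
  also have "\<dots> = c (f1 (f2 z))" using ciV[OF zV] by simp
  also have "\<dots> = c (f2 z)" by (simp add: f12)
  also have "\<dots> = z" using ciV[OF zV] gi_right[OF cT z(1)] by metis
  finally have "k (f1 z) \<noteq> f1 z" using z by simp
  then have "k \<noteq> \<one>\<^bsub>GT\<^esub>" using one_app VC[OF zz] by metis
  then show "\<exists>f1\<in>TT. \<exists>f2\<in>TT. commutes GT f1 g \<and> commutes GT f2 g \<and>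
      commutator GT f1 (commutator GT f2 h) \<noteq> \<one>\<^bsub>GT\<^esub> \<and> commutes GT (commutator GT f1 (commutator GT f2 h)) g"
    using f1(1) f2(1) c1 c2 kg unfolding k_def c_def by blast
qed

text \<open>Otherwise some leaf \<open>V\<close> around \<open>x\<close> is disjoint from
  \<open>f V\<close> and from its images under \<open>g\<close>, ..., \<open>g ^^ 4\<close>. Any
  \<open>h\<close> supported in \<open>V\<close> and moving a point there fails to commute with
  \<open>f\<close>, so there is a nontrivial double commutator \<open>k\<close> commuting with
  \<open>g\<close>. It moves five points \<open>(g ^^ i) y0\<close>, each lying in one of four
  translates of \<open>V\<close> by maps that commute with \<open>g\<close>. Two of them share a
  translate, which puts two points of one \<open>g\<close>-orbit into \<open>V\<close>.\<close>

lemma alg_disjoint_disjoint: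
  assumes f: "f \<in> TT" and g: "g \<in> TT" and fg: "alg_disjoint GT f g" and x: "x \<in> C" "f x \<noteq> x"
  shows "(g [^]\<^bsub>GT\<^esub> (12::nat)) x = x"
proof (rule ccontr)
  assume g12: "(g [^]\<^bsub>GT\<^esub> (12::nat)) x \<noteq> x"
  have gC: "(g ^^ i) y \<in> C" if "y \<in> C" for i y using funpow_in[of C g] TT_in[OF g] that by blast
  have per: "(g ^^ i) x \<noteq> x" if "i \<in> {1..4}" for i
  proof
    assume e: "(g ^^ i) x = x"
    have "i = 1 \<or> i = 2 \<or> i = 3 \<or> i = 4" using that by auto
    then have "i dvd 12" by auto
    then obtain j where "12 = i * j" by blast
    moreover have "(g ^^ (i * j)) x = x" by (induction j) (auto simp: funpow_add e)
    ultimately show False using g12 gpow_app[OF g x(1), of 12] by simp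
  qed
  have "\<exists>N0. \<forall>N\<ge>N0. \<forall>y\<in>C. val N y = val N x \<longrightarrow> val N ((g ^^ i) y) \<noteq> val N x" if "i \<in> {1..4}" for i
    using moved_disjoint[OF gpow_TT[OF g] x(1), of i] per[OF that] gpow_app[OF g] x(1) by auto
  then obtain N0 where N0: "\<And>i N y. i \<in> {1..4} \<Longrightarrow> N0 i \<le> N \<Longrightarrow> y \<in> C \<Longrightarrow> val N y = val N x \<Longrightarrow> val N ((g ^^ i) y) \<noteq> val N x"
    by metis
  obtain Nf where Nf: "\<forall>N\<ge>Nf. \<forall>y\<in>C. val N y = val N x \<longrightarrow> val N (f y) \<noteq> val N x"
    using moved_disjoint[OF f x] by blast
  define N where "N = Nf + (\<Sum>i\<in>{1..4}. N0 i)"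
  have NN: "N0 i \<le> N" if "i \<in> {1..4}" for i
    using member_le_sum[of i "{1..4}" N0] that by (simp add: N_def)
  define V where "V = {y \<in> C. val N y = val N x}"
  have Vg: "(g ^^ i) y \<notin> V" if "y \<in> V" "i \<in> {1..4}" for y i
    using that N0 NN by (auto simp: V_def)
  have Vf: "f y \<notin> V" if "y \<in> V" for y using that Nf by (auto simp: V_def N_def)
  obtain h where h: "h \<in> TT" "\<And>y. y \<in> C \<Longrightarrow> h y \<noteq> y \<Longrightarrow> val N y = val N x" "x \<in> S h"
    using bump[OF x(1)] by metis
  have hV: "h y = y" if "y \<in> C" "y \<notin> V" for y using h(2)[OF that(1)] that unfolding V_def by blast
  obtain z where z: "z \<in> C" "h z \<noteq> z" using S_moved[OF h(3)] by blast
  have "\<not> commutes GT f h"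
  proof
    assume "commutes GT f h"
    then have "h (f z) = f (h z)" using commutes_iff f h z by blast
    moreover have "h (f z) = f z" using hV Vf z TT_in[OF f] by blast
    ultimately show False using TT_inj f z TT_in h by metis
  qed
  then obtain f1 f2 where f12: "f1 \<in> TT" "f2 \<in> TT" "commutes GT f1 g" "commutes GT f2 g"
    and k1: "commutator GT f1 (commutator GT f2 h) \<noteq> \<one>\<^bsub>GT\<^esub>"
    and kg: "commutes GT (commutator GT f1 (commutator GT f2 h)) g"
    using fg h(1) unfolding alg_disjoint_def carrier_GT by blast
  define c where "c = commutator GT f2 h"
  define k where "k = commutator GT f1 c"
  have cT: "c \<in> TT" and kT: "k \<in> TT" using commutator_TT f12 h by (auto simp: c_def k_def)
  have hi: "gi h y = y" if "y \<in> C" "y \<notin> V" for y using hV[OF that] gi_left[OF h(1) that(1)] by simp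
  have cfix: "c y = y" if y: "y \<in> C" "y \<notin> V" "gi f2 y \<notin> V" for y
    unfolding c_def commutator_app[OF f12(2) h(1) y(1)]
    using hi[OF gi_in[OF f12(2) y(1)] y(3)] gi_right[OF f12(2) y(1)] hV[OF y(1,2)] by simp
  have kfix: "k y = y" if y: "y \<in> C" "y \<notin> V" "gi f2 y \<notin> V" "gi f1 y \<notin> V" "gi f2 (gi f1 y) \<notin> V" for y
  proof -
    have 1: "gi f1 y \<in> C" using gi_in f12 y by blast
    have "c (gi f1 y) = gi f1 y" using cfix[OF 1] y by blast
    then have "gi c (gi f1 y) = gi f1 y" using gi_left[OF cT 1] by simp
    then show ?thesis unfolding k_def commutator_app[OF f12(1) cT y(1)]
      using gi_right[OF f12(1) y(1)] cfix y by simp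
  qed
  obtain y0 where y0: "y0 \<in> C" "k y0 \<noteq> y0"
    using k1 TT_ext[OF kT one_TT] one_app unfolding k_def c_def by metis
  have cpow: "a ((g ^^ i) y) = (g ^^ i) (a y)" if "\<And>y. y \<in> C \<Longrightarrow> a (g y) = g (a y)" "y \<in> C" for a y i
    using that(1) gC[OF that(2)] by (induction i) auto
  have ci: "gi a (g y) = g (gi a y)" if "a \<in> TT" "commutes GT a g" "y \<in> C" for a y
  proof -
    have "a (g (gi a y)) = g y" using that commutes_iff[OF that(1) g] gi_in gi_right by metis
    then show ?thesis using gi_left[OF that(1)] gi_in TT_in g that by metis
  qed
  have kmov: "k ((g ^^ i) y0) \<noteq> (g ^^ i) y0" for i
  proof -
    have "k ((g ^^ i) y0) = (g ^^ i) (k y0)"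
      using commutes_iff[OF kT g] kg y0 unfolding k_def c_def by (intro cpow) auto
    moreover have "(g [^]\<^bsub>GT\<^esub> i) (k y0) \<noteq> (g [^]\<^bsub>GT\<^esub> i) y0" using TT_inj[OF gpow_TT[OF g]] TT_in kT y0 by metis
    ultimately show ?thesis using gpow_app[OF g] TT_in kT y0 by simp
  qed
  \<comment> \<open>For \<open>m < 4\<close>, \<open>A m\<close> is the inverse of the map that
    carries \<open>V\<close> to the translate with number \<open>m\<close>. All four commute with
    \<open>g\<close>, so a coincidence of translates can be pulled back to \<open>V\<close>.\<close>
  define A where "A m = (if m = 0 then id else if m = 1 then gi f2 else if m = 2 then gi f1 else gi f2 \<circ> gi f1)" for m :: nat
  have AC: "A m y \<in> C" if "y \<in> C" for m y using that gi_in f12 by (auto simp: A_def)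
  have Ag: "A m (g y) = g (A m y)" if "y \<in> C" for m y
    using that ci f12 gi_in TT_in g by (auto simp: A_def)
  have "\<exists>m<4. A m ((g ^^ i) y0) \<in> V" for i
  proof (rule ccontr)
    assume "\<not> ?thesis"
    then have a: "A m ((g ^^ i) y0) \<notin> V" if "m < 4" for m using that by blast
    have "k ((g ^^ i) y0) = (g ^^ i) y0"
      using a[of 0] a[of 1] a[of 2] a[of 3] by (intro kfix gC y0) (simp_all add: A_def)
    then show False using kmov by blast
  qed
  then obtain m where m: "\<And>i. m i < 4" "\<And>i. A (m i) ((g ^^ i) y0) \<in> V" by metis
  have "\<not> inj_on m {..4::nat}"
  proof (rule pigeonhole)
    have "card (m ` {..4}) \<le> card {..<4::nat}" using m by (intro card_mono) auto
    then show "card {..4::nat} > card (m ` {..4})" by simp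
  qed
  then obtain i j where ij: "i \<le> 4" "j \<le> 4" "i < j" "m i = m j"
    unfolding inj_on_def by (metis atMost_iff linorder_neqE_nat)
  define v where "v = A (m i) ((g ^^ i) y0)"
  have "(g ^^ (j - i)) v = A (m i) ((g ^^ (j - i)) ((g ^^ i) y0))"
    unfolding v_def using cpow[of "A (m i)" "(g ^^ i) y0" "j - i"] Ag gC y0 by metis
  also have "(g ^^ (j - i)) ((g ^^ i) y0) = (g ^^ j) y0" using ij by (simp flip: funpow_add comp_apply[of "g ^^ _"])
  finally have "(g ^^ (j - i)) v \<in> V" using m ij by simp
  moreover have "v \<in> V" using m by (simp add: v_def)
  moreover have "j - i \<in> {1..4}" using ij by auto
  ultimately show False using Vg by blast
qed

text \<open>If \<open>f\<close> replaces a prefix of length \<open>a\<close> by one of length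
  \<open>b\<close> near \<open>x\<close> and is the identity near some \<open>y\<close> of the same
  leaf, then \<open>a = b\<close> and the prefix is replaced by itself. So \<open>f\<close> is the
  identity on the whole leaf as soon as one point of it lies outside the closed support.\<close>

lemma S_clopen:
  assumes f: "f \<in> TT" and x: "x \<in> C"
  shows "\<exists>N. (\<forall>y\<in>C. val N y = val N x \<longrightarrow> f y = y) \<or> (\<forall>y\<in>C. val N y = val N x \<longrightarrow> y \<in> S f)"
proof -
  obtain a b where ab: "local_at f x a b" using TT_local f x by blast
  have "\<forall>z\<in>C. val a z = val a x \<longrightarrow> f z = z" if y: "y \<in> C" "val a y = val a x" "y \<notin> S f" for y
  proof -
    obtain N where N: "\<And>z. z \<in> C \<Longrightarrow> val N z = val N y \<Longrightarrow> f z = z" using y by (auto simp: S_def)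
    define K where "K = N + a + b"
    \<comment> \<open>The last nonzero letter of \<open>z\<close> stands at position
      \<open>K\<close>. Equality of the tails of \<open>z\<close> from \<open>a\<close> and from
      \<open>b\<close> would shift this position unless \<open>a = b\<close>.\<close>
    define z where "z = pt K (val K y) (\<lambda>i. if i = 0 then 1 else 0)"
    have w: "(\<lambda>i. if i = 0 then 1 else 0) \<in> cantor n" using n2 by (auto simp: cantor_def)
    have z: "z \<in> C" unfolding z_def using pt_in[OF val_bound[OF y(1)] w] .
    have zK: "val K z = val K y" by (simp add: z_def)
    have zN: "val N z = val N y" "val a z = val a y" using val_eq_mono[OF z y(1) zK] by (simp_all add: K_def)
    have "f z = z" using N z zN by blast
    then have t: "tail b z = tail a z" using local_atD(2)[OF ab z] zN y by simp
    have zd: "snd z K = 1" "\<And>i. i > K \<Longrightarrow> snd z i = 0" by (simp_all add: z_def pt_def)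
    have "snd z (b + i) = snd z (a + i)" for i using t by (simp add: tail_def fun_eq_iff)
    moreover have "a + (N + b) = K" "b + (N + a) = K" by (simp_all add: K_def)
    ultimately have "snd z (b + (N + b)) = 1" "snd z (a + (N + a)) = 1" using zd(1) by metis+
    then have "\<not> b + (N + b) > K" "\<not> a + (N + a) > K" using zd(2) by force+
    then have "a = b" by (simp add: K_def)
    show ?thesis
    proof (intro ballI impI)
      fix u assume u: "u \<in> C" "val a u = val a x"
      have "val a (f u) = val a (f y)" using local_atD(1)[OF ab] u y \<open>a = b\<close> by simp
      also have "\<dots> = val a u" using N[OF y(1)] u y by simp
      finally have "val a (f u) = val a u" .
      moreover have "tail a (f u) = tail a u" using local_atD(2)[OF ab] u \<open>a = b\<close> by simp
      ultimately show "f u = u" using point_eqI TT_in[OF f] u by blast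
    qed
  qed
  then show ?thesis by blast
qed

lemma S_subset: "S f \<subseteq> C" by (auto simp: S_def)

lemma S_open: "f \<in> TT \<Longrightarrow> x \<in> S f \<Longrightarrow> \<exists>N. \<forall>y\<in>C. val N y = val N x \<longrightarrow> y \<in> S f"
  using S_clopen[of f x] S_moved[of x f] S_subset by blast

lemma S_closed: "f \<in> TT \<Longrightarrow> x \<in> C \<Longrightarrow> x \<notin> S f \<Longrightarrow> \<exists>N. \<forall>y\<in>C. val N y = val N x \<longrightarrow> y \<notin> S f"
proof -
  assume f: "f \<in> TT" and x: "x \<in> C" "x \<notin> S f"
  obtain N where N: "\<And>y. y \<in> C \<Longrightarrow> val N y = val N x \<Longrightarrow> f y = y" using x by (auto simp: S_def)
  have "y \<notin> S f" if "y \<in> C" "val N y = val N x" for y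
    using S_moved[of y f N] N that by metis
  then show ?thesis by blast
qed

text \<open>If a point of \<open>S k\<close> is outside \<open>S f\<close>, a bump \<open>g\<close>
  in a region fixed by \<open>f\<close>, with support carried off itself by \<open>k\<close>,
  satisfies the criterion with \<open>f\<close>, but its twelfth power does not commute with
  \<open>k\<close>. Conversely, \<open>alg_disjoint GT f g\<close> makes the twelfth power of
  \<open>g\<close> fix all points moved by \<open>f\<close>, and by continuity all of
  \<open>S f\<close>, so it is disjoint from \<open>k\<close>.\<close>

theorem dominated_iff:
  assumes f: "f \<in> TT" and k: "k \<in> TT"
  shows "dominated GT k f \<longleftrightarrow> S k \<subseteq> S f"
proof
  assume dom: "dominated GT k f"
  show "S k \<subseteq> S f"
  proof (rule subsetI, rule ccontr)
    fix y assume y: "y \<in> S k" "y \<notin> S f"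
    then have yC: "y \<in> C" using S_subset by blast
    obtain N where N: "\<And>z. z \<in> C \<Longrightarrow> val N z = val N y \<Longrightarrow> f z = z" using yC y by (auto simp: S_def)
    obtain p where p: "p \<in> C" "val N p = val N y" "k p \<noteq> p" using S_moved y by blast
    obtain M0 where M0: "\<forall>M\<ge>M0. \<forall>z\<in>C. val M z = val M p \<longrightarrow> val M (k z) \<noteq> val M p"
      using moved_disjoint[OF k p(1,3)] by blast
    define M where "M = max N M0"
    obtain g where g: "g \<in> TT" "\<And>z. z \<in> C \<Longrightarrow> g z \<noteq> z \<Longrightarrow> val M z = val M p" "p \<in> S g"
      "\<And>y z. y \<in> C \<Longrightarrow> z \<in> C \<Longrightarrow> y \<sqsubset> z \<Longrightarrow> g y \<sqsubset> g z" "\<And>y. y \<in> C \<Longrightarrow> \<not> g y \<sqsubset> y"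
      using bump[OF p(1), of M] by metis
    have "f z = z \<or> g z = z" if "z \<in> C" for z
    proof (rule ccontr)
      assume "\<not> ?thesis"
      then have "val M z = val M p" "f z \<noteq> z" using g that by blast+
      then have "val N z = val N p" using val_eq_mono[OF that p(1)] by (simp add: M_def)
      then show False using N that p \<open>f z \<noteq> z\<close> by simp
    qed
    then have "alg_disjoint GT f g" using disjoint_alg_disjoint f g by blast
    then have com: "commutes GT k (g [^]\<^bsub>GT\<^esub> (12::nat))" using dom g unfolding dominated_def by simp
    obtain z where z: "z \<in> C" "g z \<noteq> z" using S_moved[OF g(3)] by blast
    \<comment> \<open>An arbitrary \<open>g\<close> might have trivial twelfth power; since the bump
      never moves a point down, all its positive powers move \<open>z\<close> up.\<close>
    have up: "z \<sqsubset> (g ^^ Suc i) z" for i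
    proof (induction i)
      case 0
      then show ?case using lt_total z g(5) TT_in[OF g(1)] by fastforce
    next
      case (Suc i)
      define w where "w = (g ^^ Suc i) z"
      have w: "w \<in> C" unfolding w_def using funpow_in TT_in[OF g(1)] z by metis
      have "z \<sqsubset> w" using Suc by (simp add: w_def)
      then have "z \<sqsubset> g w" using lt_le_trans[OF z(1) w TT_in[OF g(1) w]] g(5)[OF w] by blast
      then show ?case by (simp add: w_def)
    qed
    have up': "z \<sqsubset> (g ^^ i) z" if "0 < i" for i
      using up[of "i - 1"] that by (simp only: Suc_diff_1)
    have "z \<sqsubset> (g [^]\<^bsub>GT\<^esub> (12::nat)) z" unfolding gpow_app[OF g(1) z(1)] by (rule up') simp
    then have 12: "(g [^]\<^bsub>GT\<^esub> (12::nat)) z \<noteq> z" by auto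
    have "val M z = val M p" using g z by blast
    then have "val M (k z) \<noteq> val M p" using M0 z by (simp add: M_def)
    then have "g (k z) = k z" using g(2) TT_in k z by blast
    then have "(g ^^ i) (k z) = k z" for i by (induction i) auto
    then have "(g [^]\<^bsub>GT\<^esub> (12::nat)) (k z) = k z" using gpow_app g TT_in k z by simp
    moreover have "(g [^]\<^bsub>GT\<^esub> (12::nat)) (k z) = k ((g [^]\<^bsub>GT\<^esub> (12::nat)) z)"
      using com commutes_iff[OF k gpow_TT[OF g(1)]] z by blast
    ultimately have "k ((g [^]\<^bsub>GT\<^esub> (12::nat)) z) = k z" by simp
    then show False using 12 TT_inj[OF k] TT_in[OF gpow_TT[OF g(1)] z(1)] z(1) by blast
  qed
next
  assume sub: "S k \<subseteq> S f"
  show "dominated GT k f"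
    unfolding dominated_def carrier_GT
  proof (intro ballI impI)
    fix g assume g: "g \<in> TT" and ad: "alg_disjoint GT f g"
    let ?h = "g [^]\<^bsub>GT\<^esub> (12::nat)"
    have h: "?h \<in> TT" using gpow_TT g by blast
    have "k z = z \<or> ?h z = z" if z: "z \<in> C" for z
    proof (rule ccontr)
      assume "\<not> ?thesis"
      then have kz: "k z \<noteq> z" and hz: "?h z \<noteq> z" by auto
      obtain N where N: "\<forall>M\<ge>N. \<forall>y\<in>C. val M y = val M z \<longrightarrow> ?h y \<noteq> y" using moved_nbhd[OF h z hz] by blast
      have "z \<in> S f" using moved_S z kz sub by blast
      then obtain y where "y \<in> C" "val N y = val N z" "f y \<noteq> y" using S_moved by blast
      then show False using alg_disjoint_disjoint[OF f g ad] N by blast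
    qed
    then show "commutes GT k ?h" using disjoint_commutes k h by blast
  qed
qed

end

section \<open>Automorphisms are spatial and monotone\<close>

context thompson
begin

lemma S_eq_empty: "k \<in> TT \<Longrightarrow> S k = {} \<Longrightarrow> k = \<one>\<^bsub>GT\<^esub>"
  using TT_ext[OF _ one_TT] moved_S one_app by fastforce

lemma S_one: "S \<one>\<^bsub>GT\<^esub> = {}"
  using S_moved one_app by blast

lemma bump_S:
  assumes x: "x \<in> C"
  obtains g where "g \<in> TT" "x \<in> S g" "\<And>y. y \<in> S g \<Longrightarrow> val N y = val N x"
proof -
  obtain g where g: "g \<in> TT" "\<And>y. y \<in> C \<Longrightarrow> g y \<noteq> y \<Longrightarrow> val N y = val N x" "x \<in> S g"
    using bump[OF x] by metis
  have "val N y = val N x" if "y \<in> S g" for y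
    using S_moved[OF that, of N] g(2) by metis
  then show ?thesis using that g by blast
qed

lemma S_separates:
  assumes "x \<in> C" "y \<in> C" "\<And>f. f \<in> TT \<Longrightarrow> x \<in> S f \<longleftrightarrow> y \<in> S f"
  shows "x = y"
proof (rule ccontr)
  assume "x \<noteq> y"
  then obtain N where "val N x \<noteq> val N y" using neq_val assms(1,2) by blast
  moreover obtain g where "g \<in> TT" "x \<in> S g" "\<And>y. y \<in> S g \<Longrightarrow> val N y = val N x"
    using bump_S[OF assms(1)] by blast
  ultimately show False using assms(3) by metis
qed

text \<open>Disjointness is reduced to inclusion of closed supports, which
  \<open>dominated_iff\<close> has already made group-theoretic. Two open sets that meet contain the
  support of a common bump.\<close>

lemma S_disjoint_iff:
  assumes "f \<in> TT" "g \<in> TT"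
  shows "S f \<inter> S g = {} \<longleftrightarrow> (\<forall>k\<in>TT. S k \<subseteq> S f \<and> S k \<subseteq> S g \<longrightarrow> k = \<one>\<^bsub>GT\<^esub>)"
proof
  assume d: "S f \<inter> S g = {}"
  show "\<forall>k\<in>TT. S k \<subseteq> S f \<and> S k \<subseteq> S g \<longrightarrow> k = \<one>\<^bsub>GT\<^esub>"
  proof (intro ballI impI)
    fix k assume "k \<in> TT" "S k \<subseteq> S f \<and> S k \<subseteq> S g"
    then show "k = \<one>\<^bsub>GT\<^esub>" using d S_eq_empty by blast
  qed
next
  assume all: "\<forall>k\<in>TT. S k \<subseteq> S f \<and> S k \<subseteq> S g \<longrightarrow> k = \<one>\<^bsub>GT\<^esub>"
  show "S f \<inter> S g = {}"
  proof (rule ccontr)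
    assume "S f \<inter> S g \<noteq> {}"
    then obtain x where x: "x \<in> S f" "x \<in> S g" by blast
    then have xC: "x \<in> C" using S_subset by blast
    obtain M where M: "\<forall>y\<in>C. val M y = val M x \<longrightarrow> y \<in> S f" using S_open assms x by blast
    obtain N where N: "\<forall>y\<in>C. val N y = val N x \<longrightarrow> y \<in> S g" using S_open assms x by blast
    obtain k where k: "k \<in> TT" "x \<in> S k" "\<And>y. y \<in> S k \<Longrightarrow> val (max M N) y = val (max M N) x"
      using bump_S[OF xC] by blast
    have "y \<in> S f \<and> y \<in> S g" if y: "y \<in> S k" for y
    proof -
      have yC: "y \<in> C" using S_subset y by blast
      have "val M y = val M x" "val N y = val N x"
        by (rule val_eq_mono[OF yC xC k(3)[OF y]]; simp)+
      then show ?thesis using M N yC by blast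
    qed
    then have "k = \<one>\<^bsub>GT\<^esub>" using all k(1) by blast
    then show False using k(2) S_one by blast
  qed
qed

lemma S_conj_mono:
  assumes t: "t \<in> TT" and f: "f \<in> TT" and x: "x \<in> C" "t x \<in> S f"
  shows "x \<in> S (t \<odot> f \<odot> gi t)"
  unfolding S_def
proof (intro CollectI conjI allI x(1))
  fix N
  have tx: "t x \<in> C" using TT_in t x by blast
  obtain M where M: "\<forall>y\<in>C. val M y = val M (t x) \<longrightarrow> val N (gi t y) = val N (gi t (t x))"
    using TT_cont[OF gi_TT[OF t] tx] by blast
  obtain y where y: "y \<in> C" "val M y = val M (t x)" "f y \<noteq> y" using S_moved x by blast
  define z where "z = gi t y"
  have z: "z \<in> C" "t z = y" using gi_in gi_right t y by (auto simp: z_def)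
  have "val N z = val N x" using M y gi_left[OF t x(1)] by (simp add: z_def)
  moreover have "(t \<odot> f \<odot> gi t) z \<noteq> z"
    using z y gi_eq_iff[OF t TT_in[OF f y(1)] z(1)] by (simp add: mult_app)
  ultimately show "\<exists>y\<in>C. val N y = val N x \<and> (t \<odot> f \<odot> gi t) y \<noteq> y" using z by blast
qed

text \<open>As maps act on the right, \<open>t \<odot> f \<odot> gi t\<close> applies
  \<open>t\<close> first; its closed support is the preimage of that of \<open>f\<close>. One
  inclusion, applied to the inverse of \<open>t\<close>, gives the other.\<close>

lemma S_conj:
  assumes t: "t \<in> TT" and f: "f \<in> TT" and x: "x \<in> C"
  shows "x \<in> S (t \<odot> f \<odot> gi t) \<longleftrightarrow> t x \<in> S f"
proof
  assume a: "x \<in> S (t \<odot> f \<odot> gi t)"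
  have T: "t \<odot> f \<odot> gi t \<in> TT" using t f gm_TT gi_TT by simp
  have "t x \<in> S (gi t \<odot> (t \<odot> f \<odot> gi t) \<odot> gi (gi t))"
    using S_conj_mono[OF gi_TT[OF t] T TT_in[OF t x]] a by (simp only: gi_left[OF t x])
  also have "gi t \<odot> (t \<odot> f \<odot> gi t) \<odot> gi (gi t) = f"
  proof (rule TT_ext)
    show "gi t \<odot> (t \<odot> f \<odot> gi t) \<odot> gi (gi t) \<in> TT" using t f gm_TT gi_TT by simp
    show "(gi t \<odot> (t \<odot> f \<odot> gi t) \<odot> gi (gi t)) y = f y" if "y \<in> C" for y
      using that t TT_in[OF f] gi_in[OF t] gi_right[OF t] by (simp add: mult_app)
  qed (rule f)
  finally show "t x \<in> S f" .
qed (use S_conj_mono assms in blast)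

text \<open>Let bumps \<open>b N\<close> shrink to \<open>z\<close>, choose points
  \<open>p N\<close> in the closed supports of their images, and let \<open>y\<close> be an
  accumulation point. If \<open>z \<in> S f\<close>, the support of \<open>b N\<close> is eventually
  inside \<open>S f\<close>, so \<open>p N\<close> is in the closed set \<open>S (\<phi> f)\<close>;
  otherwise the two supports are eventually disjoint, and \<open>p N\<close> avoids the open set
  \<open>S (\<phi> f)\<close>. Both clauses of clopenness are used.\<close>

lemma image_point:
  assumes \<phi>: "\<phi> \<in> iso GT GT" and z: "z \<in> C"
  shows "\<exists>y\<in>C. \<forall>f\<in>TT. z \<in> S f \<longleftrightarrow> y \<in> S (\<phi> f)"
proof -
  note aut = auto_closed[OF GT.is_group \<phi>, unfolded carrier_GT]
  have sub: "S (\<phi> k) \<subseteq> S (\<phi> f) \<longleftrightarrow> S k \<subseteq> S f" if "k \<in> TT" "f \<in> TT" for k f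
    using auto_dominated[OF GT.is_group \<phi>, of f k] that dominated_iff aut by simp
  have one: "\<phi> k = \<one>\<^bsub>GT\<^esub> \<longleftrightarrow> k = \<one>\<^bsub>GT\<^esub>" if "k \<in> TT" for k
    using auto_inj[OF GT.is_group \<phi>, of k "\<one>\<^bsub>GT\<^esub>"] auto_one[OF GT.is_group \<phi>] that one_TT by simp
  have disj: "S (\<phi> f) \<inter> S (\<phi> g) = {}" if fg: "f \<in> TT" "g \<in> TT" "S f \<inter> S g = {}" for f g
    unfolding S_disjoint_iff[OF aut[OF fg(1)] aut[OF fg(2)]]
  proof (intro ballI impI)
    fix k assume "k \<in> TT" and k: "S k \<subseteq> S (\<phi> f) \<and> S k \<subseteq> S (\<phi> g)"
    from \<open>k \<in> TT\<close> have "\<exists>k'\<in>TT. \<phi> k' = k" using auto_surj[OF GT.is_group \<phi>, of k] by simp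
    then obtain k' where k': "k' \<in> TT" "\<phi> k' = k" by blast
    then have "S k' \<subseteq> S f \<and> S k' \<subseteq> S g" using k sub fg by blast
    then show "k = \<one>\<^bsub>GT\<^esub>" using S_disjoint_iff fg k' one by blast
  qed
  have "\<exists>g. g \<in> TT \<and> z \<in> S g \<and> (\<forall>y\<in>S g. val N y = val N z)" for N using bump_S[OF z] by metis
  then obtain b where b: "\<And>N. b N \<in> TT" "\<And>N. z \<in> S (b N)" "\<And>N y. y \<in> S (b N) \<Longrightarrow> val N y = val N z" by metis
  have "S (\<phi> (b N)) \<noteq> {}" for N
    using S_eq_empty[OF aut[OF b(1)]] one[OF b(1)] b(2) S_one by (metis empty_iff)
  then have "\<forall>N. \<exists>q. q \<in> S (\<phi> (b N))" by blast
  then obtain p where p: "\<And>N. p N \<in> S (\<phi> (b N))" by metis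
  then have pC: "p N \<in> C" for N using S_subset by blast
  obtain y where y: "y \<in> C" "\<And>N. \<exists>M\<ge>N. val N (p M) = val N y" using accumulation[of p] pC by blast
  have "z \<in> S f \<longleftrightarrow> y \<in> S (\<phi> f)" if f: "f \<in> TT" for f
  proof
    assume "z \<in> S f"
    then obtain N where N: "\<forall>x\<in>C. val N x = val N z \<longrightarrow> x \<in> S f" using S_open f by blast
    have pf: "p M \<in> S (\<phi> f)" if "M \<ge> N" for M
    proof -
      have "S (b M) \<subseteq> S f" using N b(3)[of _ M] S_subset val_eq_mono[OF _ z _ that] by blast
      then show ?thesis using sub[OF b(1) f] p by blast
    qed
    show "y \<in> S (\<phi> f)"
    proof (rule ccontr)
      assume "y \<notin> S (\<phi> f)"
      then obtain K where K: "\<forall>x\<in>C. val K x = val K y \<longrightarrow> x \<notin> S (\<phi> f)" using S_closed aut[OF f] y by blast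
      obtain M where M: "M \<ge> K + N" "val (K + N) (p M) = val (K + N) y" using y by blast
      have "val K (p M) = val K y" by (rule val_eq_mono[OF pC y(1) M(2)]) simp
      then show False using K pC pf[of M] M by simp
    qed
  next
    assume a: "y \<in> S (\<phi> f)"
    show "z \<in> S f"
    proof (rule ccontr)
      assume "z \<notin> S f"
      then obtain N where N: "\<forall>x\<in>C. val N x = val N z \<longrightarrow> x \<notin> S f" using S_closed f z by blast
      have pf: "p M \<notin> S (\<phi> f)" if "M \<ge> N" for M
      proof -
        have "S (b M) \<inter> S f = {}" using N b(3)[of _ M] S_subset val_eq_mono[OF _ z _ that] by blast
        then show ?thesis using disj[OF b(1) f] p by blast
      qed
      obtain K where K: "\<forall>x\<in>C. val K x = val K y \<longrightarrow> x \<in> S (\<phi> f)" using S_open[OF aut[OF f] a] by blast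
      obtain M where M: "M \<ge> K + N" "val (K + N) (p M) = val (K + N) y" using y by blast
      have "val K (p M) = val K y" by (rule val_eq_mono[OF pC y(1) M(2)]) simp
      then show False using K pC pf[of M] M by simp
    qed
  qed
  then show ?thesis using y(1) by blast
qed

text \<open>Conjugation by \<tau> carries the group onto itself: for each \<open>h\<close>, both
  conjugates, by \<tau> and by its inverse, are in the group. They are described pointwise on
  \<open>C\<close>, with no inverse of \<tau> in the formula.\<close>

definition normalizer :: "(inf_word \<Rightarrow> inf_word) \<Rightarrow> bool" where
  "normalizer \<tau> \<longleftrightarrow> bij_betw \<tau> C C \<and>
     (\<forall>h\<in>TT. \<exists>h'\<in>TT. \<forall>x\<in>C. h' (\<tau> x) = \<tau> (h x)) \<and>
     (\<forall>h\<in>TT. \<exists>h'\<in>TT. \<forall>x\<in>C. \<tau> (h' x) = h (\<tau> x))"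

text \<open>For a bijection of \<open>C\<close> this is continuity of the inverse, stated without
  naming it.\<close>

definition inverse_continuous :: "(inf_word \<Rightarrow> inf_word) \<Rightarrow> bool" where
  "inverse_continuous \<tau> \<longleftrightarrow>
     (\<forall>x\<in>C. \<forall>N. \<exists>M. \<forall>y\<in>C. val M (\<tau> y) = val M (\<tau> x) \<longrightarrow> val N y = val N x)"

text \<open>A point is determined by the closed supports containing it. This gives injectivity of
  \<sigma>, and equivariance because \<open>\<sigma> (t x)\<close> and
  \<open>\<phi> t (\<sigma> x)\<close> lie in the same closed supports. Surjectivity comes from
  \<open>image_point\<close> for the inverse automorphism.\<close>

theorem automorphism_spatial:
  assumes \<phi>: "\<phi> \<in> iso GT GT"
  obtains \<sigma> where "bij_betw \<sigma> C C" "inverse_continuous \<sigma>"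
    "\<And>t x. t \<in> TT \<Longrightarrow> x \<in> C \<Longrightarrow> \<sigma> (t x) = \<phi> t (\<sigma> x)"
proof -
  note aut = auto_closed[OF GT.is_group \<phi>, unfolded carrier_GT]
    and surj = auto_surj[OF GT.is_group \<phi>, unfolded carrier_GT]
  obtain \<sigma> where \<sigma>: "\<And>z. z \<in> C \<Longrightarrow> \<sigma> z \<in> C"
      "\<And>z f. z \<in> C \<Longrightarrow> f \<in> TT \<Longrightarrow> z \<in> S f \<longleftrightarrow> \<sigma> z \<in> S (\<phi> f)"
    using image_point[OF \<phi>] by metis
  have eq: "y = y'" if "y \<in> C" "y' \<in> C" "\<And>f. f \<in> TT \<Longrightarrow> y \<in> S (\<phi> f) \<longleftrightarrow> y' \<in> S (\<phi> f)" for y y'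
    using S_separates[OF that(1,2)] that(3) surj by metis
  have inj: "inj_on \<sigma> C"
    using \<sigma> by (intro inj_onI S_separates) simp_all
  have "\<exists>z\<in>C. \<sigma> z = y" if y: "y \<in> C" for y
  proof -
    define \<psi> where "\<psi> = inv_into (carrier GT) \<phi>"
    have \<psi>: "\<psi> \<in> iso GT GT" unfolding \<psi>_def using GT.iso_set_sym[OF \<phi>] .
    have \<psi>\<phi>: "\<psi> (\<phi> g) = g" if "g \<in> TT" for g
      using \<phi> that by (simp add: \<psi>_def iso_def bij_betw_def)
    obtain z where z: "z \<in> C" "\<And>f. f \<in> TT \<Longrightarrow> y \<in> S f \<longleftrightarrow> z \<in> S (\<psi> f)"
      using image_point[OF \<psi> y] by blast
    have "\<sigma> z = y"
    proof (rule eq)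
      fix f assume f: "f \<in> TT"
      show "\<sigma> z \<in> S (\<phi> f) \<longleftrightarrow> y \<in> S (\<phi> f)" using z(2)[OF aut[OF f]] \<psi>\<phi>[OF f] \<sigma>(2)[OF z(1) f] by simp
    qed (use \<sigma> z y in auto)
    then show ?thesis using z by blast
  qed
  then have "\<sigma> ` C = C" using \<sigma>(1) by blast
  then have bij: "bij_betw \<sigma> C C" using inj by (simp add: bij_betw_def)
  have "\<sigma> (t x) = \<phi> t (\<sigma> x)" if t: "t \<in> TT" and x: "x \<in> C" for t x
  proof (rule eq)
    fix f assume f: "f \<in> TT"
    have T: "t \<odot> f \<odot> gi t \<in> TT" using t f gm_TT gi_TT by simp
    have "\<phi> (t \<odot> f \<odot> gi t) = \<phi> t \<odot> \<phi> f \<odot> gi (\<phi> t)"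
      using auto_mult[OF GT.is_group \<phi>] auto_inv[OF GT.is_group \<phi>] t f gm_TT gi_TT by simp
    then have "\<sigma> x \<in> S (\<phi> t \<odot> \<phi> f \<odot> gi (\<phi> t)) \<longleftrightarrow> t x \<in> S f"
      using \<sigma>(2)[OF x T] S_conj[OF t f x] by simp
    then show "\<sigma> (t x) \<in> S (\<phi> f) \<longleftrightarrow> \<phi> t (\<sigma> x) \<in> S (\<phi> f)"
      using S_conj[OF aut[OF t] aut[OF f] \<sigma>(1)[OF x]] \<sigma>(2)[OF TT_in[OF t x] f] by simp
  qed (use \<sigma>(1) TT_in t x aut in auto)
  moreover have "inverse_continuous \<sigma>"
    unfolding inverse_continuous_def
  proof (intro ballI allI)
    fix x N assume x: "x \<in> C"
    obtain g where g: "g \<in> TT" "x \<in> S g" "\<And>y. y \<in> S g \<Longrightarrow> val N y = val N x" using bump_S[OF x] by blast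
    have "\<sigma> x \<in> S (\<phi> g)" using \<sigma>(2)[OF x g(1)] g(2) by simp
    then obtain M where M: "\<forall>y\<in>C. val M y = val M (\<sigma> x) \<longrightarrow> y \<in> S (\<phi> g)" using S_open[OF aut[OF g(1)]] by blast
    then show "\<exists>M. \<forall>y\<in>C. val M (\<sigma> y) = val M (\<sigma> x) \<longrightarrow> val N y = val N x"
      using \<sigma> g by blast
  qed
  ultimately show ?thesis using that bij by blast
qed

section \<open>Stabilizers of points and gaps\<close>

lemma TT_adj:
  assumes t: "t \<in> TT" and x: "x \<in> C" and y: "y \<in> C"
  shows "adj (t x) (t y) \<longleftrightarrow> adj x y"
proof -
  have "(\<exists>w\<in>C. cyc (t x) w (t y)) \<longleftrightarrow> (\<exists>w\<in>C. cyc x w y)"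
    using TT_cyc_iff[OF t x _ y] TT_surj[OF t] TT_in[OF t] by metis
  then show ?thesis unfolding adj_def using TT_inj[OF t x y] by blast
qed

lemma adj_stab: "t \<in> TT \<Longrightarrow> x \<in> C \<Longrightarrow> y \<in> C \<Longrightarrow> adj x y \<Longrightarrow> t x = x \<longleftrightarrow> t y = y"
  using TT_adj adj_unique_left adj_unique_right TT_in by metis

text \<open>At a large depth a crossing of two neighbouring leaves moves \<open>y\<close> and misses
  \<open>x\<close>. If \<open>y\<close> is the smallest point of some leaf, it is fixed by a
  crossing of its own leaf with the next one, so the preceding leaf is used; in the other case the
  next one. Since the points do not form a gap, \<open>x\<close> can be kept out of the second leaf,
  and since \<open>y\<close> is not an end, that leaf exists.\<close>

lemma separating_interior:
  assumes x: "x \<in> C" and y: "y \<in> C" and ne: "x \<noteq> y" and in_y: "y \<noteq> mn" "y \<noteq> mx"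
    and na: "\<not> adj x y" "\<not> adj y x"
  shows "\<exists>t\<in>TT. t x = x \<and> t y \<noteq> y"
proof -
  obtain N1 where N1: "\<forall>M\<ge>N1. val M x \<noteq> val M y" using neq_val[OF x y ne] by blast
  show ?thesis
  proof (cases "\<exists>N0. y = lo N0 (val N0 y)")
    case False
    obtain N2 where N2: "val N2 y < val N2 mx" using lt_mx[OF y in_y(2)] by (auto simp: lt_def)
    obtain N where N: "N \<ge> N1 + N2" "val N x \<noteq> Suc (val N y)"
      using adj_of_neighbouring_leaves[OF y x] na by metis
    have "val N y < val N mx" using val_less_mono[OF y mx_in N2] N by simp
    then have k: "Suc (val N y) < r * n ^ N" using val_mx[of N] by simp
    have "val N (hi N (Suc (val N y))) \<noteq> val N y" by simp
    then have "y \<noteq> hi N (Suc (val N y))" by metis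
    then have "y \<sqsubset> cross N (val N y) y" using cross_gt[OF k y] False by blast
    then have "cross N (val N y) y \<noteq> y" by auto
    moreover have "cross N (val N y) x = x" using cross_out[OF x] N1 N by simp
    ultimately show ?thesis using cross_TT(1)[OF k] by blast
  next
    case True
    then obtain N0 where N0: "y = lo N0 (val N0 y)" by blast
    obtain N3 where N3: "val N3 mn < val N3 y" using mn_lt[OF y in_y(1)] unfolding lt_def by blast
    obtain N where N: "N \<ge> N0 + N1 + N3" "val N y \<noteq> Suc (val N x)"
      using adj_of_neighbouring_leaves[OF x y] na by metis
    have pos: "0 < val N y" using val_less_mono[OF mn_in y N3, of N] N by simp
    define k where "k = val N y - 1"
    have kS: "Suc k = val N y" using pos by (simp add: k_def)
    then have k: "Suc k < r * n ^ N" using val_bound[OF y] by simp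
    have "snd y N = 0"
      using N by (subst N0) (simp add: lo_def pt_def)
    moreover have "snd (hi N (Suc k)) N = n - 1" by (simp add: hi_def pt_def)
    ultimately have nh: "y \<noteq> hi N (Suc k)" using n2 by auto
    have nl: "y \<noteq> lo N k" using kS val_lo[of N k] by auto
    have "y \<sqsubset> cross N k y" using cross_gt[OF k y] kS nl nh by simp
    then have "cross N k y \<noteq> y" by auto
    moreover have "cross N k x = x" using cross_out[OF x, of N k] N1 N kS by simp
    ultimately show ?thesis using cross_TT(1)[OF k] by blast
  qed
qed

lemma stab_adj:
  assumes x: "x \<in> C" and y: "y \<in> C" and ne: "x \<noteq> y" and st: "\<And>t. t \<in> TT \<Longrightarrow> t x = x \<longleftrightarrow> t y = y"
  shows "adj x y \<or> adj y x"
proof (rule ccontr)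
  assume na: "\<not> ?thesis"
  then have "\<not> (x \<in> {mn, mx} \<and> y \<in> {mn, mx})" using adj_mx_mn ne by auto
  then consider "x \<noteq> mn" "x \<noteq> mx" | "y \<noteq> mn" "y \<noteq> mx" by blast
  then show False
    by cases (use separating_interior[OF y x] separating_interior[OF x y] ne na st in metis)+
qed

text \<open>Unoriented, because equality of stabilizers does not tell the two points apart.\<close>

definition gap :: "inf_word \<Rightarrow> inf_word \<Rightarrow> bool" where
  "gap x y \<longleftrightarrow> adj x y \<or> adj y x"

lemma gap_sym: "gap x y \<longleftrightarrow> gap y x" by (auto simp: gap_def)

lemma normalizer_bij: "normalizer \<tau> \<Longrightarrow> bij_betw \<tau> C C" by (simp add: normalizer_def)

lemma bij_in: "bij_betw \<tau> C C \<Longrightarrow> x \<in> C \<Longrightarrow> \<tau> x \<in> C" by (rule bij_betwE[THEN bspec])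

lemma bij_eq: "bij_betw \<tau> C C \<Longrightarrow> x \<in> C \<Longrightarrow> y \<in> C \<Longrightarrow> \<tau> x = \<tau> y \<longleftrightarrow> x = y"
  by (auto simp: bij_betw_def inj_on_def)

lemma bij_preimage: "bij_betw \<tau> C C \<Longrightarrow> y \<in> C \<Longrightarrow> \<exists>x\<in>C. \<tau> x = y"
proof -
  assume "bij_betw \<tau> C C" "y \<in> C"
  then have "y \<in> \<tau> ` C" by (simp add: bij_betw_def)
  then show ?thesis by blast
qed

lemma gap_iff:
  assumes "x \<in> C" "y \<in> C"
  shows "gap x y \<longleftrightarrow> x \<noteq> y \<and> (\<forall>t\<in>TT. t x = x \<longleftrightarrow> t y = y)"
  using stab_adj[OF assms] adj_stab assms unfolding gap_def by (metis adj_def)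

lemma normalizer_gap:
  assumes \<tau>: "normalizer \<tau>" and x: "x \<in> C" and y: "y \<in> C"
  shows "gap (\<tau> x) (\<tau> y) \<longleftrightarrow> gap x y"
proof -
  note bij = normalizer_bij[OF \<tau>]
  have 1: "\<exists>h'\<in>TT. \<forall>x\<in>C. h' (\<tau> x) = \<tau> (h x)" if "h \<in> TT" for h using \<tau> that by (simp add: normalizer_def)
  have 2: "\<exists>h'\<in>TT. \<forall>x\<in>C. \<tau> (h' x) = h (\<tau> x)" if "h \<in> TT" for h using \<tau> that by (simp add: normalizer_def)
  have "(\<forall>t\<in>TT. t (\<tau> x) = \<tau> x \<longleftrightarrow> t (\<tau> y) = \<tau> y) \<longleftrightarrow> (\<forall>t\<in>TT. t x = x \<longleftrightarrow> t y = y)"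
  proof (rule iffI; rule ballI)
    fix h assume a: "\<forall>t\<in>TT. t (\<tau> x) = \<tau> x \<longleftrightarrow> t (\<tau> y) = \<tau> y" and h: "h \<in> TT"
    obtain h' where "h' \<in> TT" "\<forall>x\<in>C. h' (\<tau> x) = \<tau> (h x)" using 1 h by blast
    then show "h x = x \<longleftrightarrow> h y = y" using a bij_eq[OF bij] x y TT_in[OF h] by metis
  next
    fix h assume a: "\<forall>t\<in>TT. t x = x \<longleftrightarrow> t y = y" and h: "h \<in> TT"
    obtain h' where "h' \<in> TT" "\<forall>x\<in>C. \<tau> (h' x) = h (\<tau> x)" using 2 h by blast
    then show "h (\<tau> x) = \<tau> x \<longleftrightarrow> h (\<tau> y) = \<tau> y" using a bij_eq[OF bij] x y TT_in by metis
  qed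
  then show ?thesis
    unfolding gap_iff[OF bij_in[OF bij x] bij_in[OF bij y]] gap_iff[OF x y] bij_eq[OF bij x y] by blast
qed

text \<open>A discrete intermediate value theorem. A locally constant predicate depends only on the
  leaf at some uniform depth; between the leaves of \<open>x\<close> and \<open>y\<close> it must
  change from one leaf to the next, and the ends of these two leaves form a gap.\<close>

lemma change_at_gap:
  assumes P: "\<And>x. x \<in> C \<Longrightarrow> \<exists>N. \<forall>y\<in>C. val N y = val N x \<longrightarrow> (P y \<longleftrightarrow> P x)"
    and x: "x \<in> C" and y: "y \<in> C" and xy: "x \<sqsubset> y" and ne: "P x \<noteq> P y"
  obtains a b where "a \<in> C" "b \<in> C" "adj a b" "a \<sqsubset> b" "\<not> a \<sqsubset> x" "\<not> y \<sqsubset> b" "P a \<noteq> P b"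
proof -
  obtain N where N: "\<And>x. x \<in> C \<Longrightarrow> \<forall>y\<in>C. val N y = val N x \<longrightarrow> (P y \<longleftrightarrow> P x)"
  proof (rule uniform_depth[where P = "\<lambda>N x. \<forall>y\<in>C. val N y = val N x \<longrightarrow> (P y \<longleftrightarrow> P x)"])
    fix x y N M
    assume h: "x \<in> C" "y \<in> C" "\<forall>y\<in>C. val N y = val N x \<longrightarrow> (P y \<longleftrightarrow> P x)" "N \<le> M" "val N y = val N x"
    show "\<forall>z\<in>C. val M z = val M y \<longrightarrow> (P z \<longleftrightarrow> P y)"
    proof (intro ballI impI)
      fix z assume z: "z \<in> C" "val M z = val M y"
      have "val N z = val N x" using val_eq_mono[OF z(1) h(2) z(2) h(4)] h(5) by simp
      then show "P z \<longleftrightarrow> P y" using h z by blast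
    qed
  qed (use P in blast)+
  let ?Q = "\<lambda>k. P (lo N k)"
  have PQ: "P z \<longleftrightarrow> ?Q (val N z)" if "z \<in> C" for z
    using N[OF that] lo_in[OF val_bound[OF that]] by simp
  have le: "val N x \<le> val N y" using lt_le x y xy by blast
  have "\<exists>k. val N x \<le> k \<and> k < val N y \<and> ?Q k \<noteq> ?Q (Suc k)"
  proof (rule ccontr)
    assume no: "\<nexists>k. val N x \<le> k \<and> k < val N y \<and> ?Q k \<noteq> ?Q (Suc k)"
    have "val N x + j \<le> val N y \<Longrightarrow> ?Q (val N x + j) = ?Q (val N x)" for j
    proof (induction j)
      case (Suc j)
      then show ?case using no[unfolded not_ex, rule_format, of "val N x + j"] by simp
    qed simp
    from this[of "val N y - val N x"] have "?Q (val N y) = ?Q (val N x)" using le by simp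
    then show False using PQ[OF x] PQ[OF y] ne by blast
  qed
  then obtain k where k: "val N x \<le> k" "k < val N y" "?Q k \<noteq> ?Q (Suc k)" by blast
  have kL: "Suc k < r * n ^ N" using k val_bound[OF y, of N] by simp
  show ?thesis
  proof (rule that)
    show h: "hi N k \<in> C" and "lo N (Suc k) \<in> C" using hi_in lo_in kL by auto
    show "P (hi N k) \<noteq> P (lo N (Suc k))" using PQ[OF h] k(3) by simp
    show "adj (hi N k) (lo N (Suc k))" "hi N k \<sqsubset> lo N (Suc k)" using adj_leaf kL by auto
    show "\<not> hi N k \<sqsubset> x" using hi_greatest x k kL by simp
    show "\<not> y \<sqsubset> lo N (Suc k)" using lo_least y k by simp
  qed
qed

text \<open>The first \<open>k\<close> leaves form an arc of the circle, whose boundary consists of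
  two gaps: the one before leaf \<open>k\<close> and the base gap.\<close>

lemma gap_boundary:
  assumes x: "x \<in> C" and y: "y \<in> C" and g: "gap x y" and k: "val N x < k" "k \<le> val N y"
  shows "x = hi N (k - 1) \<and> y = lo N k \<or> x = mn \<and> y = mx"
proof -
  have xy: "x \<sqsubset> y" using k by (auto simp: lt_def intro!: exI[of _ N])
  have kL: "k < r * n ^ N" "k - 1 < r * n ^ N" using k val_bound[OF y, of N] by auto
  have hl: "hi N (k - 1) \<in> C" "lo N k \<in> C" using hi_in lo_in kL by auto
  show ?thesis
  proof (cases "adj x y")
    case True
    have "hi N (k - 1) \<sqsubset> y" "x \<sqsubset> lo N k"
      using k by (auto simp: lt_def intro!: exI[of _ N])
    then have "\<not> x \<sqsubset> hi N (k - 1)" "\<not> lo N k \<sqsubset> y" using adj_lt[OF True xy] hl by blast+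
    moreover have "\<not> hi N (k - 1) \<sqsubset> x" "\<not> y \<sqsubset> lo N k"
      using hi_greatest[OF x _ kL(2)] lo_least[OF y] k by auto
    ultimately show ?thesis using lt_total hl x y by blast
  next
    case False
    then have "adj y x" using g by (simp add: gap_def)
    then show ?thesis using adj_gt xy x y by blast
  qed
qed

text \<open>A leaf boundary separates \<open>z\<close> from \<open>z'\<close>; \<open>P w\<close>
  says that the preimage of \<open>w\<close> is below it. By continuity \<open>P\<close> is locally
  constant, and it changes only at images of the two boundary gaps. One of these is the base gap
  again, so on the line \<open>P\<close> changes at the single gap from \<open>c'\<close> to
  \<open>c\<close>. The image of the lower part is therefore an initial or a final segment, and the
  value at \<open>mn\<close> decides which.\<close>

lemma monotone_or_antitone:
  assumes bij: "bij_betw \<tau> C C" and gap: "\<And>x y. x \<in> C \<Longrightarrow> y \<in> C \<Longrightarrow> gap (\<tau> x) (\<tau> y) \<longleftrightarrow> gap x y"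
    and cont: "inverse_continuous \<tau>" and base: "\<tau> mn = mn \<and> \<tau> mx = mx \<or> \<tau> mn = mx \<and> \<tau> mx = mn"
    and z: "z \<in> C" "z' \<in> C" "z \<sqsubset> z'"
  shows "if \<tau> mn = mn then \<tau> z \<sqsubset> \<tau> z' else \<tau> z' \<sqsubset> \<tau> z"
proof -
  note tC = bij_in[OF bij] and te = bij_eq[OF bij]
  obtain N where N: "val N z < val N z'" using z by (auto simp: lt_def)
  define k where "k = val N z'"
  have k: "k < r * n ^ N" "0 < k" "k - 1 < r * n ^ N" "Suc (k - 1) = k"
    using val_bound[OF z(2), of N] N by (auto simp: k_def)
  define b where "b = lo N k"
  define b' where "b' = hi N (k - 1)"
  have bC: "b \<in> C" "b' \<in> C" using lo_in hi_in k by (auto simp: b_def b'_def)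
  have "adj b' b" using adj_leaf(1)[of "k - 1" N] k by (simp add: b_def b'_def)
  then have g: "gap (\<tau> b') (\<tau> b)" using gap bC by (simp add: gap_def)
  have "snd b N = 0" by (simp add: b_def lo_def pt_def)
  then have "b \<noteq> mx" using n2 by (auto simp: mx_def)
  have "val N b = k" by (simp add: b_def)
  then have "b \<noteq> mn" using k(2) by auto
  with \<open>b \<noteq> mx\<close> have tb: "\<tau> b \<noteq> mn" "\<tau> b \<noteq> mx" using base te[OF bC(1)] mn_in mx_in by metis+
  obtain c c' where c: "c \<in> C" "c' \<in> C" "adj c' c" "c' \<sqsubset> c" "{c', c} = {\<tau> b', \<tau> b}"
  proof -
    obtain c c' where c: "adj c' c" "{c', c} = {\<tau> b', \<tau> b}" using g unfolding gap_def by (metis insert_commute)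
    have cC: "c \<in> C" "c' \<in> C" using c(2) tC[OF bC(1)] tC[OF bC(2)] by (auto simp: doubleton_eq_iff)
    have "\<not> c \<sqsubset> c'"
    proof
      assume "c \<sqsubset> c'"
      then have "c' = mx \<and> c = mn" using adj_gt c(1) cC by blast
      then show False using c(2) tb by (auto simp: doubleton_eq_iff)
    qed
    then have "c' \<sqsubset> c" using lt_total cC c(1) unfolding adj_def by blast
    then show ?thesis using that cC c by blast
  qed
  define \<rho> where "\<rho> = inv_into C \<tau>"
  have \<rho>: "\<rho> w \<in> C" "\<tau> (\<rho> w) = w" if "w \<in> C" for w
    using bij that unfolding \<rho>_def bij_betw_def by (auto simp: inv_into_into f_inv_into_f)
  have \<rho>\<tau>: "\<rho> (\<tau> x) = x" if "x \<in> C" for x using te \<rho> tC that by blast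
  define P where "P w \<longleftrightarrow> val N (\<rho> w) < k" for w
  have loc: "\<exists>M. \<forall>y\<in>C. val M y = val M w \<longrightarrow> (P y \<longleftrightarrow> P w)" if w: "w \<in> C" for w
  proof -
    obtain M where M: "\<forall>y\<in>C. val M (\<tau> y) = val M (\<tau> (\<rho> w)) \<longrightarrow> val N y = val N (\<rho> w)"
      using cont \<rho>(1)[OF w] unfolding inverse_continuous_def by blast
    have "val N (\<rho> y) = val N (\<rho> w)" if "y \<in> C" "val M y = val M w" for y
      using M \<rho>(1)[OF that(1)] \<rho>(2)[OF that(1)] \<rho>(2)[OF w] that(2) by metis
    then show ?thesis unfolding P_def by (intro exI[of _ M]) simp
  qed
  \<comment> \<open>A change between two points on the same side of the gap from \<open>c'\<close>
    to \<open>c\<close> happens at some gap \<open>a\<close>, \<open>a2\<close>, whose preimage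
    straddles the boundary. If the preimage is \<open>b'\<close>, \<open>b\<close>, the gap is
    \<open>c'\<close>, \<open>c\<close> itself, which is not between the points; if it is the base
    gap, then \<open>a = mn\<close> and \<open>a2 = mx\<close>, which are not adjacent in this
    orientation.\<close>
  have side: False
    if w: "w1 \<in> C" "w2 \<in> C" "P w1 \<noteq> P w2" "w1 \<sqsubset> w2"
      and s: "\<not> c' \<sqsubset> w2 \<or> \<not> w1 \<sqsubset> c" for w1 w2
  proof -
    obtain a a2 where a: "a \<in> C" "a2 \<in> C" "adj a a2" "a \<sqsubset> a2" "\<not> a \<sqsubset> w1" "\<not> w2 \<sqsubset> a2" "P a \<noteq> P a2"
      using change_at_gap[where P = P, OF loc w(1,2,4,3)] by metis
    have g2: "gap (\<rho> a) (\<rho> a2)" using gap[OF \<rho>(1)[OF a(1)] \<rho>(1)[OF a(2)]] \<rho>(2) a by (simp add: gap_def)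
    have "{\<rho> a, \<rho> a2} = {b', b} \<or> {\<rho> a, \<rho> a2} = {mn, mx}"
    proof (cases "P a")
      case True
      then show ?thesis using gap_boundary[OF \<rho>(1)[OF a(1)] \<rho>(1)[OF a(2)] g2, of N k] a(7)
        by (auto simp: P_def b_def b'_def)
    next
      case False
      then show ?thesis using gap_boundary[OF \<rho>(1)[OF a(2)] \<rho>(1)[OF a(1)], of N k] g2 a(7)
        by (auto simp: P_def b_def b'_def gap_sym)
    qed
    then have "\<tau> ` {\<rho> a, \<rho> a2} = \<tau> ` {b', b} \<or> \<tau> ` {\<rho> a, \<rho> a2} = \<tau> ` {mn, mx}" by metis
    then have "{a, a2} = {\<tau> b', \<tau> b} \<or> {a, a2} = {mn, mx}" using \<rho>(2) a(1,2) base by auto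
    then consider "{a, a2} = {c', c}" | "{a, a2} = {mn, mx}" using c by metis
    then show False
    proof cases
      case 1
      then have "a = c' \<and> a2 = c" using a(4) c lt_asym by (metis doubleton_eq_iff)
      then show False using s a c w le_lt_trans lt_le_trans lt_irrefl by metis
    next
      case 2
      then have "a = mn \<and> a2 = mx" using a(4) mn_lt_mx lt_asym mn_in mx_in by (metis doubleton_eq_iff)
      then show False using a(3) not_adj_mn_mx by blast
    qed
  qed
  have same: "P w1 = P w2" if w: "w1 \<in> C" "w2 \<in> C"
      and s: "\<not> c' \<sqsubset> w1 \<and> \<not> c' \<sqsubset> w2 \<or> \<not> w1 \<sqsubset> c \<and> \<not> w2 \<sqsubset> c" for w1 w2
    using side[of w1 w2] side[of w2 w1] lt_total[OF w] s w by metis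
  have split: "\<not> c' \<sqsubset> w \<or> \<not> w \<sqsubset> c" if "w \<in> C" for w using adj_lt[OF c(3,4) that] by blast
  have Pz: "P (\<tau> z)" "\<not> P (\<tau> z')" "P (\<tau> mn)"
    using \<rho>\<tau> z mn_in N k by (simp_all add: P_def k_def)
  have zC: "\<tau> z \<in> C" "\<tau> z' \<in> C" using tC z by auto
  show ?thesis
  proof (cases "\<tau> mn = mn")
    case True
    have "\<not> c' \<sqsubset> mn" using mn_least c by blast
    then have "c' \<sqsubset> \<tau> z'" using same[OF mn_in zC(2)] Pz True by auto
    then have 1: "\<not> \<tau> z' \<sqsubset> c" using split zC by blast
    then have "\<tau> z \<sqsubset> c" using same[OF zC] Pz by blast
    then show ?thesis using lt_le_trans[OF zC(1) c(1) zC(2)] 1 True by simp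
  next
    case False
    then have m: "\<tau> mn = mx" using base by blast
    have "\<not> mx \<sqsubset> c" using mx_greatest c by blast
    then have 1: "\<tau> z' \<sqsubset> c" using same[OF mx_in zC(2)] Pz m by auto
    then have "\<not> c' \<sqsubset> \<tau> z'" using split zC by blast
    then have "\<not> \<tau> z \<sqsubset> c" using same[OF zC] Pz split zC by blast
    then show ?thesis using lt_le_trans[OF zC(2) c(1) zC(1)] 1 False by simp
  qed
qed

text \<open>The upper end of a gap is the smallest point of some leaf, so a rotation of the leaves
  carries it to \<open>mn\<close>. The lower end follows because a gap is determined by its upper
  end.\<close>

lemma TT_move_to_mn:
  assumes "adj a b" "a \<in> C" "b \<in> C"
  obtains t where "t \<in> TT" "t b = mn" "t a = mx"
proof -
  obtain N where N: "b = lo N (val N b)" using adj_right_lo assms by blast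
  define L where "L = r * n ^ N"
  define k where "k = val N b"
  have kL: "k < L" using val_bound assms by (simp add: k_def L_def)
  \<comment> \<open>The reduction modulo \<open>L\<close> covers \<open>k = 0\<close>, where
    \<open>L - k\<close> is not below \<open>L\<close> as \<open>rot_TT\<close> requires.\<close>
  define m where "m = (L - k) mod L"
  have m: "m < L" using kL by (simp add: m_def)
  have "(k + m) mod L = (k + (L - k)) mod L" unfolding m_def by (simp add: mod_add_right_eq)
  also have "\<dots> = 0" using kL by simp
  finally have km: "(k + m) mod L = 0" .
  have t: "rot N m \<in> TT" using rot_TT m by (simp add: L_def)
  have "tail N b = (\<lambda>_. 0)" by (subst N) (simp add: lo_def)
  then have 1: "rot N m b = mn"
    using km assms(3) lo_eq_mn[of N] by (simp add: rot_def k_def L_def lo_def)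
  moreover have "rot N m a = mx"
    using TT_adj[OF t assms(2,3)] assms(1) 1 adj_mx_mn adj_unique_left TT_in[OF t] assms mx_in mn_in by metis
  ultimately show ?thesis using that t by blast
qed

end

section \<open>Exponents at the smallest point\<close>

context thompson
begin

text \<open>Near the smallest point, \<open>h\<close> is a scaling by \<open>n\<close> to the power \<open>- k\<close>.\<close>

definition expo :: "(inf_word \<Rightarrow> inf_word) \<Rightarrow> int \<Rightarrow> bool" where
  "expo h k \<longleftrightarrow> h mn = mn \<and> (\<exists>a b. int b - int a = k \<and> local_at h mn a b)"

lemma expoI: "h mn = mn \<Longrightarrow> local_at h mn a b \<Longrightarrow> int b - int a = k \<Longrightarrow> expo h k"
  unfolding expo_def by blast

lemma expo_mn: "expo h k \<Longrightarrow> h mn = mn" by (simp add: expo_def)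

lemma expo_ex: "h \<in> TT \<Longrightarrow> h mn = mn \<Longrightarrow> \<exists>k. expo h k"
  using TT_local[OF _ mn_in] unfolding expo_def by metis

text \<open>Two descriptions are refined to a common depth \<open>A\<close> of the domain and tested
  on the tail \<open>1 0 0 ...\<close>: its only nonzero letter would have to stand at two positions
  of the same image.\<close>

lemma expo_unique:
  assumes h: "h \<in> TT" and k: "expo h k" "expo h l"
  shows "k = l"
proof -
  obtain a b where ab: "int b - int a = k" "local_at h mn a b" using k by (auto simp: expo_def)
  obtain c d where cd: "int d - int c = l" "local_at h mn c d" using k by (auto simp: expo_def)
  define A where "A = a + c"
  have 1: "local_at h mn A (b + c)" unfolding A_def using local_at_add[OF TT_in[OF h] mn_in ab(2)] by blast
  have 2: "local_at h mn A (d + a)"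
    using local_at_add[OF TT_in[OF h] mn_in cd(2), of a] by (simp add: A_def add.commute)
  define w where "w = (\<lambda>i::nat. if i = 0 then 1 else 0::nat)"
  have w: "w \<in> cantor n" using n2 by (auto simp: cantor_def w_def)
  define y where "y = pt A 0 w"
  have y: "y \<in> C" "val A y = val A mn" "tail A y = w"
    unfolding y_def using pt_in[OF leaf_pos w] by simp_all
  have "tail (b + c) (h y) = w" "tail (d + a) (h y) = w" using local_atD(2)[OF 1 y(1,2)] local_atD(2)[OF 2 y(1,2)] y by auto
  then have t: "snd (h y) (b + c + i) = w i" "snd (h y) (d + a + i) = w i" for i
    unfolding tail_def by (metis)+
  have "b + c = d + a"
  proof (rule linorder_cases)
    assume "b + c < d + a"
    then show ?thesis using t(1)[of "d + a - (b + c)"] t(2)[of 0] by (simp add: w_def)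
  next
    assume "d + a < b + c"
    then show ?thesis using t(2)[of "b + c - (d + a)"] t(1)[of 0] by (simp add: w_def)
  qed
  then show ?thesis using ab cd by simp
qed

lemma expo_mult:
  assumes g: "g \<in> TT" and h: "h \<in> TT" and k: "expo g k" "expo h l"
  shows "expo (g \<odot> h) (k + l)"
proof -
  obtain a b where ab: "int b - int a = k" "local_at g mn a b" using k by (auto simp: expo_def)
  obtain c d where cd: "int d - int c = l" "local_at h mn c d" using k by (auto simp: expo_def)
  have m: "g mn = mn" "h mn = mn" using k expo_mn by auto
  have "local_at (g \<odot> h) mn (a + (max b c - b)) (d + (max b c - c))"
    unfolding mult_GT using local_at_compose[OF g h mn_in ab(2)] cd m by simp
  moreover have "(g \<odot> h) mn = mn" using m mn_in by (simp add: mult_app)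
  ultimately show ?thesis using ab cd by (intro expoI) auto
qed

lemma expo_fixed_nbhd: "h \<in> TT \<Longrightarrow> (\<And>y. y \<in> C \<Longrightarrow> val a y = 0 \<Longrightarrow> h y = y) \<Longrightarrow> expo h 0"
  using mn_in by (intro expoI[of _ a a]) (auto simp: local_at_def)

lemma expo_one: "expo \<one>\<^bsub>GT\<^esub> 0"
  using expo_fixed_nbhd[OF one_TT, of 0] one_app by simp

lemma gi_mn: "g \<in> TT \<Longrightarrow> g mn = mn \<Longrightarrow> gi g mn = mn"
  using gi_left mn_in by metis

lemma expo_inv: "g \<in> TT \<Longrightarrow> expo g k \<Longrightarrow> expo (gi g) (- k)"
proof -
  assume g: "g \<in> TT" and k: "expo g k"
  obtain l where l: "expo (gi g) l" using expo_ex[OF gi_TT[OF g]] gi_mn g k expo_mn by blast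
  have "expo \<one>\<^bsub>GT\<^esub> (k + l)" using expo_mult[OF g gi_TT[OF g] k l] g by simp
  then have "k + l = 0" using expo_unique one_TT expo_one by blast
  then show ?thesis using l by (simp add: add_eq_0_iff)
qed

lemma expo_pow: "g \<in> TT \<Longrightarrow> expo g k \<Longrightarrow> expo (g [^]\<^bsub>GT\<^esub> (m::nat)) (int m * k)"
proof (induction m)
  case (Suc m)
  then show ?case using expo_mult[OF gpow_TT, of g g m "int m * k" k] by (simp add: algebra_simps)
qed (simp add: expo_one)

text \<open>The exponent determines the germ: around the fixed point \<open>mn\<close> both the
  replaced and the replacing prefix consist of zeros, so only their lengths matter.\<close>

lemma expo_agree:
  assumes g: "g \<in> TT" and h: "h \<in> TT" and k: "expo g k" "expo h k"
  shows "\<exists>a. \<forall>y\<in>C. val a y = 0 \<longrightarrow> g y = h y"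
proof -
  obtain a b where ab: "int b - int a = k" "local_at g mn a b" using k by (auto simp: expo_def)
  obtain c d where cd: "int d - int c = k" "local_at h mn c d" using k by (auto simp: expo_def)
  have m: "g mn = mn" "h mn = mn" using k expo_mn by auto
  have 1: "local_at g mn (a + c) (b + c)" using local_at_add[OF TT_in[OF g] mn_in ab(2)] by blast
  have bc: "d + a = b + c" using ab cd by linarith
  have 2: "local_at h mn (a + c) (b + c)"
    using local_at_add[OF TT_in[OF h] mn_in cd(2), of a] bc by (simp add: add.commute[of c a])
  have "g y = h y" if y: "y \<in> C" "val (a + c) y = 0" for y
  proof (rule point_eqI)
    show "g y \<in> C" "h y \<in> C" using TT_in g h y by auto
    have v: "val (a + c) y = val (a + c) mn" using y by simp
    show "val (b + c) (g y) = val (b + c) (h y)" using local_atD(1)[OF 1 y(1) v] local_atD(1)[OF 2 y(1) v] m by simp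
    show "tail (b + c) (g y) = tail (b + c) (h y)" using local_atD(2)[OF 1 y(1) v] local_atD(2)[OF 2 y(1) v] by simp
  qed
  then show ?thesis by blast
qed

lemma expo_cong:
  assumes h: "h \<in> TT" and g: "g \<in> TT" "expo g k" and ag: "\<And>y. y \<in> C \<Longrightarrow> val a y = 0 \<Longrightarrow> h y = g y"
  shows "expo h k"
proof -
  obtain c b where cb: "int b - int c = k" "local_at g mn c b" using g by (auto simp: expo_def)
  have 1: "local_at g mn (c + a) (b + a)" using local_at_add[OF TT_in[OF g(1)] mn_in cb(2)] by blast
  have m: "h mn = g mn" using ag mn_in by simp
  have "local_at h mn (c + a) (b + a)"
    unfolding local_at_def
  proof (intro ballI impI)
    fix y assume y: "y \<in> C" "val (c + a) y = val (c + a) mn"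
    have "val a y = val a mn" by (rule val_eq_mono[OF y(1) mn_in y(2)]) simp
    then have "h y = g y" using ag y by simp
    then show "val (b + a) (h y) = val (b + a) (h mn) \<and> tail (b + a) (h y) = tail (c + a) y"
      using local_atD[OF 1 y] m by simp
  qed
  then show ?thesis using cb m expo_mn[OF g(2)] by (intro expoI[of h "c + a" "b + a"]) auto
qed

text \<open>A negative exponent deletes leading zeros and brings the first nonzero letter
  forward.\<close>

lemma expo_neg_moves_up:
  assumes g: "g \<in> TT" and k: "expo g k" "k < 0"
  shows "\<exists>a. \<forall>y\<in>C. val a y = 0 \<and> y \<noteq> mn \<longrightarrow> y \<sqsubset> g y"
proof -
  obtain a b where ab: "int b - int a = k" "local_at g mn a b" using k by (auto simp: expo_def)
  have "y \<sqsubset> g y" if y: "y \<in> C" "val a y = 0" "y \<noteq> mn" for y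
  proof -
    have v: "val a y = val a mn" using y by simp
    have "tail a mn = (\<lambda>_. 0)" by (simp add: tail_def mn_def)
    then have "tail a y \<noteq> (\<lambda>_. 0)" using point_eqI[OF y(1) mn_in v] y(3) by metis
    then have "\<exists>i. tail a y i \<noteq> 0" by auto
    then obtain i where i: "tail a y i \<noteq> 0" "\<forall>j<i. tail a y j = 0" using exists_least_iff[of "\<lambda>i. tail a y i \<noteq> 0"] by auto
    have "tail b (g y) i \<noteq> 0" using local_atD(2)[OF ab(2) y(1) v] i by simp
    then have gy: "0 < val (Suc (b + i)) (g y)" by (simp add: tail_def)
    have "snd y j = 0" if j: "j < a + i" for j
    proof (cases "j < a")
      case True
      then show ?thesis using val_eq_iff[OF y(1) mn_in, of a] v by (simp add: mn_def)
    next
      case False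
      then show ?thesis using i(2)[rule_format, of "j - a"] j by (simp add: tail_def)
    qed
    moreover have "fst y = 0" using val_eq_iff[OF y(1) mn_in, of a] v by (simp add: mn_def)
    ultimately have "val (a + i) y = val (a + i) mn" using val_eq_iff[OF y(1) mn_in, of "a + i"] by (simp add: mn_def)
    moreover have "Suc (b + i) \<le> a + i" using ab(1) k(2) by linarith
    ultimately have "val (Suc (b + i)) y = val (Suc (b + i)) mn" using val_eq_mono[OF y(1) mn_in] by blast
    then show ?thesis unfolding lt_def using gy val_mn by metis
  qed
  then show ?thesis by blast
qed

lemma TT_increasing:
  assumes g: "g \<in> TT" "g mn = mn" and x: "x \<in> C" "y \<in> C" "x \<sqsubset> y"
  shows "g x \<sqsubset> g y"
proof (cases "x = mn")
  case True
  then have "g y \<noteq> mn" using g x TT_inj mn_in lt_irrefl by metis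
  then show ?thesis using True g mn_lt TT_in x by simp
next
  case False
  then have "cyc mn x y" using mn_lt x by (simp add: cyc_def)
  then have "cyc mn (g x) (g y)" using TT_cyc[OF g(1) mn_in x(1,2)] g(2) by simp
  then show ?thesis using mn_least TT_in[OF g(1)] x unfolding cyc_def by blast
qed

section \<open>Increasing normalizers near the smallest point\<close>

definition increasing :: "(inf_word \<Rightarrow> inf_word) \<Rightarrow> bool" where
  "increasing \<tau> \<longleftrightarrow> (\<forall>x\<in>C. \<forall>y\<in>C. x \<sqsubset> y \<longrightarrow> \<tau> x \<sqsubset> \<tau> y)"

lemma increasingD: "increasing \<tau> \<Longrightarrow> x \<in> C \<Longrightarrow> y \<in> C \<Longrightarrow> x \<sqsubset> y \<Longrightarrow> \<tau> x \<sqsubset> \<tau> y"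
  by (simp add: increasing_def)

lemma increasing_iff:
  assumes "increasing \<tau>" "bij_betw \<tau> C C" "x \<in> C" "y \<in> C"
  shows "\<tau> x \<sqsubset> \<tau> y \<longleftrightarrow> x \<sqsubset> y"
  using assms increasingD[OF assms(1)] lt_total[of x y] lt_asym[of "\<tau> x" "\<tau> y"] bij_in lt_irrefl by metis

lemma increasing_mn: "increasing \<tau> \<Longrightarrow> bij_betw \<tau> C C \<Longrightarrow> \<tau> mn = mn"
  using bij_preimage[OF _ mn_in] increasingD mn_lt mn_least mn_in bij_in by metis

lemma increasing_mx: "increasing \<tau> \<Longrightarrow> bij_betw \<tau> C C \<Longrightarrow> \<tau> mx = mx"
  using bij_preimage[OF _ mx_in] increasingD lt_mx mx_greatest mx_in bij_in by metis

lemma Suc_le_leaves: "Suc (Suc 0) \<le> r * n ^ Suc a"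
  using leaf_pos[of a] n2 mult_le_mono[of 1 "r * n ^ a" 2 n] by (simp add: mult_ac)

text \<open>Continuity of the inverse of \<tau> at \<open>mn\<close>, obtained from monotonicity:
  points mapped below \<open>\<tau> d\<close> lie below \<open>d\<close>.\<close>

lemma small_preimage:
  assumes inc: "increasing \<tau>" and bij: "bij_betw \<tau> C C"
  shows "\<exists>a'. \<forall>y\<in>C. val a' (\<tau> y) = 0 \<longrightarrow> val a y = 0"
proof -
  have one: "1 < r * n ^ Suc a" using Suc_le_leaves[of a] by simp
  define d where "d = lo (Suc a) 1"
  have d: "d \<in> C" "d \<noteq> mn" using lo_in[OF one] val_lo[of "Suc a" 1] val_mn[of "Suc a"] by (auto simp: d_def)
  then have "\<tau> d \<noteq> mn" using increasing_mn[OF inc bij] bij_eq[OF bij d(1) mn_in] by metis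
  then obtain a' where a': "val a' mn < val a' (\<tau> d)" using mn_lt bij_in[OF bij d(1)] unfolding lt_def by blast
  have "val a y = 0" if y: "y \<in> C" "val a' (\<tau> y) = 0" for y
  proof -
    have "\<tau> y \<sqsubset> \<tau> d" unfolding lt_def using a' y by (intro exI[of _ a']) simp
    then have "y \<sqsubset> d" using increasing_iff[OF inc bij y(1) d(1)] by blast
    then have "\<not> 1 \<le> val (Suc a) y" using lo_least[OF y(1)] unfolding d_def by blast
    then have "val (Suc a) y = val (Suc a) mn" by (simp del: pval.simps)
    from val_eq_mono[OF y(1) mn_in this, of a] show ?thesis by simp
  qed
  then show ?thesis by blast
qed

lemma normalizer_ex: "normalizer \<tau> \<Longrightarrow> h \<in> TT \<Longrightarrow> \<exists>h'\<in>TT. \<forall>x\<in>C. h' (\<tau> x) = \<tau> (h x)"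
  by (simp add: normalizer_def)

lemma normalizer_ex': "normalizer \<tau> \<Longrightarrow> h \<in> TT \<Longrightarrow> \<exists>h'\<in>TT. \<forall>x\<in>C. \<tau> (h' x) = h (\<tau> x)"
  by (simp add: normalizer_def)

lemma conj_funpow:
  assumes "\<And>x. x \<in> C \<Longrightarrow> h' (\<tau> x) = \<tau> (h x)" "\<And>x. x \<in> C \<Longrightarrow> h x \<in> C" "x \<in> C"
  shows "(h' ^^ m) (\<tau> x) = \<tau> ((h ^^ m) x)"
  using assms(1) funpow_in[of C h, OF assms(2) assms(3)] by (induction m) auto

lemma expo_cross:
  shows "cross (Suc a) 0 \<in> TT" "expo (cross (Suc a) 0) (-1)"
proof -
  have k: "Suc 0 < r * n ^ Suc a" using Suc_le_leaves[of a] by simp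
  show "cross (Suc a) 0 \<in> TT" using cross_TT k by blast
  have "local_at (cross (Suc a) 0) mn (Suc (Suc a)) (Suc a)"
    by (rule cross_local_bottom[OF mn_in val_mn]) (simp add: tail_def mn_def)
  moreover have "cross (Suc a) 0 mn = mn" using cross_lo[OF k] lo_eq_mn by simp
  ultimately show "expo (cross (Suc a) 0) (-1)" by (intro expoI) auto
qed

text \<open>The exponent of a conjugate depends only on the exponent of the element, because
  elements with equal germs at \<open>mn\<close> have conjugates with equal germs
  (\<open>near\<close>). With \<open>e\<close> the exponent of the conjugate of \<open>G\<close>,
  conjugation multiplies exponents by \<open>- e\<close> (\<open>gen\<close>); applied to a preimage
  \<open>H\<close> of \<open>G\<close> this makes \<open>e\<close> a unit. The value
  \<open>e = 1\<close> is excluded by the order.\<close>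

theorem expo_conj:
  assumes nrm: "normalizer \<tau>" and inc: "increasing \<tau>"
    and h: "h \<in> TT" and h': "h' \<in> TT" and conj: "\<And>x. x \<in> C \<Longrightarrow> h' (\<tau> x) = \<tau> (h x)" and k: "expo h k"
  shows "expo h' k"
proof -
  note bij = normalizer_bij[OF nrm]
  note tC = bij_in[OF bij] and t_mn = increasing_mn[OF inc bij]
  define G where "G = cross (Suc 0) 0"
  have G: "G \<in> TT" "expo G (-1)" using expo_cross by (simp_all add: G_def)
  obtain G' where G': "G' \<in> TT" "\<And>x. x \<in> C \<Longrightarrow> G' (\<tau> x) = \<tau> (G x)" using normalizer_ex[OF nrm G(1)] by blast
  have fix': "g' mn = mn" if "\<And>x. x \<in> C \<Longrightarrow> g' (\<tau> x) = \<tau> (g x)" "g mn = mn" for g g'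
    using that(1)[OF mn_in] that(2) t_mn by simp
  obtain e where e: "expo G' e" using expo_ex[OF G'(1)] fix'[of G' G, OF G'(2)] expo_mn[OF G(2)] by blast
  have near: "expo g' l"
    if g: "g \<in> TT" "g' \<in> TT" "\<And>x. x \<in> C \<Longrightarrow> g' (\<tau> x) = \<tau> (g x)" "expo g m"
      and f: "f \<in> TT" "f' \<in> TT" "\<And>x. x \<in> C \<Longrightarrow> f' (\<tau> x) = \<tau> (f x)" "expo f m" "expo f' l" for g g' f f' m l
  proof -
    obtain a where a: "\<forall>y\<in>C. val a y = 0 \<longrightarrow> g y = f y" using expo_agree g f by blast
    obtain a' where a': "\<forall>y\<in>C. val a' (\<tau> y) = 0 \<longrightarrow> val a y = 0" using small_preimage[OF inc bij] by blast
    show ?thesis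
    proof (rule expo_cong[OF g(2) f(2,5)])
      fix y assume y: "y \<in> C" "val a' y = 0"
      then obtain x where x: "x \<in> C" "\<tau> x = y" using bij_preimage bij by blast
      then have "g x = f x" using a a' y by blast
      then show "g' y = f' y" using g(3)[OF x(1)] f(3)[OF x(1)] x by simp
    qed
  qed
  have gen: "expo g' (- (m * e))"
    if g: "g \<in> TT" "g' \<in> TT" "\<And>x. x \<in> C \<Longrightarrow> g' (\<tau> x) = \<tau> (g x)" "expo g m" for g g' m
  proof -
    define j where "j = nat \<bar>m\<bar>"
    have P: "G [^]\<^bsub>GT\<^esub> j \<in> TT" "G' [^]\<^bsub>GT\<^esub> j \<in> TT" using gpow_TT G G' by auto
    have E: "expo (G [^]\<^bsub>GT\<^esub> j) (- int j)" "expo (G' [^]\<^bsub>GT\<^esub> j) (int j * e)"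
      using expo_pow[OF G] expo_pow[OF G'(1) e] by simp_all
    have cj: "(G' [^]\<^bsub>GT\<^esub> j) (\<tau> x) = \<tau> ((G [^]\<^bsub>GT\<^esub> j) x)" if "x \<in> C" for x
      using conj_funpow[of G' \<tau> G, OF G'(2) TT_in[OF G(1)] that] gpow_app G(1) G'(1) that tC by simp
    show ?thesis
    proof (cases "m \<le> 0")
      case True
      then have "int j = - m" by (simp add: j_def)
      then show ?thesis using near[OF g P cj, of "int j * e"] E by simp
    next
      case False
      then have jm: "int j = m" by (simp add: j_def)
      have ci: "gi (G' [^]\<^bsub>GT\<^esub> j) (\<tau> x) = \<tau> (gi (G [^]\<^bsub>GT\<^esub> j) x)" if x: "x \<in> C" for x
        using cj[OF gi_in[OF P(1) x]] gi_right[OF P(1) x] gi_eq_iff[OF P(2)] tC gi_in[OF P(1)] x by metis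
      show ?thesis using near[OF g gi_TT[OF P(1)] gi_TT[OF P(2)] ci, of "- (int j * e)"]
          expo_inv[OF P(1) E(1)] expo_inv[OF P(2) E(2)] jm by simp
    qed
  qed
  have "e = -1"
  proof -
    obtain H where H: "H \<in> TT" "\<And>x. x \<in> C \<Longrightarrow> \<tau> (H x) = G (\<tau> x)" using normalizer_ex'[OF nrm G(1)] by blast
    have "\<tau> (H mn) = mn" using H(2)[OF mn_in] t_mn expo_mn[OF G(2)] by simp
    then have "H mn = mn" using bij_eq[OF bij TT_in[OF H(1) mn_in] mn_in] t_mn by simp
    then obtain m where m: "expo H m" using expo_ex H by blast
    have "expo G (- (m * e))" using gen[OF H(1) G(1) _ m] H(2) by simp
    then have "m * e = 1" using expo_unique[OF G(1) G(2), of "- (m * e)"] by simp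
    then have e1: "e = 1 \<or> e = -1" using zmult_eq_1_iff[of m e] by auto
    have "e \<noteq> 1"
    \<comment> \<open>With \<open>e = 1\<close> the inverse of \<open>G'\<close> would move points
      near \<open>mn\<close> up. But \<open>G\<close> moves points near \<open>mn\<close> up, and
      \<tau> is increasing, so \<open>G'\<close> does so too. The contradiction is read off at a
      point \<open>y\<close> close to \<open>mn\<close>.\<close>
    proof
      assume "e = 1"
      then have "expo (gi G') (-1)" using expo_inv[OF G'(1) e] by simp
      then obtain a where a: "\<forall>y\<in>C. val a y = 0 \<and> y \<noteq> mn \<longrightarrow> y \<sqsubset> gi G' y"
        using expo_neg_moves_up[OF gi_TT[OF G'(1)]] by force
      obtain b where b: "\<forall>y\<in>C. val b y = 0 \<and> y \<noteq> mn \<longrightarrow> y \<sqsubset> G y" using expo_neg_moves_up[OF G] by force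
      obtain b' where b': "\<forall>y\<in>C. val b' (\<tau> y) = 0 \<longrightarrow> val b y = 0" using small_preimage[OF inc bij] by blast
      define A where "A = Suc (a + b')"
      define y where "y = lo A 1"
      have yC: "y \<in> C" unfolding y_def A_def using Suc_le_leaves[of "a + b'"] by (intro lo_in) simp
      have vy: "val A y = 1" by (simp add: y_def)
      then have yn: "y \<noteq> mn" by auto
      have "val (a + b') y = 0" using val_Suc_div[OF yC, of "a + b'"] vy n2 by (simp add: A_def del: pval.simps)
      then have v: "val (a + b') y = val (a + b') mn" by simp
      have va: "val a y = 0" "val b' y = 0"
        using val_eq_mono[OF yC mn_in v, of a] val_eq_mono[OF yC mn_in v, of b'] by auto
      obtain x where x: "x \<in> C" "\<tau> x = y" using bij_preimage bij yC by blast
      have "x \<noteq> mn" using x yn t_mn by blast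
      then have "x \<sqsubset> G x" using b b' x va by blast
      then have up: "y \<sqsubset> G' y" using increasingD[OF inc x(1) TT_in[OF G(1) x(1)]] G'(2)[OF x(1)] x(2) by simp
      have "y \<sqsubset> gi G' y" using a yC va yn by blast
      then have "G' y \<sqsubset> y"
        using TT_increasing[OF G'(1) expo_mn[OF e] yC gi_in[OF G'(1) yC]] gi_right[OF G'(1) yC] by simp
      then show False using up lt_asym yC TT_in G' by blast
    qed
    then show ?thesis using e1 by blast
  qed
  then show ?thesis using gen[OF h h' conj k] by simp
qed

definition ascending :: "(inf_word \<Rightarrow> inf_word) \<Rightarrow> bool" where
  "ascending E \<longleftrightarrow> E \<in> TT \<and> E mn = mn \<and> (\<forall>z\<in>C. z \<noteq> mn \<longrightarrow> z \<noteq> mx \<longrightarrow> z \<sqsubset> E z)"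

lemma fix_mx: "g \<in> TT \<Longrightarrow> g mn = mn \<Longrightarrow> g mx = mx"
  using adj_stab[OF _ mx_in mn_in adj_mx_mn] by blast

lemma funpow_TT_in: "E \<in> TT \<Longrightarrow> z \<in> C \<Longrightarrow> (E ^^ m) z \<in> C"
  using funpow_in TT_in by metis

lemma ascending_ge: "ascending E \<Longrightarrow> z \<in> C \<Longrightarrow> \<not> E z \<sqsubset> z"
  unfolding ascending_def using fix_mx lt_asym TT_in lt_irrefl by metis

lemma ascending_funpow_mono:
  assumes E: "ascending E" and z: "z \<in> C" and jm: "j \<le> m"
  shows "\<not> (E ^^ m) z \<sqsubset> (E ^^ j) z"
  using jm
proof (induction m rule: dec_induct)
  case (step m)
  have T: "E \<in> TT" using E by (simp add: ascending_def)
  have "\<not> E ((E ^^ m) z) \<sqsubset> (E ^^ m) z" using ascending_ge[OF E funpow_TT_in[OF T z]] .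
  then show ?case using step le_lt_trans[of "(E ^^ m) z" "E ((E ^^ m) z)" "(E ^^ j) z"] funpow_TT_in[OF T z] TT_in[OF T]
    by auto
qed simp

text \<open>An accumulation point of the orbit other than \<open>mx\<close> would be moved strictly
  up, and by continuity some later point of the orbit would lie beyond it.\<close>

lemma ascending_limit:
  assumes E: "ascending E" and z: "z \<in> C" "z \<noteq> mn" and z': "z' \<in> C" "z' \<noteq> mx"
  shows "\<exists>M. \<forall>m\<ge>M. z' \<sqsubset> (E ^^ m) z"
proof -
  have T: "E \<in> TT" using E by (simp add: ascending_def)
  note fC = funpow_TT_in[OF T z(1)]
  obtain y where y: "y \<in> C" "\<And>N. \<exists>M\<ge>N. val N ((E ^^ M) z) = val N y"
    using accumulation[of "\<lambda>M. (E ^^ M) z"] fC by blast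
  have yge: "\<not> y \<sqsubset> (E ^^ M) z" for M
  proof
    assume "y \<sqsubset> (E ^^ M) z"
    then obtain N where N: "N \<ge> M" "val N y < val N ((E ^^ M) z)" using lt_shift[OF y(1) fC] by blast
    obtain K where K: "K \<ge> N" "val N ((E ^^ K) z) = val N y" using y by blast
    have "val N ((E ^^ M) z) \<le> val N ((E ^^ K) z)"
      using nlt_le[OF ascending_funpow_mono[OF E z(1), of M K], of N] K N by simp
    then show False using K N by simp
  qed
  have "y = mx"
  proof (rule ccontr)
    assume ny: "y \<noteq> mx"
    have "y \<noteq> mn" using yge[of 0] mn_lt[OF z] by auto
    then have "y \<sqsubset> E y" using E ny y(1) by (simp add: ascending_def)
    then obtain N where N: "val N y < val N (E y)" by (auto simp: lt_def)
    obtain M where M: "\<forall>w\<in>C. val M w = val M y \<longrightarrow> val N (E w) = val N (E y)" using TT_cont[OF T y(1)] by blast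
    obtain K where K: "val M ((E ^^ K) z) = val M y" using y by blast
    have "val N ((E ^^ Suc K) z) = val N (E y)" using M K fC by simp
    then have "y \<sqsubset> (E ^^ Suc K) z" unfolding lt_def using N by metis
    then show False using yge by blast
  qed
  then obtain N where N: "val N z' < val N y" using lt_mx[OF z'] by (auto simp: lt_def)
  obtain M where M: "val N ((E ^^ M) z) = val N y" using y by blast
  have "z' \<sqsubset> (E ^^ m) z" if "m \<ge> M" for m
  proof -
    have "z' \<sqsubset> (E ^^ M) z" unfolding lt_def using N M by metis
    then show ?thesis using lt_le_trans[OF z'(1) fC fC] ascending_funpow_mono[OF E z(1) that] by blast
  qed
  then show ?thesis by blast
qed

lemma funpow_increasing:
  assumes "E \<in> TT" "E mn = mn" "x \<in> C" "y \<in> C"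
  shows "(E ^^ m) x \<sqsubset> (E ^^ m) y \<longleftrightarrow> x \<sqsubset> y"
proof -
  have 1: "x \<sqsubset> y \<Longrightarrow> (E ^^ m) x \<sqsubset> (E ^^ m) y" if "x \<in> C" "y \<in> C" for x y
    using that by (induction m) (auto intro: TT_increasing assms funpow_TT_in)
  show ?thesis using 1[OF assms(3,4)] 1[OF assms(4,3)] lt_total[OF assms(3,4)]
      lt_asym[OF funpow_TT_in[OF assms(1,3)] funpow_TT_in[OF assms(1,4)]] lt_irrefl by metis
qed

text \<open>By \<open>expo_conj\<close>, \<open>E\<close> and its conjugate have the same germ at
  \<open>mn\<close>, so \<tau> commutes with \<open>E\<close> near \<open>mn\<close>. The interval
  from \<open>z1\<close> to \<open>z2 = E z1\<close> is a fundamental domain: there \<tau> is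
  bounded by \<open>\<tau> z2\<close>, hence by \<open>(E ^^ m) z1\<close>, and commutation carries
  the bound to all points below \<open>z1\<close> with the same \<open>M\<close>.\<close>

lemma dominates_near_mn:
  assumes nrm: "normalizer \<tau>" and inc: "increasing \<tau>" and E: "ascending E" and e: "expo E (-1)"
  shows "\<exists>M. \<exists>b\<in>C. b \<noteq> mn \<and> (\<forall>m\<ge>M. \<forall>z\<in>C. mn \<sqsubset> z \<longrightarrow> z \<sqsubset> b \<longrightarrow> \<tau> z \<sqsubset> (E ^^ m) z)"
proof -
  note bij = normalizer_bij[OF nrm]
  note tC = bij_in[OF bij] and t_mn = increasing_mn[OF inc bij] and t_mx = increasing_mx[OF inc bij]
  have T: "E \<in> TT" and Emn: "E mn = mn" using E by (simp_all add: ascending_def)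
  note Emx = fix_mx[OF T Emn]
  obtain E' where E': "E' \<in> TT" "\<And>x. x \<in> C \<Longrightarrow> E' (\<tau> x) = \<tau> (E x)" using normalizer_ex[OF nrm T] by blast
  have "expo E' (-1)" using expo_conj[OF nrm inc T E' e] .
  then obtain a where a: "\<forall>y\<in>C. val a y = 0 \<longrightarrow> E' y = E y" using expo_agree[OF E'(1) T _ e] by blast
  have one: "1 < r * n ^ Suc a" using Suc_le_leaves[of a] by simp
  obtain d where d: "d \<in> C" "\<tau> d = lo (Suc a) 1" using bij_preimage[OF bij lo_in[OF one]] by blast
  have comm: "E (\<tau> z) = \<tau> (E z)" if z: "z \<in> C" "z \<sqsubset> d" for z
  proof -
    have "\<tau> z \<sqsubset> lo (Suc a) 1" using increasingD[OF inc z(1) d(1) z(2)] d by simp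
    then have "\<not> 1 \<le> val (Suc a) (\<tau> z)" using lo_least tC z by blast
    then have "val (Suc a) (\<tau> z) = val (Suc a) mn" by (simp del: pval.simps)
    from val_eq_mono[OF tC[OF z(1)] mn_in this, of a] have "val a (\<tau> z) = 0" by simp
    then show ?thesis using a E'(2) tC z by metis
  qed
  have "d \<noteq> mn"
  proof
    assume "d = mn"
    then have "val (Suc a) mn = 1" using d t_mn val_lo[of "Suc a" 1] by metis
    then show False by (simp del: pval.simps)
  qed
  then obtain K where K: "0 < val K d" using mn_lt[OF d(1)] by (auto simp: lt_def)
  \<comment> \<open>The point \<open>d\<close> lies in a leaf of depth \<open>Suc K\<close> with
    number at least \<open>n\<close>, so the smallest point of leaf 1 is strictly between
    \<open>mn\<close> and \<open>d\<close>.\<close>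
  define z1 where "z1 = lo (Suc K) 1"
  have z1: "z1 \<in> C" unfolding z1_def using Suc_le_leaves[of K] by (intro lo_in) simp
  have "2 * 1 \<le> n * val K d" using K n2 by (intro mult_le_mono) auto
  then have "1 < val (Suc K) d" by simp
  then have z1d: "z1 \<sqsubset> d" unfolding lt_def z1_def by (intro exI[of _ "Suc K"]) (simp only: val_lo)
  have "val (Suc K) z1 \<noteq> val (Suc K) mn" unfolding z1_def by (simp only: val_lo val_mn)
  then have z1n: "z1 \<noteq> mn" by auto
  have z1x: "z1 \<noteq> mx" using z1d mx_greatest d by blast
  define z2 where "z2 = E z1"
  have z2: "z2 \<in> C" unfolding z2_def using TT_in T z1 by blast
  have "z2 \<noteq> mx" unfolding z2_def using TT_inj[OF T z1 mx_in] Emx z1x by simp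
  then have "\<tau> z2 \<noteq> mx" using bij_eq[OF bij z2 mx_in] t_mx by simp
  then obtain M where M: "\<forall>m\<ge>M. \<tau> z2 \<sqsubset> (E ^^ m) z1" using ascending_limit[OF E z1 z1n tC[OF z2]] by blast
  have "\<tau> z \<sqsubset> (E ^^ m) z" if m: "m \<ge> M" and z: "z \<in> C" "mn \<sqsubset> z" "z \<sqsubset> z1" for m z
  proof -
    have zn: "z \<noteq> mn" using z by auto
    note fC = funpow_TT_in[OF T z(1)]
    obtain k0 where "z1 \<sqsubset> (E ^^ k0) z" using ascending_limit[OF E z(1) zn z1 z1x] by blast
    then have "\<exists>k. \<not> (E ^^ k) z \<sqsubset> z1" using lt_asym[OF z1 fC] by blast
    \<comment> \<open>The first time at which the orbit of \<open>z\<close> reaches the fundamental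
      domain. Before it the orbit stays below \<open>z1\<close>, where \<tau> commutes with
      \<open>E\<close>.\<close>
    then obtain k where k: "\<not> (E ^^ k) z \<sqsubset> z1" "\<forall>i<k. (E ^^ i) z \<sqsubset> z1"
      using exists_least_iff[of "\<lambda>k. \<not> (E ^^ k) z \<sqsubset> z1"] by auto
    have k0: "k \<noteq> 0" using k(1) z(3) by (cases k) auto
    have "(E ^^ (k - 1)) z \<sqsubset> z1" using k(2) k0 by simp
    then have "E ((E ^^ (k - 1)) z) \<sqsubset> z2" unfolding z2_def using TT_increasing[OF T Emn fC z1] by blast
    moreover have "E ((E ^^ (k - 1)) z) = (E ^^ k) z" using k0 by (cases k) auto
    ultimately have kz2: "(E ^^ k) z \<sqsubset> z2" by simp
    have "i \<le> k \<Longrightarrow> (E ^^ i) (\<tau> z) = \<tau> ((E ^^ i) z)" for i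
    proof (induction i)
      case (Suc i)
      then have "(E ^^ i) z \<sqsubset> d" using k(2) lt_trans[OF fC z1 d(1)] z1d by simp
      then show ?case using Suc comm[OF fC] by simp
    qed simp
    from this[of k] have "(E ^^ k) (\<tau> z) = \<tau> ((E ^^ k) z)" by simp
    also have "\<dots> \<sqsubset> \<tau> z2" using increasingD[OF inc fC z2 kz2] .
    finally have 1: "(E ^^ k) (\<tau> z) \<sqsubset> (E ^^ m) z1"
      using lt_trans[OF _ tC[OF z2] funpow_TT_in[OF T z1]] M m funpow_TT_in[OF T tC[OF z(1)]] by blast
    have "\<not> (E ^^ m) ((E ^^ k) z) \<sqsubset> (E ^^ m) z1" using funpow_increasing[OF T Emn fC z1] k(1) by blast
    then have "(E ^^ k) (\<tau> z) \<sqsubset> (E ^^ m) ((E ^^ k) z)"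
      using lt_le_trans[OF funpow_TT_in[OF T tC[OF z(1)]] funpow_TT_in[OF T z1] funpow_TT_in[OF T fC] 1] by blast
    also have "(E ^^ m) ((E ^^ k) z) = (E ^^ k) ((E ^^ m) z)" by (simp flip: funpow_add comp_apply[of "E ^^ _"] add: add.commute)
    finally show ?thesis using funpow_increasing[OF T Emn tC[OF z(1)] fC] by blast
  qed
  then show ?thesis using z1 z1n by blast
qed

section \<open>Inverses, composites and the reflection as normalizers\<close>

lemma normalizer_inv:
  assumes nrm: "normalizer \<tau>"
  shows "normalizer (inv_into C \<tau>)"
proof -
  note bij = normalizer_bij[OF nrm]
  let ?\<rho> = "inv_into C \<tau>"
  have b: "bij_betw ?\<rho> C C" using bij_betw_inv_into[OF bij] .
  have l: "?\<rho> (\<tau> x) = x" if "x \<in> C" for x using bij_betw_inv_into_left[OF bij that] .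
  have rr: "\<tau> (?\<rho> x) = x" if "x \<in> C" for x using bij_betw_inv_into_right[OF bij that] .
  have 1: "\<exists>h'\<in>TT. \<forall>x\<in>C. h' (?\<rho> x) = ?\<rho> (h x)" if h: "h \<in> TT" for h
  proof -
    obtain h' where h': "h' \<in> TT" "\<forall>x\<in>C. \<tau> (h' x) = h (\<tau> x)" using normalizer_ex'[OF nrm h] by blast
    have "h' (?\<rho> x) = ?\<rho> (h x)" if "x \<in> C" for x
      using h'(2) bij_in[OF b that] rr[OF that] l[OF TT_in[OF h'(1) bij_in[OF b that]]] by simp
    then show ?thesis using h' by blast
  qed
  have 2: "\<exists>h'\<in>TT. \<forall>x\<in>C. ?\<rho> (h' x) = h (?\<rho> x)" if h: "h \<in> TT" for h
  proof -
    obtain h' where h': "h' \<in> TT" "\<forall>x\<in>C. h' (\<tau> x) = \<tau> (h x)" using normalizer_ex[OF nrm h] by blast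
    have "?\<rho> (h' x) = h (?\<rho> x)" if "x \<in> C" for x
      using h'(2) bij_in[OF b that] rr[OF that] l[OF TT_in[OF h bij_in[OF b that]]] by metis
    then show ?thesis using h' by blast
  qed
  show ?thesis unfolding normalizer_def by (intro conjI ballI b 1 2)
qed

lemma normalizer_comp:
  assumes a: "normalizer \<sigma>" and b: "normalizer \<tau>"
  shows "normalizer (\<lambda>x. \<tau> (\<sigma> x))"
proof -
  note ba = normalizer_bij[OF a]
  have 1: "bij_betw (\<lambda>x. \<tau> (\<sigma> x)) C C" using bij_betw_trans[OF ba normalizer_bij[OF b]] by (simp add: o_def)
  have 2: "\<exists>h'\<in>TT. \<forall>x\<in>C. h' (\<tau> (\<sigma> x)) = \<tau> (\<sigma> (h x))" if h: "h \<in> TT" for h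
  proof -
    obtain h1 where h1: "h1 \<in> TT" "\<forall>x\<in>C. h1 (\<sigma> x) = \<sigma> (h x)" using normalizer_ex[OF a h] by blast
    obtain h2 where h2: "h2 \<in> TT" "\<forall>x\<in>C. h2 (\<tau> x) = \<tau> (h1 x)" using normalizer_ex[OF b h1(1)] by blast
    have "h2 (\<tau> (\<sigma> x)) = \<tau> (\<sigma> (h x))" if "x \<in> C" for x using h1 h2 bij_in[OF ba that] that by simp
    then show ?thesis using h2 by blast
  qed
  have 3: "\<exists>h'\<in>TT. \<forall>x\<in>C. \<tau> (\<sigma> (h' x)) = h (\<tau> (\<sigma> x))" if h: "h \<in> TT" for h
  proof -
    obtain h1 where h1: "h1 \<in> TT" "\<forall>x\<in>C. \<tau> (h1 x) = h (\<tau> x)" using normalizer_ex'[OF b h] by blast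
    obtain h2 where h2: "h2 \<in> TT" "\<forall>x\<in>C. \<sigma> (h2 x) = h1 (\<sigma> x)" using normalizer_ex'[OF a h1(1)] by blast
    have "\<tau> (\<sigma> (h2 x)) = h (\<tau> (\<sigma> x))" if "x \<in> C" for x using h1 h2 bij_in[OF ba that] that by simp
    then show ?thesis using h2 by blast
  qed
  show ?thesis unfolding normalizer_def by (intro conjI ballI 1 2 3)
qed

lemma normalizer_flip: "normalizer flip"
proof -
  have 1: "\<forall>x\<in>C. fconj h (flip x) = flip (h x)" for h by (simp add: fconj_app flip_in flip_flip)
  have 2: "\<forall>x\<in>C. flip (fconj h x) = h (flip x)" if "h \<in> TT" for h
    using that by (simp add: fconj_app flip_in TT_in flip_flip)
  show ?thesis unfolding normalizer_def using flip_bij fconj_TT 1 2 by blast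
qed

lemma fconj_funpow: "g \<in> TT \<Longrightarrow> x \<in> C \<Longrightarrow> (fconj g ^^ m) x = flip ((g ^^ m) (flip x))"
  using flip_flip by (induction m) (auto simp: fconj_app flip_in funpow_TT_in)

text \<open>Near \<open>mn\<close> this is \<open>dominates_near_mn\<close>. Near \<open>mx\<close>
  the same lemma is applied to reflected inverses, and between these neighbourhoods a high power
  carries \<open>b1\<close> beyond \<open>\<tau> (flip b2)\<close>. The exponent 1 of
  \<open>fconj E\<close> says that the reflected inverse of \<open>E\<close> has exponent -1 at
  \<open>mn\<close>.\<close>

theorem eventually_dominates:
  assumes nrm: "normalizer \<tau>" and inc: "increasing \<tau>" and E: "ascending E"
    and e: "expo E (-1)" and e': "expo (fconj E) 1"
  shows "\<exists>M. \<forall>m\<ge>M. \<forall>z\<in>C. z \<noteq> mn \<longrightarrow> z \<noteq> mx \<longrightarrow> \<tau> z \<sqsubset> (E ^^ m) z"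
proof -
  note bij = normalizer_bij[OF nrm]
  note tC = bij_in[OF bij] and t_mx = increasing_mx[OF inc bij]
  have T: "E \<in> TT" and Emn: "E mn = mn" using E by (simp_all add: ascending_def)
  note Emx = fix_mx[OF T Emn]
  obtain M1 b1 where 1: "b1 \<in> C" "b1 \<noteq> mn" and bottom: "\<And>m z. m \<ge> M1 \<Longrightarrow> z \<in> C \<Longrightarrow> mn \<sqsubset> z \<Longrightarrow> z \<sqsubset> b1 \<Longrightarrow> \<tau> z \<sqsubset> (E ^^ m) z"
    using dominates_near_mn[OF nrm inc E e] by blast
  define \<rho> where "\<rho> = inv_into C \<tau>"
  have \<rho>: "\<rho> w \<in> C" "\<tau> (\<rho> w) = w" "\<rho> (\<tau> w) = w" if "w \<in> C" for w
    using bij_betw_inv_into_left[OF bij that] bij_betw_inv_into_right[OF bij that]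
      bij_in[OF bij_betw_inv_into[OF bij] that] by (simp_all add: \<rho>_def)
  \<comment> \<open>With \<open>y = (E ^^ m) z\<close>, the inequality
    \<open>\<tau> z \<sqsubset> y\<close> says that the preimage of \<open>y\<close> under
    \<open>E ^^ m\<close> is below its preimage under \<tau>. Reflection reverses this, so the
    inverses of both maps have to be reflected.\<close>
  define \<tau>2 where "\<tau>2 = (\<lambda>x. flip (\<rho> (flip x)))"
  have nrm2: "normalizer \<tau>2"
    unfolding \<tau>2_def \<rho>_def
    using normalizer_comp[OF normalizer_comp[OF normalizer_flip normalizer_inv[OF nrm]] normalizer_flip] .
  have inc2: "increasing \<tau>2"
    unfolding increasing_def
  proof (intro ballI impI)
    fix x y assume xy: "x \<in> C" "y \<in> C" "x \<sqsubset> y"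
    then have "flip y \<sqsubset> flip x" using flip_lt by blast
    then have "\<rho> (flip y) \<sqsubset> \<rho> (flip x)"
      using increasing_iff[OF inc bij \<rho>(1)[OF flip_in[OF xy(2)]] \<rho>(1)[OF flip_in[OF xy(1)]]]
        \<rho>(2)[OF flip_in[OF xy(2)]] \<rho>(2)[OF flip_in[OF xy(1)]] by simp
    then show "\<tau>2 x \<sqsubset> \<tau>2 y" unfolding \<tau>2_def
      using flip_lt[OF \<rho>(1)[OF flip_in[OF xy(1)]] \<rho>(1)[OF flip_in[OF xy(2)]]] by blast
  qed
  define K where "K = fconj (gi E)"
  have K: "K \<in> TT" "K mn = mn"
    using fconj_TT gi_TT T mn_in gi_left[OF T mx_in] Emx by (simp_all add: K_def fconj_app flip_mn flip_mx)
  have Kup: "z \<sqsubset> K z" if z: "z \<in> C" "z \<noteq> mn" "z \<noteq> mx" for z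
  proof -
    define u where "u = gi E (flip z)"
    have u: "u \<in> C" "E u = flip z" using gi_in gi_right T flip_in z by (simp_all add: u_def)
    have "u \<noteq> mn" "u \<noteq> mx" using u(2) Emn Emx z flip_flip flip_mn flip_mx by metis+
    then have "u \<sqsubset> flip z" using E u unfolding ascending_def by metis
    then show ?thesis using flip_lt[OF flip_in[OF z(1)] u(1)] flip_flip[OF z(1)] z
      by (simp add: K_def fconj_app u_def)
  qed
  have aK: "ascending K" unfolding ascending_def using K Kup by blast
  have inv: "K = gi (fconj E)"
  proof (rule TT_ext)
    show "K \<in> TT" "gi (fconj E) \<in> TT" using K gi_TT fconj_TT T by auto
    fix x assume x: "x \<in> C"
    have "fconj E (K x) = x"
      using x T by (simp add: K_def fconj_app flip_in gi_in flip_flip gi_right)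
    then show "K x = gi (fconj E) x" using gi_left[OF fconj_TT[OF T] TT_in[OF K(1) x]] by simp
  qed
  have eK: "expo K (-1)" unfolding inv using expo_inv[OF fconj_TT[OF T] e'] by simp
  obtain M2 b2 where 2: "b2 \<in> C" "b2 \<noteq> mn" "\<And>m z. m \<ge> M2 \<Longrightarrow> z \<in> C \<Longrightarrow> mn \<sqsubset> z \<Longrightarrow> z \<sqsubset> b2 \<Longrightarrow> \<tau>2 z \<sqsubset> (K ^^ m) z"
    using dominates_near_mn[OF nrm2 inc2 aK eK] by blast
  have fb2: "flip b2 \<in> C" "flip b2 \<noteq> mx" using 2 flip_in flip_flip flip_mx by metis+
  have top: "\<tau> z \<sqsubset> (E ^^ m) z" if m: "m \<ge> M2" and z: "z \<in> C" "z \<noteq> mx" "flip b2 \<sqsubset> z" for m z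
  proof -
    define y where "y = (E ^^ m) z"
    have yC: "y \<in> C" using funpow_TT_in T z by (simp add: y_def)
    have "flip b2 \<sqsubset> y"
      using lt_le_trans[OF fb2(1) z(1) yC z(3)] ascending_funpow_mono[OF E z(1), of 0 m] by (simp add: y_def)
    then have a: "flip y \<sqsubset> b2" using flip_lt[OF yC fb2(1)] flip_flip[OF 2(1)] by simp
    have "y \<noteq> mx"
    proof
      assume "y = mx"
      have "(E ^^ m) mx = mx" by (induction m) (auto simp: Emx)
      then have "(E ^^ m) z = (E ^^ m) mx" using \<open>y = mx\<close> by (simp add: y_def)
      then show False using funpow_increasing[OF T Emn z(1) mx_in, of m] lt_mx[OF z(1,2)] by simp
    qed
    then have "flip y \<noteq> mn" using flip_flip yC flip_mn by metis
    then have "mn \<sqsubset> flip y" using mn_lt flip_in yC by blast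
    then have "\<tau>2 (flip y) \<sqsubset> (K ^^ m) (flip y)" using 2(3)[OF m flip_in[OF yC] _ a] by blast
    also have "(K ^^ m) (flip y) = flip ((gi E ^^ m) y)"
      using fconj_funpow[OF gi_TT[OF T] flip_in[OF yC]] flip_flip[OF yC] by (simp add: K_def)
    also have "(gi E ^^ m) y = z"
    proof -
      have "(gi E ^^ m) ((E ^^ m) z) = z" for m
      proof (induction m)
        case (Suc m)
        have "(gi E ^^ Suc m) ((E ^^ Suc m) z) = (gi E ^^ m) (gi E (E ((E ^^ m) z)))" by (simp add: funpow_swap1)
        also have "\<dots> = z" using Suc gi_left[OF T funpow_TT_in[OF T z(1)]] by simp
        finally show ?case .
      qed simp
      then show ?thesis by (simp add: y_def)
    qed
    also have "\<tau>2 (flip y) = flip (\<rho> y)" using flip_flip[OF yC] by (simp add: \<tau>2_def)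
    finally have "z \<sqsubset> \<rho> y" using flip_lt[OF \<rho>(1)[OF yC] z(1)] by blast
    then show ?thesis using increasingD[OF inc z(1) \<rho>(1)[OF yC]] \<rho>(2)[OF yC] by (simp add: y_def)
  qed
  have "\<tau> (flip b2) \<noteq> mx" using bij_eq[OF bij fb2(1) mx_in] t_mx fb2 by simp
  then obtain M3 where mid: "\<forall>m\<ge>M3. \<tau> (flip b2) \<sqsubset> (E ^^ m) b1"
    using ascending_limit[OF E 1(1,2) tC[OF fb2(1)]] by blast
  have "\<tau> z \<sqsubset> (E ^^ m) z" if m: "m \<ge> M1 + M2 + M3" and z: "z \<in> C" "z \<noteq> mn" "z \<noteq> mx" for m z
  proof -
    consider "z \<sqsubset> b1" | "flip b2 \<sqsubset> z" | "\<not> z \<sqsubset> b1" "\<not> flip b2 \<sqsubset> z" by blast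
    then show ?thesis
    proof cases
      case 1
      then show ?thesis using bottom m z mn_lt by simp
    next
      case 2
      then show ?thesis using top m z by simp
    next
      case 3
      have a: "\<not> \<tau> (flip b2) \<sqsubset> \<tau> z" using increasing_iff[OF inc bij fb2(1) z(1)] 3 by blast
      have "\<not> (E ^^ m) z \<sqsubset> (E ^^ m) b1" using funpow_increasing[OF T Emn z(1) 1(1)] 3 by blast
      moreover have "\<tau> (flip b2) \<sqsubset> (E ^^ m) b1" using mid m by simp
      ultimately show ?thesis
        using le_lt_trans[OF tC[OF z(1)] tC[OF fb2(1)] funpow_TT_in[OF T 1(1)] a]
          lt_le_trans[OF tC[OF z(1)] funpow_TT_in[OF T 1(1)] funpow_TT_in[OF T z(1)]] by blast
    qed
  qed
  then show ?thesis by blast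
qed

end

section \<open>Twisted conjugacy classes\<close>

context thompson
begin

lemma two_leaves: "2 \<le> r * n ^ 1"
  using r1 n2 mult_le_mono[of 1 r 2 n] by simp

lemma fconj_mult: "g \<in> TT \<Longrightarrow> h \<in> TT \<Longrightarrow> fconj (g \<odot> h) = fconj g \<odot> fconj h"
  by (rule TT_ext) (auto simp: fconj_TT gm_TT fconj_app mult_app flip_in flip_flip TT_in)

lemma fconj_mn: "g \<in> TT \<Longrightarrow> g mn = mn \<Longrightarrow> fconj g mn = mn"
  by (simp add: fconj_app mn_in flip_mn fix_mx flip_mx)

text \<open>The crossings of the pairs of leaves (0, 1), (1, 2), ... of depth 1, applied in this
  order; with all \<open>r * n - 1\<close> pairs the product moves every interior point up.\<close>

fun pusher :: "nat \<Rightarrow> inf_word \<Rightarrow> inf_word" where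
  "pusher 0 = \<one>\<^bsub>GT\<^esub>"
| "pusher (Suc j) = pusher j \<odot> cross 1 j"

lemma pusher_TT: "j < r * n \<Longrightarrow> pusher j \<in> TT"
  by (induction j) (simp_all add: one_TT gm_TT cross_TT)

lemma cross_mn: "Suc k < r * n ^ N \<Longrightarrow> cross N k mn = mn"
  using cross_lo[of 0 N] cross_out[OF mn_in, of N k] lo_eq_mn[of N] by (cases k) simp_all

lemma expo_cross_0: "0 < k \<Longrightarrow> Suc k < r * n ^ N \<Longrightarrow> expo (cross N k) 0"
  using cross_out[of _ N k] by (intro expo_fixed_nbhd[of _ N] cross_TT) auto

lemma expo_fconj_cross_0: "Suc (Suc k) < r * n ^ N \<Longrightarrow> expo (fconj (cross N k)) 0"
proof (intro expo_fixed_nbhd[of _ N] fconj_TT cross_TT)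
  fix y assume k: "Suc (Suc k) < r * n ^ N" and y: "y \<in> C" "val N y = 0"
  then have "val N (flip y) = r * n ^ N - 1" using val_flip[OF y(1), of N] by simp
  then have "cross N k (flip y) = flip y" using k cross_out[OF flip_in[OF y(1)]] by simp
  then show "fconj (cross N k) y = y" using y flip_flip by (simp add: fconj_app)
qed simp

lemma expo_fconj_cross_top:
  assumes k: "Suc (Suc k) = r * n ^ N"
  shows "expo (fconj (cross N k)) 1"
proof (rule expoI)
  have T: "cross N k \<in> TT" using cross_TT k by simp
  have "val N mx = Suc k" using val_mx[of N] k by simp
  then have "local_at (cross N k) (flip mn) N (Suc N)"
    unfolding flip_mn by (rule cross_local_top[OF mx_in])
  then show "local_at (fconj (cross N k)) mn N (Suc N)" using fconj_local[OF T mn_in] by blast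
  show "fconj (cross N k) mn = mn" using T cross_mn k by (intro fconj_mn) simp_all
qed simp

text \<open>Only the first factor acts near \<open>mn\<close>; likewise only the crossing of the
  last two leaves acts near \<open>mx\<close>.\<close>

lemma expo_pusher: "Suc j < r * n \<Longrightarrow> expo (pusher (Suc j)) (-1)"
proof (induction j)
  case 0
  then have "cross 1 0 \<in> TT" "expo (cross 1 0) (-1)" using expo_cross[of 0] by simp_all
  then show ?case using expo_mult[OF one_TT _ expo_one] by simp
next
  case (Suc j)
  then have "expo (cross 1 (Suc j)) 0" "cross 1 (Suc j) \<in> TT" using expo_cross_0[of "Suc j" 1] cross_TT by simp_all
  then show ?case using expo_mult[OF pusher_TT[of "Suc j"]] Suc by fastforce
qed

lemma expo_fconj_pusher:
  "j < r * n \<Longrightarrow> expo (fconj (pusher j)) (if Suc j = r * n then 1 else 0)"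
proof (induction j)
  case 0
  have "fconj \<one>\<^bsub>GT\<^esub> x = x" if "x \<in> C" for x using that by (simp add: fconj_app flip_in one_app flip_flip)
  then have "expo (fconj \<one>\<^bsub>GT\<^esub>) 0" using expo_fixed_nbhd[OF fconj_TT[OF one_TT], of 0] by blast
  moreover have "Suc 0 \<noteq> r * n" using two_leaves by (simp only: power_one_right)
  ultimately show ?case by (simp only: pusher.simps if_False)
next
  case (Suc j)
  have T: "pusher j \<in> TT" "cross 1 j \<in> TT" using Suc pusher_TT cross_TT by simp_all
  have 1: "expo (fconj (pusher j)) 0" using Suc by simp
  have "expo (fconj (cross 1 j)) (if Suc (Suc j) = r * n then 1 else 0)"
    using Suc expo_fconj_cross_0[of j 1] expo_fconj_cross_top[of j 1] by simp
  then show ?case using expo_mult[OF fconj_TT fconj_TT 1] T by (simp add: fconj_mult)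
qed

text \<open>It is enough that some factor moves the original point \<open>x\<close>: no factor moves
  a point down, and if the earlier factors have left \<open>x\<close> in place, this factor is
  applied to \<open>x\<close> itself.\<close>

lemma pusher_ge:
  assumes x: "x \<in> C"
  shows "j < r * n \<Longrightarrow> \<not> pusher j x \<sqsubset> x \<and> ((\<exists>k<j. cross 1 k x \<noteq> x) \<longrightarrow> x \<sqsubset> pusher j x)"
proof (induction j)
  case 0
  then show ?case using x by (simp add: one_app)
next
  case (Suc j)
  then have jl: "Suc j < r * n ^ 1" by simp
  define p where "p = pusher j x"
  have p: "p \<in> C" using pusher_TT[of j] Suc.prems TT_in x by (simp add: p_def)
  have ge: "\<not> p \<sqsubset> x" "(\<exists>k<j. cross 1 k x \<noteq> x) \<longrightarrow> x \<sqsubset> p" using Suc by (simp_all add: p_def)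
  define q where "q = cross 1 j p"
  have q: "q \<in> C" "\<not> q \<sqsubset> p" using cross_TT(1)[OF jl] TT_in p cross_ge[OF jl p] by (simp_all add: q_def)
  have e: "pusher (Suc j) x = q" using x by (simp add: mult_app p_def q_def)
  have a: "\<not> q \<sqsubset> x" using le_lt_trans[OF p q(1) x q(2)] ge(1) by blast
  have "x \<sqsubset> q" if k: "k < Suc j" "cross 1 k x \<noteq> x" for k
  proof (cases "x \<sqsubset> p")
    case True
    then show ?thesis using lt_le_trans[OF x p q(1)] q(2) by blast
  next
    case False
    then have px: "p = x" using ge(1) lt_total p x by blast
    have "k = j" using False ge(2) k by (metis less_SucE)
    then have "q \<noteq> x" using k px by (simp add: q_def)
    then show ?thesis using q(2) px lt_total[OF q(1) x] by blast
  qed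
  then show ?case unfolding e using a by blast
qed

text \<open>A point of leaf \<open>k\<close> is moved by the crossing with the next leaf, unless it
  is the smallest point of its leaf or the leaf is the last one. An interior point of either
  exceptional kind is moved by the crossing with the preceding leaf.\<close>

lemma pusher_ascending: "ascending (pusher (r * n - 1))"
proof -
  have L: "r * n - 1 < r * n" "r * n ^ 1 = r * n" using two_leaves by simp_all
  have "pusher (r * n - 1) mn = mn"
  proof -
    have "pusher j mn = mn" if "j < r * n" for j
      using that by (induction j) (simp_all add: one_app mult_app mn_in cross_mn)
    then show ?thesis using L by blast
  qed
  moreover have "z \<sqsubset> pusher (r * n - 1) z" if z: "z \<in> C" "z \<noteq> mn" "z \<noteq> mx" for z
  proof -
    define k where "k = val 1 z"
    have k: "k < r * n" using val_bound[OF z(1), of 1] by (simp add: k_def)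
    have "\<exists>j<r * n - 1. cross 1 j z \<noteq> z"
    proof (cases "Suc k < r * n \<and> z \<noteq> lo 1 k")
      case True
      have "val 1 (hi 1 (Suc k)) \<noteq> val 1 z" by (simp only: val_hi k_def[symmetric] n_not_Suc_n not_False_eq_True Suc_n_not_n)
      then have "z \<noteq> hi 1 (Suc k)" by metis
      then have "z \<sqsubset> cross 1 k z" using cross_gt[of k 1 z] True z k_def by simp
      then show ?thesis using True by (intro exI[of _ k]) auto
    next
      case False
      have k0: "0 < k"
      proof (rule ccontr)
        assume "\<not> 0 < k"
        then have "z = lo 1 0" using False two_leaves by simp
        then show False using z lo_eq_mn by simp
      qed
      define j where "j = k - 1"
      have j: "Suc j = k" using k0 by (simp add: j_def)
      have jl: "Suc j < r * n ^ 1" using j k by simp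
      have "val 1 (lo 1 j) \<noteq> val 1 z" using j by (simp only: val_lo k_def[symmetric])
      then have "z \<noteq> lo 1 j" by metis
      moreover have "z \<noteq> hi 1 (Suc j)"
      proof
        assume h: "z = hi 1 (Suc j)"
        show False
        proof (cases "Suc k < r * n")
          case True
          then have "z = lo 1 k" using False by blast
          then have "snd z 1 = 0" by (simp add: lo_def pt_def)
          moreover have "snd z 1 = n - 1" unfolding h by (simp add: hi_def pt_def)
          ultimately show False using n2 by simp
        next
          case False
          then have "k = r * n ^ 1 - 1" using k by simp
          then show False using h j hi_eq_mx[of 1] z by metis
        qed
      qed
      ultimately have "z \<sqsubset> cross 1 j z" using cross_gt[OF jl z(1)] j k_def by simp
      then show ?thesis using j k by (intro exI[of _ j]) auto
    qed
    then show ?thesis using pusher_ge[OF z(1) L(1)] by blast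
  qed
  ultimately show ?thesis unfolding ascending_def using pusher_TT[OF L(1)] by blast
qed

lemma no_adj_mx: "a \<in> C \<Longrightarrow> \<not> adj a mx"
proof
  assume a: "a \<in> C" "adj a mx"
  then obtain N where N: "mx = lo N (val N mx)" using adj_right_lo mx_in by blast
  have "snd mx N = 0" by (subst N) (simp add: lo_def pt_def)
  then show False using n2 by (simp add: mx_def)
qed

text \<open>
  \<open>linked \<tau> x y h h'\<close> says that the homeomorphisms \<open>\<tau>\<inverse>x\<close> and \<open>\<tau>\<inverse>y\<close> are conjugate by \<open>h\<close>.
\<close>

definition linked :: "(inf_word \<Rightarrow> inf_word) \<Rightarrow> (inf_word \<Rightarrow> inf_word) \<Rightarrow> (inf_word \<Rightarrow> inf_word) \<Rightarrow>
    (inf_word \<Rightarrow> inf_word) \<Rightarrow> (inf_word \<Rightarrow> inf_word) \<Rightarrow> bool" where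
  "linked \<tau> x y h h' \<longleftrightarrow> h \<in> TT \<and> h' \<in> TT \<and> (\<forall>v\<in>C. h' (\<tau> v) = \<tau> (h v)) \<and> (\<forall>v\<in>C. y (h v) = h' (x v))"

lemma linked_mult: "linked \<tau> x y h h' \<Longrightarrow> x \<in> TT \<Longrightarrow> y \<in> TT \<Longrightarrow> h \<odot> y = x \<odot> h'"
  unfolding linked_def by (intro TT_ext) (auto simp: gm_TT mult_app)

lemma linked_back:
  assumes a: "linked \<tau> x z h h'" and b: "linked \<tau> y z g g'" and \<tau>: "bij_betw \<tau> C C" and x: "x \<in> TT" and y: "y \<in> TT"
  shows "linked \<tau> x y (h \<odot> gi g) (h' \<odot> gi g')"
proof -
  have T: "h \<in> TT" "h' \<in> TT" "g \<in> TT" "g' \<in> TT" using a b by (simp_all add: linked_def)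
  have "gi g' (h' (\<tau> v)) = \<tau> (gi g (h v))" if v: "v \<in> C" for v
  proof -
    have u: "gi g (h v) \<in> C" using gi_in T TT_in v by blast
    have "g' (\<tau> (gi g (h v))) = \<tau> (g (gi g (h v)))" using b u by (simp add: linked_def)
    also have "\<dots> = \<tau> (h v)" using gi_right[OF T(3) TT_in[OF T(1) v]] by simp
    also have "\<dots> = h' (\<tau> v)" using a v by (simp add: linked_def)
    finally show ?thesis using gi_left[OF T(4) bij_in[OF \<tau> u]] by simp
  qed
  moreover have "y (gi g (h v)) = gi g' (h' (x v))" if v: "v \<in> C" for v
  proof -
    have u: "gi g (h v) \<in> C" using gi_in T TT_in v by blast
    have "g' (y (gi g (h v))) = z (g (gi g (h v)))" using b u by (simp add: linked_def)
    also have "\<dots> = z (h v)" using gi_right[OF T(3) TT_in[OF T(1) v]] by simp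
    also have "\<dots> = h' (x v)" using a v by (simp add: linked_def)
    finally show ?thesis using gi_left[OF T(4) TT_in[OF y u]] by simp
  qed
  ultimately show ?thesis unfolding linked_def using T gm_TT gi_TT bij_in[OF \<tau>] TT_in[OF x] by (simp add: mult_app)
qed

text \<open>Once \<open>h\<close> fixes \<open>mn\<close>, \<open>h\<close> and \<open>h'\<close>
  have the same exponent by \<open>expo_conj\<close>, and it cancels in
  \<open>h \<odot> X i = X j \<odot> h'\<close>.\<close>

lemma increasing_unlinked:
  assumes nrm: "normalizer \<tau>" and inc: "increasing \<tau>"
  shows "\<exists>X :: nat \<Rightarrow> _. (\<forall>i. X i \<in> TT) \<and> (\<forall>i. finite {j. \<exists>h h'. linked \<tau> (X j) (X i) h h'})"
proof -
  note bij = normalizer_bij[OF nrm]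
  define G where "G = pusher (r * n - 1)"
  have aG: "ascending G" unfolding G_def by (rule pusher_ascending)
  then have T: "G \<in> TT" and Gmn: "G mn = mn" by (simp_all add: ascending_def)
  obtain j where j: "r * n - 1 = Suc j" "Suc j < r * n" using two_leaves by (cases "r * n - 1") auto
  have e: "expo G (-1)" unfolding G_def j(1) using expo_pusher j by blast
  have e': "expo (fconj G) 1" unfolding G_def using expo_fconj_pusher[OF j(2)] j by (simp only: if_True refl split: if_splits)
  obtain M where M: "\<And>m z. m \<ge> M \<Longrightarrow> z \<in> C \<Longrightarrow> z \<noteq> mn \<Longrightarrow> z \<noteq> mx \<Longrightarrow> \<tau> z \<sqsubset> (G ^^ m) z"
    using eventually_dominates[OF nrm inc aG e e'] by blast
  define X where "X i = G [^]\<^bsub>GT\<^esub> (M + i)" for i :: nat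
  have XT: "X i \<in> TT" for i using gpow_TT T by (simp add: X_def)
  have Xe: "expo (X i) (- int (M + i))" for i using expo_pow[OF T e, of "M + i"] by (simp add: X_def)
  have "j = i" if l: "linked \<tau> (X j) (X i) h h'" for i j h h'
  proof -
    have H: "h \<in> TT" "h' \<in> TT" "\<And>v. v \<in> C \<Longrightarrow> h' (\<tau> v) = \<tau> (h v)" "\<And>v. v \<in> C \<Longrightarrow> X i (h v) = h' (X j v)"
      using l by (auto simp: linked_def)
    define w where "w = h mn"
    have w: "w \<in> C" using TT_in H mn_in by (simp add: w_def)
    \<comment> \<open>Both \<tau> and \<open>X j\<close> fix \<open>mn\<close>, so they agree there;
      the link carries this agreement to \<tau> and \<open>X i\<close> at \<open>w = h mn\<close>.
      By domination \<tau> and \<open>X i\<close> agree only at the ends.\<close>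
    have "X i w = \<tau> w"
      using H(3)[OF mn_in] H(4)[OF mn_in] increasing_mn[OF inc bij] expo_mn[OF Xe[of j]] by (simp add: w_def)
    then have "(G ^^ (M + i)) w = \<tau> w" using gpow_app[OF T w] by (simp add: X_def)
    then have "\<not> \<tau> w \<sqsubset> (G ^^ (M + i)) w" by simp
    then have "w = mn \<or> w = mx" using M[of "M + i" w] w by (meson le_add1)
    moreover have "w \<noteq> mx"
    proof
      assume "w = mx"
      then have "adj (h mx) mx" using TT_adj[OF H(1) mx_in mn_in] adj_mx_mn by (simp add: w_def)
      then show False using no_adj_mx TT_in[OF H(1) mx_in] by blast
    qed
    ultimately have hm: "h mn = mn" by (simp add: w_def)
    obtain k where k: "expo h k" using expo_ex H hm by blast
    have k': "expo h' k" using expo_conj[OF nrm inc H(1,2,3) k] .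
    have "expo (h \<odot> X i) (k + - int (M + i))" using expo_mult[OF H(1) XT k Xe] .
    moreover have "expo (h \<odot> X i) (- int (M + j) + k)"
      unfolding linked_mult[OF l XT XT] using expo_mult[OF XT H(2) Xe k'] .
    ultimately have "k + - int (M + i) = - int (M + j) + k" using expo_unique[OF gm_TT[OF H(1) XT]] by blast
    then show ?thesis by simp
  qed
  then have "{j. \<exists>h h'. linked \<tau> (X j) (X i) h h'} \<subseteq> {i}" for i by blast
  then have "finite {j. \<exists>h h'. linked \<tau> (X j) (X i) h h'}" for i using finite_subset by blast
  then show ?thesis using XT by blast
qed

text \<open>Let \<open>h\<close> fix \<open>mn\<close> and have exponents \<open>k\<close> at
  \<open>mn\<close> and \<open>k2\<close> at \<open>mx\<close>. As \<tau> exchanges the ends, those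
  of \<open>h'\<close> are \<open>k2\<close> and \<open>k\<close>. The link gives
  \<open>k - i = k2 - j\<close> at \<open>mn\<close> and \<open>k2 = k\<close> at \<open>mx\<close>,
  hence \<open>i = j\<close>.\<close>

lemma decreasing_unlinked:
  assumes nrm: "normalizer \<tau>" and dec: "\<And>x y. x \<in> C \<Longrightarrow> y \<in> C \<Longrightarrow> x \<sqsubset> y \<Longrightarrow> \<tau> y \<sqsubset> \<tau> x"
    and sw: "\<tau> mn = mx" "\<tau> mx = mn"
  shows "\<exists>X :: nat \<Rightarrow> _. (\<forall>i. X i \<in> TT) \<and> (\<forall>i. finite {j. \<exists>h h'. linked \<tau> (X j) (X i) h h'})"
proof -
  note bij = normalizer_bij[OF nrm]
  note tC = bij_in[OF bij]
  \<comment> \<open>Depth 2 has a leaf beyond the first two even for \<open>n = 2\<close> and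
    \<open>r = 1\<close>, so crossing the first two leaves is the identity near
    \<open>mx\<close>.\<close>
  have N2: "Suc (Suc 0) < r * n ^ Suc 1"
  proof -
    have "1 * (2 * 2) \<le> r * (n * n)" using r1 n2 by (intro mult_le_mono) auto
    then show ?thesis by simp
  qed
  define c where "c = cross (Suc 1) 0"
  have T: "c \<in> TT" and e: "expo c (-1)" using expo_cross[of 1] by (simp_all add: c_def)
  have e': "expo (fconj c) 0" unfolding c_def using expo_fconj_cross_0[OF N2] .
  define X where "X i = c [^]\<^bsub>GT\<^esub> i" for i :: nat
  have XT: "X i \<in> TT" for i using gpow_TT T by (simp add: X_def)
  have Xe: "expo (X i) (- int i)" for i using expo_pow[OF T e, of i] by (simp add: X_def)
  have Xe': "expo (fconj (X i)) 0" for i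
  proof -
    have "fconj (X i) = fconj c [^]\<^bsub>GT\<^esub> i"
    proof (induction i)
      case 0
      show ?case
        by (rule TT_ext) (auto simp: X_def fconj_TT one_TT fconj_app one_app flip_in flip_flip)
    next
      case (Suc i)
      then show ?case using fconj_mult[OF gpow_TT[OF T] T] by (simp add: X_def)
    qed
    then show ?thesis using expo_pow[OF fconj_TT[OF T] e', of i] by simp
  qed
  have Xmn: "X i mn = mn" and Xmx: "X i mx = mx" for i
    using expo_mn[OF Xe] fix_mx[OF XT] by auto
  have fixed: "j = i" if l: "linked \<tau> (X j) (X i) h h'" and hm: "h mn = mn" for i j h h'
  proof -
    have H: "h \<in> TT" "h' \<in> TT" "\<And>v. v \<in> C \<Longrightarrow> h' (\<tau> v) = \<tau> (h v)" "\<And>v. v \<in> C \<Longrightarrow> X i (h v) = h' (X j v)"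
      using l by (auto simp: linked_def)
    have inc1: "increasing (\<lambda>x. flip (\<tau> x))" unfolding increasing_def using dec flip_lt tC by blast
    have inc2: "increasing (\<lambda>x. \<tau> (flip x))" unfolding increasing_def using dec flip_lt flip_in by blast
    obtain k where k: "expo h k" using expo_ex H hm by blast
    obtain k2 where k2: "expo (fconj h) k2" using expo_ex fconj_TT fconj_mn H hm by blast
    have h2: "expo (fconj h') k"
    proof (rule expo_conj[OF normalizer_comp[OF nrm normalizer_flip] inc1 H(1) fconj_TT[OF H(2)] _ k])
      show "fconj h' (flip (\<tau> x)) = flip (\<tau> (h x))" if "x \<in> C" for x
        using that H(3) tC flip_flip flip_in by (simp add: fconj_app)
    qed
    have h1: "expo h' k2"
    proof (rule expo_conj[OF normalizer_comp[OF normalizer_flip nrm] inc2 fconj_TT[OF H(1)] H(2) _ k2])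
      show "h' (\<tau> (flip x)) = \<tau> (flip (fconj h x))" if "x \<in> C" for x
        using that H(3)[OF flip_in[OF that]] TT_in[OF H(1) flip_in[OF that]] flip_flip by (simp add: fconj_app)
    qed
    have "expo (h \<odot> X i) (k + - int i)" using expo_mult[OF H(1) XT k Xe] .
    moreover have "expo (h \<odot> X i) (- int j + k2)"
      unfolding linked_mult[OF l XT XT] using expo_mult[OF XT H(2) Xe h1] .
    ultimately have 1: "k + - int i = - int j + k2" using expo_unique[OF gm_TT[OF H(1) XT]] by blast
    have "expo (fconj (h \<odot> X i)) (k2 + 0)"
      unfolding fconj_mult[OF H(1) XT] using expo_mult[OF fconj_TT[OF H(1)] fconj_TT[OF XT] k2 Xe'] .
    moreover have "expo (fconj (h \<odot> X i)) (0 + k)"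
      unfolding linked_mult[OF l XT XT] fconj_mult[OF XT H(2)]
      using expo_mult[OF fconj_TT[OF XT] fconj_TT[OF H(2)] Xe' h2] .
    ultimately have "k2 + 0 = 0 + k" using expo_unique[OF fconj_TT[OF gm_TT[OF H(1) XT]]] by blast
    then show ?thesis using 1 by simp
  qed
  \<comment> \<open>The upper ends of the gaps exchanged by \<open>X i\<close> followed by the
    inverse of \<tau>. For \<open>X j\<close> the base gap is exchanged, and a link carries it to a
    gap counted in \<open>Z i\<close>.\<close>
  define Z where "Z i = {w \<in> C. \<exists>u\<in>C. adj u w \<and> X i w = \<tau> u \<and> X i u = \<tau> w}" for i
  have Z: "h mn \<in> Z i" if l: "linked \<tau> (X j) (X i) h h'" for i j h h'
  proof -
    have H: "h \<in> TT" "h' \<in> TT" "\<And>v. v \<in> C \<Longrightarrow> h' (\<tau> v) = \<tau> (h v)" "\<And>v. v \<in> C \<Longrightarrow> X i (h v) = h' (X j v)"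
      using l by (auto simp: linked_def)
    have "adj (h mx) (h mn)" using TT_adj[OF H(1) mx_in mn_in] adj_mx_mn by blast
    moreover have "X i (h mn) = \<tau> (h mx)" using H(4)[OF mn_in] H(3)[OF mx_in] Xmn sw by simp
    moreover have "X i (h mx) = \<tau> (h mn)" using H(4)[OF mx_in] H(3)[OF mn_in] Xmx sw by simp
    ultimately show ?thesis unfolding Z_def using TT_in[OF H(1)] mn_in mx_in by blast
  qed
  \<comment> \<open>For two such gaps away from the base, the increasing map \<open>X i\<close>
    would order \<open>\<tau> w\<close> and \<open>\<tau> w'\<close> as the gaps are ordered,
    against \<tau> being decreasing.\<close>
  have Zlt: "w' = mn" if w: "w \<in> Z i" "w' \<in> Z i" "w \<noteq> mn" "w' \<sqsubset> w \<or> w \<sqsubset> w'" for w w' i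
  proof (rule ccontr)
    have contra: False if w: "w \<in> Z i" "w' \<in> Z i" "w \<noteq> mn" "w' \<noteq> mn" "w \<sqsubset> w'" for w w'
    proof -
      obtain u where u: "u \<in> C" "adj u w" "X i u = \<tau> w" and wC: "w \<in> C" using w(1) unfolding Z_def by blast
      obtain u' where u': "u' \<in> C" "adj u' w'" "X i u' = \<tau> w'" and wC': "w' \<in> C" using w(2) unfolding Z_def by blast
      have "u \<sqsubset> w" using adj_gt[OF u(2) _ u(1) wC] lt_total[OF u(1) wC] u(2) w(3) unfolding adj_def by blast
      moreover have "u' \<sqsubset> w'" using adj_gt[OF u'(2) _ u'(1) wC'] lt_total[OF u'(1) wC'] u'(2) w(4) unfolding adj_def by blast
      then have "\<not> u' \<sqsubset> w" using adj_lt[OF u'(2) _ wC] w(5) by blast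
      ultimately have "u \<sqsubset> u'" using lt_le_trans[OF u(1) wC u'(1)] by blast
      then have "\<tau> w \<sqsubset> \<tau> w'" using TT_increasing[OF XT Xmn u(1) u'(1)] u u' by metis
      then show False using dec[OF wC wC' w(5)] lt_asym[OF tC[OF wC] tC[OF wC']] by blast
    qed
    assume "w' \<noteq> mn"
    then show False using contra[of w w'] contra[of w' w] w by blast
  qed
  have "finite {j. \<exists>h h'. linked \<tau> (X j) (X i) h h'}" (is "finite ?J") for i
  proof -
    \<comment> \<open>Both \<open>h\<close> and \<open>g\<close> carry \<open>mn\<close> to the one
      exceptional gap, so \<open>h \<odot> gi g\<close> fixes \<open>mn\<close> and links
      \<open>X j\<close> with \<open>X k\<close>; the case of a fixed base gap applies to
      it.\<close>
    have "j = k" if jk: "j \<in> ?J" "k \<in> ?J" "j \<noteq> i" "k \<noteq> i" for j k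
    proof -
      obtain h h' where h: "linked \<tau> (X j) (X i) h h'" using jk by blast
      obtain g g' where g: "linked \<tau> (X k) (X i) g g'" using jk by blast
      have n: "h mn \<noteq> mn" "g mn \<noteq> mn" using fixed h g jk by blast+
      have hT: "h \<in> TT" "g \<in> TT" using h g by (auto simp: linked_def)
      have "\<not> (g mn \<sqsubset> h mn \<or> h mn \<sqsubset> g mn)" using Zlt[OF Z[OF h] Z[OF g]] n by blast
      then have "h mn = g mn" using lt_total TT_in hT mn_in by blast
      then have "(h \<odot> gi g) mn = mn" using gi_left[OF hT(2) mn_in] mn_in by (simp add: mult_app)
      then show ?thesis using fixed[OF linked_back[OF h g bij XT XT]] by blast
    qed
    then have "\<exists>a. ?J \<subseteq> {i, a}" by (cases "?J \<subseteq> {i}") blast+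
    then obtain a where "?J \<subseteq> {i, a}" ..
    then show ?thesis by (rule finite_subset) simp
  qed
  then show ?thesis using XT by blast
qed

section \<open>From links to twisted conjugacy classes\<close>

lemma twisted_conj_refl:
  assumes \<phi>: "\<phi> \<in> iso GT GT" and x: "x \<in> TT"
  shows "(x, x) \<in> twisted_conj GT \<phi>"
  using x one_TT auto_one[OF GT.is_group \<phi>] unfolding twisted_conj_def
  by (auto intro!: bexI[of _ "\<one>\<^bsub>GT\<^esub>"])

text \<open>With finitely many classes, infinitely many \<open>X j\<close> would have the same image
  under \<open>R\<close> as some \<open>X i\<close>; reflexivity at \<open>X i\<close> puts
  \<open>X i\<close> into that image, against finiteness.\<close>

lemma infinite_classes:
  fixes R :: "('b \<times> 'b) set" and X :: "nat \<Rightarrow> 'b"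
  assumes X: "\<And>i. X i \<in> A" and refl: "\<And>i. (X i, X i) \<in> R" and fin: "\<And>i. finite {j. (X j, X i) \<in> R}"
  shows "infinite (A // R)"
proof
  assume f: "finite (A // R)"
  have "finite (range (\<lambda>j. R `` {X j}))"
    by (rule finite_subset[OF _ f]) (auto intro: quotientI X)
  then obtain i where i: "infinite {j. R `` {X j} = R `` {X i}}"
    using pigeonhole_infinite[of UNIV "\<lambda>j. R `` {X j}"] by auto
  have "(X j, X i) \<in> R" if "R `` {X j} = R `` {X i}" for j using that refl[of i] by blast
  then have "{j. R `` {X j} = R `` {X i}} \<subseteq> {j. (X j, X i) \<in> R}" by blast
  then show False using i fin finite_subset by blast
qed

theorem R_infinity_GT: "R_infinity GT"
  unfolding R_infinity_def
proof
  fix \<phi> assume \<phi>: "\<phi> \<in> iso GT GT"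
  note aut = auto_closed[OF GT.is_group \<phi>, unfolded carrier_GT]
  obtain \<sigma> where bij: "bij_betw \<sigma> C C" and cont: "inverse_continuous \<sigma>"
    and eqv: "\<And>t x. t \<in> TT \<Longrightarrow> x \<in> C \<Longrightarrow> \<sigma> (t x) = \<phi> t (\<sigma> x)"
    using automorphism_spatial[OF \<phi>] by blast
  have nrm: "normalizer \<sigma>"
    unfolding normalizer_def
  proof (intro conjI bij ballI)
    fix h assume h: "h \<in> TT"
    show "\<exists>h'\<in>TT. \<forall>x\<in>C. h' (\<sigma> x) = \<sigma> (h x)"
      using eqv[OF h] aut[OF h] by (intro bexI[of _ "\<phi> h"]) simp_all
    have "\<exists>g\<in>TT. \<phi> g = h" using auto_surj[OF GT.is_group \<phi>, of h] h by simp
    then obtain g where "g \<in> TT" "\<phi> g = h" by blast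
    then show "\<exists>h'\<in>TT. \<forall>x\<in>C. \<sigma> (h' x) = h (\<sigma> x)" using eqv by blast
  qed
  have sC: "\<sigma> mn \<in> C" "\<sigma> mx \<in> C" using bij_in[OF bij] mn_in mx_in by auto
  have "gap (\<sigma> mx) (\<sigma> mn)" using normalizer_gap[OF nrm mx_in mn_in] adj_mx_mn by (simp add: gap_def)
  then consider "adj (\<sigma> mx) (\<sigma> mn)" | "adj (\<sigma> mn) (\<sigma> mx)" unfolding gap_def by blast
  then have "\<exists>t\<in>TT. {t (\<sigma> mn), t (\<sigma> mx)} = {mn, mx}"
  proof cases
    case 1
    then obtain t where "t \<in> TT" "t (\<sigma> mn) = mn" "t (\<sigma> mx) = mx" using TT_move_to_mn sC by blast
    then show ?thesis by (intro bexI[of _ t]) simp_all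
  next
    case 2
    then obtain t where "t \<in> TT" "t (\<sigma> mx) = mn" "t (\<sigma> mn) = mx" using TT_move_to_mn sC by blast
    then show ?thesis by (intro bexI[of _ t]) (simp_all add: insert_commute)
  qed
  then obtain t where t: "t \<in> TT" "{t (\<sigma> mn), t (\<sigma> mx)} = {mn, mx}" by blast
  define \<tau> where "\<tau> = (\<lambda>x. t (\<sigma> x))"
  have ntT: "normalizer t"
    unfolding normalizer_def
  proof (intro conjI ballI TT_bij t(1))
    fix h assume h: "h \<in> TT"
    have "(gi t \<odot> h \<odot> t) (t x) = t (h x)" if "x \<in> C" for x
      using that t(1) h by (simp add: mult_app TT_in gi_left)
    then show "\<exists>h'\<in>TT. \<forall>x\<in>C. h' (t x) = t (h x)"
      using gm_TT gi_TT t(1) h by (intro bexI[of _ "gi t \<odot> h \<odot> t"]) simp_all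
    have "t ((t \<odot> h \<odot> gi t) x) = h (t x)" if "x \<in> C" for x
      using that t(1) h by (simp add: mult_app TT_in gi_right)
    then show "\<exists>h'\<in>TT. \<forall>x\<in>C. t (h' x) = h (t x)"
      using gm_TT gi_TT t(1) h by (intro bexI[of _ "t \<odot> h \<odot> gi t"]) simp_all
  qed
  have nt: "normalizer \<tau>" unfolding \<tau>_def using normalizer_comp[OF nrm ntT] .
  note tbij = normalizer_bij[OF nt]
  have ct: "inverse_continuous \<tau>"
    unfolding inverse_continuous_def
  proof (intro ballI allI)
    fix x N assume x: "x \<in> C"
    have sx: "\<sigma> x \<in> C" using bij_in[OF bij x] .
    obtain M where M: "\<forall>y\<in>C. val M (\<sigma> y) = val M (\<sigma> x) \<longrightarrow> val N y = val N x"
      using cont x unfolding inverse_continuous_def by blast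
    obtain K where K: "\<forall>y\<in>C. val K y = val K (t (\<sigma> x)) \<longrightarrow> val M (gi t y) = val M (gi t (t (\<sigma> x)))"
      using TT_cont[OF gi_TT[OF t(1)] TT_in[OF t(1) sx]] by blast
    have "val N y = val N x" if y: "y \<in> C" "val K (\<tau> y) = val K (\<tau> x)" for y
    proof -
      have sy: "\<sigma> y \<in> C" using bij_in[OF bij y(1)] .
      have "val M (gi t (t (\<sigma> y))) = val M (gi t (t (\<sigma> x)))"
        using K TT_in[OF t(1) sy] y(2) by (simp add: \<tau>_def)
      then show ?thesis using M y(1) gi_left[OF t(1) sx] gi_left[OF t(1) sy] by simp
    qed
    then show "\<exists>M. \<forall>y\<in>C. val M (\<tau> y) = val M (\<tau> x) \<longrightarrow> val N y = val N x" by blast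
  qed
  have base: "\<tau> mn = mn \<and> \<tau> mx = mx \<or> \<tau> mn = mx \<and> \<tau> mx = mn"
    using t(2) by (auto simp: \<tau>_def doubleton_eq_iff)
  have mono: "if \<tau> mn = mn then \<tau> z \<sqsubset> \<tau> z' else \<tau> z' \<sqsubset> \<tau> z" if "z \<in> C" "z' \<in> C" "z \<sqsubset> z'" for z z'
    using monotone_or_antitone[OF tbij normalizer_gap[OF nt] ct base that] .
  have "\<exists>X :: nat \<Rightarrow> _. (\<forall>i. X i \<in> TT) \<and> (\<forall>i. finite {j. \<exists>h h'. linked \<tau> (X j) (X i) h h'})"
  proof (cases "\<tau> mn = mn")
    case True
    then have "increasing \<tau>" unfolding increasing_def using mono by simp
    then show ?thesis using increasing_unlinked[OF nt] by blast
  next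
    case False
    then have sw: "\<tau> mn = mx" "\<tau> mx = mn" using base by blast+
    have "\<tau> z' \<sqsubset> \<tau> z" if "z \<in> C" "z' \<in> C" "z \<sqsubset> z'" for z z'
      using mono[OF that] False by simp
    then show ?thesis by (rule decreasing_unlinked[OF nt _ sw])
  qed
  then obtain X :: "nat \<Rightarrow> _" where X: "\<And>i. X i \<in> TT" "\<And>i. finite {j. \<exists>h h'. linked \<tau> (X j) (X i) h h'}" by blast
  \<comment> \<open>The factor \<open>gi t\<close> compensates for the passage from \<sigma> to
    \<tau>: it turns twisting by \<phi> into twisting by conjugation with \<tau>.\<close>
  define Y where "Y i = X i \<odot> gi t" for i
  have YT: "Y i \<in> TT" for i unfolding Y_def using gm_TT gi_TT X(1) t(1) by simp
  have link: "\<exists>h h'. linked \<tau> (X j) (X i) h h'" if R: "(Y j, Y i) \<in> twisted_conj GT \<phi>" for i j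
  proof -
    have "\<exists>h\<in>TT. gi h \<odot> Y j \<odot> \<phi> h = Y i"
      using R by (simp add: twisted_conj_def)
    then obtain h where h: "h \<in> TT" "gi h \<odot> Y j \<odot> \<phi> h = Y i" by blast
    \<comment> \<open>As maps act on the right, this is the conjugate of \<open>\<phi> h\<close> by
      \<open>t\<close>, and therefore the conjugate of \<open>h\<close> by \<tau>.\<close>
    define h' where "h' = gi t \<odot> \<phi> h \<odot> t"
    have h'T: "h' \<in> TT" unfolding h'_def using gm_TT gi_TT t(1) aut h(1) by simp
    have "h' (\<tau> v) = \<tau> (h v)" if v: "v \<in> C" for v
    proof -
      have "\<sigma> v \<in> C" using bij_in[OF bij v] .
      then show ?thesis using eqv[OF h(1) v] gi_left[OF t(1)] TT_in[OF t(1)] by (simp add: h'_def \<tau>_def mult_app)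
    qed
    moreover have "X i (h v) = h' (X j v)" if v: "v \<in> C" for v
    proof -
      have hv: "h v \<in> C" using TT_in h v by blast
      have "Y i (h v) = \<phi> h (Y j v)" using hv v gi_left[OF h(1) v] by (simp add: mult_app flip: h(2))
      then have "gi t (X i (h v)) = \<phi> h (gi t (X j v))" using hv v by (simp add: Y_def mult_app)
      then have "t (gi t (X i (h v))) = t (\<phi> h (gi t (X j v)))" by simp
      then show ?thesis using gi_right[OF t(1) TT_in[OF X(1) hv]] TT_in[OF X(1) v] by (simp add: h'_def mult_app)
    qed
    ultimately show ?thesis unfolding linked_def using h(1) h'T by blast
  qed
  have "finite {j. (Y j, Y i) \<in> twisted_conj GT \<phi>}" for i
    by (rule finite_subset[OF _ X(2)[of i]]) (use link in blast)
  then show "infinite (carrier GT // twisted_conj GT \<phi>)"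
    using infinite_classes[of Y "carrier GT" "twisted_conj GT \<phi>"] YT twisted_conj_refl[OF \<phi> YT] by simp
qed

end

theorem theorem1p11:
  fixes n r :: nat
  assumes "2 \<le> n" and "1 \<le> r" and "r \<le> n - 1"
  shows "R_infinity (T_group n r)"
proof -
  interpret thompson n r using assms(1,2) by unfold_locales
  show ?thesis using R_infinity_GT by (simp add: GT_def)
qed

end
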